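(* Fix $\delta\in\mathbb{R}$ and $\tau\in(0,1)$, let $\rho=\rho_N=\frac12+\delta 2^{-4/3}N^{-1/3}$, and let $$\mathcal{L}_N^{\mathrm{st},\rho}(0,1)=\frac{L^{\mathrm{st},\rho}(N,N)-4N}{2^{4/3}N^{1/3}},\qquad \mathcal{L}_N^{\mathrm{st},\rho}(0,\tau)=\frac{L^{\mathrm{st},\rho}(\tau N,\tau N)-4\tau N}{2^{4/3}N^{1/3}}$$ be the rescaled stationary half-space last passage times, both computed in the same random environment. Then $$\lim_{N\to\infty}\mathrm{Cov}\big(\mathcal{L}_N^{\mathrm{st},\rho}(0,1),\mathcal{L}_N^{\mathrm{st},\rho}(0,\tau)\big)=\tfrac12\mathrm{Var}\big(\mathcal{A}^{\mathrm{st,hs}}_{\delta}(0)\big)+\tfrac12\tau^{2/3}\,\mathrm{Var}\big(\mathcal{A}^{\mathrm{st,hs}}_{\delta\tau^{1/3}}(0)\big)-\tfrac12(1-\tau)^{2/3}\,\mathrm{Var}\big(\mathcal{A}^{\mathrm{st,hs}}_{\delta(1-\tau)^{1/3}}(0)\big).$$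
   Context: Half-space last passage percolation (LPP): given weights $\omega_{i,j}$ on $\{(i,j)\in\mathbb{Z}^2: i\ge j\ge 0\}$, put $L(a,b)=\max_{\pi:a\to b}\sum_{(i,j)\in\pi\setminus\{a\}}\omega_{i,j}$, the maximum being over up-right lattice paths in the half-space from $a$ to $b$; $L(b):=L((0,0),b)$. Non-integer points are rounded: $(x,y)$ means $(\lfloor x\rfloor,\lfloor y\rfloor)$. $\exp(a)$ is the exponential law with rate $a$ (mean $1/a$). Stationary model with parameter $\rho\in(0,1)$, denoted $L^{\mathrm{st},\rho}$: independent weights $\omega_{0,0}=0$, $\omega_{i,i}\sim\exp(\rho)$ for $i\ge1$, $\omega_{i,0}\sim\exp(1-\rho)$ for $i\ge 1$, $\omega_{i,j}\sim\exp(1)$ for $0<j<i$. Limit process: for every $\delta\in\mathbb{R}$ it is known that, with $\rho=\frac12+\delta2^{-4/3}N^{-1/3}$ and $Q(u)=(N+u(2N)^{2/3},N-u(2N)^{2/3})$, $u\ge 0$, the finite-dimensional distributions of $\frac{L^{\mathrm{st},\rho}(Q(u))-4N}{2^{4/3}N^{1/3}}$ converge as $N\to\infty$; the limit process is denoted $\mathcal{A}^{\mathrm{st,hs}}_\delta(u)$ (the half-space stationary limit process). In particular $\mathcal{A}^{\mathrm{st,hs}}_\delta(0)$ is the limit in law for $u=0$. *)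

theory Defs
  imports "HOL-Probability.Probability"
begin

section \<open>Half-space last passage percolation\<close>

definition half_space :: "(nat \<times> nat) set" where
  "half_space = {(i, j). j \<le> i}"

definition up_right_step :: "nat \<times> nat \<Rightarrow> nat \<times> nat \<Rightarrow> bool" where
  "up_right_step p q \<longleftrightarrow> q = (fst p + 1, snd p) \<or> q = (fst p, snd p + 1)"

definition up_right_paths :: "nat \<times> nat \<Rightarrow> nat \<times> nat \<Rightarrow> (nat \<times> nat) list set" where
  "up_right_paths a b =
     {\<pi>. \<pi> \<noteq> [] \<and> hd \<pi> = a \<and> last \<pi> = b \<and> successively up_right_step \<pi> \<and> set \<pi> \<subseteq> half_space}"

text \<open>Only meaningful if \<open>b\<close> can be reached from \<open>a\<close>; otherwise this is the maximum of the
  empty set.\<close>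
definition last_passage :: "(nat \<times> nat \<Rightarrow> real) \<Rightarrow> nat \<times> nat \<Rightarrow> nat \<times> nat \<Rightarrow> real" where
  "last_passage \<omega> a b = Max ((\<lambda>\<pi>. \<Sum>p\<in>set \<pi> - {a}. \<omega> p) ` up_right_paths a b)"

definition round_point :: "real \<times> real \<Rightarrow> nat \<times> nat" where
  "round_point p = (nat \<lfloor>fst p\<rfloor>, nat \<lfloor>snd p\<rfloor>)"


section \<open>The stationary model\<close>

definition exp_law :: "real \<Rightarrow> real measure" where
  "exp_law a = density lborel (\<lambda>x. ennreal (exponential_density a x))"

definition stationary_weight_law :: "real \<Rightarrow> nat \<times> nat \<Rightarrow> real measure" where
  "stationary_weight_law \<rho> = (\<lambda>(i, j).
     if i = 0 \<and> j = 0 then return borel 0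
     else if i = j then exp_law \<rho>
     else if j = 0 then exp_law (1 - \<rho>)
     else exp_law 1)"

text \<open>The random environment: the coordinates of this product space are independent with the
  prescribed laws. It is a probability space for \<open>0 < \<rho> < 1\<close>.\<close>
definition stationary_env :: "real \<Rightarrow> (nat \<times> nat \<Rightarrow> real) measure" where
  "stationary_env \<rho> = Pi\<^sub>M half_space (stationary_weight_law \<rho>)"


section \<open>Critical scaling\<close>

text \<open>Statements about \<open>N \<rightarrow> \<infinity>\<close> involve only large \<open>N\<close>, for which \<open>0 < rho_crit \<delta> N < 1\<close>.\<close>
definition rho_crit :: "real \<Rightarrow> nat \<Rightarrow> real" where
  "rho_crit \<delta> N = 1 / 2 + \<delta> * 2 powr (- (4 / 3)) * real N powr (- (1 / 3))"

definition Q_point :: "nat \<Rightarrow> real \<Rightarrow> nat \<times> nat" where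
  "Q_point N u = round_point (real N + u * (2 * real N) powr (2 / 3),
                              real N - u * (2 * real N) powr (2 / 3))"

definition rescaled_space :: "nat \<Rightarrow> real \<Rightarrow> (nat \<times> nat \<Rightarrow> real) \<Rightarrow> real" where
  "rescaled_space N u \<omega> =
     (last_passage \<omega> (0, 0) (Q_point N u) - 4 * real N) / (2 powr (4 / 3) * real N powr (1 / 3))"

text \<open>The rescaled last passage time at time \<open>\<tau>\<close> and spatial position \<open>0\<close>.\<close>
definition rescaled_time :: "nat \<Rightarrow> real \<Rightarrow> (nat \<times> nat \<Rightarrow> real) \<Rightarrow> real" where
  "rescaled_time N \<tau> \<omega> =
     (last_passage \<omega> (0, 0) (round_point (\<tau> * real N, \<tau> * real N)) - 4 * \<tau> * real N)
       / (2 powr (4 / 3) * real N powr (1 / 3))"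


section \<open>The half-space stationary limit process\<close>

text \<open>Convergence of finite-dimensional distributions: weak convergence in \<open>\<real>\<^sup>k\<close> of the vectors
  with entries at \<open>u 0, \<dots>, u (k - 1)\<close>. Here \<open>\<real>\<^sup>k\<close> is identified with the sequences vanishing
  from index \<open>k\<close> on; continuity of \<open>f\<close> refers to the product topology, so \<open>f\<close> ranges over exactly
  the bounded continuous functions when restricted to \<open>\<real>\<^sup>k\<close>.\<close>
definition half_space_stationary_limit ::
    "real \<Rightarrow> 'a measure \<Rightarrow> (real \<Rightarrow> 'a \<Rightarrow> real) \<Rightarrow> bool" where
  "half_space_stationary_limit \<delta> P A \<longleftrightarrow>
     prob_space P \<and>
     (\<forall>u\<ge>0. A u \<in> borel_measurable P) \<and>
     (\<forall>(k::nat) (u :: nat \<Rightarrow> real) (f :: (nat \<Rightarrow> real) \<Rightarrow> real).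
        (\<forall>i<k. 0 \<le> u i) \<longrightarrow> continuous_on UNIV f \<longrightarrow> bounded (range f) \<longrightarrow>
        (\<lambda>N. \<integral>\<omega>. f (\<lambda>i. if i < k then rescaled_space N (u i) \<omega> else 0)
               \<partial>stationary_env (rho_crit \<delta> N))
          \<longlonglongrightarrow> (\<integral>x. f (\<lambda>i. if i < k then A (u i) x else 0) \<partial>P))"


definition covariance :: "'a measure \<Rightarrow> ('a \<Rightarrow> real) \<Rightarrow> ('a \<Rightarrow> real) \<Rightarrow> real" where
  "covariance M X Y =
     (\<integral>x. (X x - integral\<^sup>L M X) * (Y x - integral\<^sup>L M Y) \<partial>M)"

end

theory Submission
  imports Defs
begin

text \<open>By polarization, twice the covariance is the sum of the variances of the two passage times
  minus the variance of their difference. The horizontal increments along every row of the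
  stationary model are again independent exponentials (a Burke property), so
  \<open>L(N,N) - L(n,n)\<close> has the same law as \<open>L(N-n,N-n)\<close>, and everything reduces to
  the convergence of the variance of the rescaled one-point passage time.

  This needs a uniform bound on its fourth moment. Write \<open>g y\<close> for the passage time when the diagonal
  weights have mean \<open>y\<close>; it is convex in \<open>y\<close>. Tilting the diagonal weights gives an explicit exponential
  moment of \<open>g y\<close> of one sign on each side of the stationary value, and convexity bounds the
  stationary passage time by these plus a small multiple of the gain \<open>g z - g y\<close> for a larger
  perturbation \<open>z\<close>. A path of the perturbed model uses no diagonal weight before its first visit
  to the diagonal and no boundary weight afterwards; this bounds the gain by the maxima along the
  diagonal of two stationary passage times. By stationarity of the increments and chaining, the
  fourth moments of these maxima are again controlled by the fourth moment of the passage time, with a small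
  factor in front, and the estimate closes.\<close>

section \<open>Last passage times by recursion\<close>

text \<open>The power four comes from the chaining: increments over n steps have p-th moment of
  order n^(p/3), and each doubling of the interval costs a factor of at least 2, so 2^(p/3) > 2,
  that is p > 3, is required.

  The obstacle is that tilt and perturbation are locked together: the tilt is the difference of the
  two diagonal rates, so it degenerates exactly at the stationary rate, and each side controls one
  tail only. With \<sigma> the fluctuation scale, the sandwich shifts the rate by 1/\<sigma> and the
  gain uses a shift \<Lambda>/\<sigma>. Convexity contributes \<Lambda>^-4 to the fourth moment,
  while the shifted stationary model has a scale of at most order \<Lambda>^(1/2) \<sigma> and costs
  \<Lambda>^2; the product is small for large \<Lambda>. As the comparison moves the parameter, the
  bound is proved for all parameters in [1/4, 3/4] at once, with a scale covering critical and
  diffusive behaviour.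

  The parameter is tuned to N although the times \<tau>N and (1-\<tau>)N occur too; up to a rounding
  error of order 1/N it is critical for them with a smaller \<delta>.\<close>

fun lpp :: "(nat \<times> nat \<Rightarrow> real) \<Rightarrow> nat \<Rightarrow> nat \<Rightarrow> real" where
  "lpp w 0 j = 0"
| "lpp w (Suc i) 0 = lpp w i 0 + w (Suc i, 0)"
| "lpp w (Suc i) (Suc j) =
    (if j < i then max (lpp w i (Suc j)) (lpp w (Suc i) j) else lpp w (Suc i) j) + w (Suc i, Suc j)"

section \<open>Decomposition of paths by their last step\<close>

lemma up_right_paths_step:
  assumes "q \<noteq> a" "q \<in> half_space"
  shows "up_right_paths a q =
    (\<lambda>\<pi>. \<pi> @ [q]) ` (\<Union>p\<in>{p. up_right_step p q}. up_right_paths a p)"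
proof (intro equalityI subsetI)
  fix \<pi> assume "\<pi> \<in> up_right_paths a q"
  then have p: "\<pi> \<noteq> []" "hd \<pi> = a" "last \<pi> = q" "successively up_right_step \<pi>" "set \<pi> \<subseteq> half_space"
    by (auto simp: up_right_paths_def)
  obtain \<pi>' where pi: "\<pi> = \<pi>' @ [q]" using p by (metis append_butlast_last_id)
  have ne: "\<pi>' \<noteq> []" using p pi assms by auto
  show "\<pi> \<in> (\<lambda>\<pi>. \<pi> @ [q]) ` (\<Union>p\<in>{p. up_right_step p q}. up_right_paths a p)"
    using p ne unfolding pi
    by (auto simp: up_right_paths_def successively_append_iff intro!: image_eqI[of _ _ \<pi>'])
next
  fix \<pi> assume "\<pi> \<in> (\<lambda>\<pi>. \<pi> @ [q]) ` (\<Union>p\<in>{p. up_right_step p q}. up_right_paths a p)"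
  then show "\<pi> \<in> up_right_paths a q" using assms
    by (auto simp: up_right_paths_def successively_append_iff)
qed

text \<open>Each step raises the coordinate sum by one. The bound acts as a rank: it excludes
  nontrivial paths from \<open>a\<close> to \<open>a\<close> and shows that the endpoint of a path
  does not occur earlier on it.\<close>

lemma up_right_path_sum_le:
  assumes "\<pi> \<in> up_right_paths a b" "q \<in> set \<pi>"
  shows "fst q + snd q \<le> fst b + snd b"
proof -
  have "\<pi> \<noteq> [] \<Longrightarrow> successively up_right_step \<pi> \<Longrightarrow> q \<in> set \<pi> \<Longrightarrow>
      fst q + snd q \<le> fst (last \<pi>) + snd (last \<pi>)" for \<pi>
    by (induction \<pi> rule: rev_induct)
       (force simp: successively_append_iff up_right_step_def)+
  then show ?thesis using assms by (auto simp: up_right_paths_def)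
qed

lemma up_right_paths_refl:
  assumes "a \<in> half_space" shows "up_right_paths a a = {[a]}"
proof (intro equalityI subsetI)
  fix \<pi> assume pi: "\<pi> \<in> up_right_paths a a"
  show "\<pi> \<in> {[a]}"
  proof (cases \<pi>)
    case Nil then show ?thesis using pi by (auto simp: up_right_paths_def)
  next
    case (Cons p \<pi>')
    have "\<pi>' = []"
    proof (rule ccontr)
      assume ne: "\<pi>' \<noteq> []"
      have "up_right_step a (hd \<pi>')" "hd \<pi>' \<in> set \<pi>"
        using pi ne unfolding Cons by (auto simp: up_right_paths_def successively_Cons)
      moreover from this(2) have "fst (hd \<pi>') + snd (hd \<pi>') \<le> fst a + snd a"
        by (rule up_right_path_sum_le[OF pi])
      ultimately show False by (auto simp: up_right_step_def)
    qed
    then show ?thesis using pi unfolding Cons by (auto simp: up_right_paths_def)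
  qed
qed (use assms in \<open>auto simp: up_right_paths_def\<close>)

lemma up_right_paths_outside: "b \<notin> half_space \<Longrightarrow> up_right_paths a b = {}"
  unfolding up_right_paths_def using last_in_set by blast

lemma finite_up_right_step: "finite {p. up_right_step p q}"
  by (rule finite_subset[of _ "{..fst q} \<times> {..snd q}"]) (auto simp: up_right_step_def)

lemma finite_up_right_paths: "finite (up_right_paths (0,0) (i,j))"
proof (induction "i + j" arbitrary: i j rule: less_induct)
  case less
  show ?case
  proof (cases "(i,j) = (0,0) \<or> (i,j) \<notin> half_space")
    case True
    moreover have "finite (up_right_paths (0,0) (0,0))"
      by (simp add: up_right_paths_refl half_space_def)
    ultimately show ?thesis by (metis up_right_paths_outside finite.emptyI)
  next
    case False
    have "finite (up_right_paths (0,0) p)" if "up_right_step p (i,j)" for p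
      using that less[of "fst p" "snd p"] by (auto simp: up_right_step_def)
    moreover have "up_right_paths (0,0) (i,j) =
        (\<lambda>\<pi>. \<pi> @ [(i,j)]) ` (\<Union>p\<in>{p. up_right_step p (i,j)}. up_right_paths (0,0) p)"
      using False by (intro up_right_paths_step) auto
    ultimately show ?thesis using finite_up_right_step[of "(i,j)"] by simp
  qed
qed

lemma up_right_paths_nonempty: "j \<le> i \<Longrightarrow> up_right_paths (0,0) (i,j) \<noteq> {}"
proof (induction "i + j" arbitrary: i j rule: less_induct)
  case less
  show ?case
  proof (cases i)
    case 0 then show ?thesis using less.prems by (simp add: up_right_paths_refl half_space_def)
  next
    case (Suc i')
    obtain p where p: "up_right_step p (i,j)" "up_right_paths (0,0) p \<noteq> {}"
    proof (cases j)
      case 0 then show ?thesis using less.hyps[of i' 0] Suc that[of "(i',0)"] by (auto simp: up_right_step_def)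
    next
      case (Suc j') then show ?thesis using less.hyps[of i j'] less.prems that[of "(i,j')"]
        by (auto simp: up_right_step_def)
    qed
    have "(i,j) \<noteq> (0,0)" "(i,j) \<in> half_space" using Suc less.prems by (auto simp: half_space_def)
    then show ?thesis using p up_right_paths_step[of "(i,j)" "(0,0)"] by blast
  qed
qed

lemma Max_add_const_image:
  fixes f :: "'a \<Rightarrow> real"
  assumes "finite A" "A \<noteq> {}" shows "Max ((\<lambda>x. f x + c) ` A) = Max (f ` A) + c"
proof -
  have "Max ((\<lambda>y. y + c) ` (f ` A)) = Max (f ` A) + c"
    by (rule Max_add_commute[of "f ` A" "\<lambda>y. y" c, simplified image_ident]) (use assms in auto)
  then show ?thesis by (simp add: image_image)
qed

lemma last_passage_step:
  assumes "q \<noteq> (0,0)" "q \<in> half_space"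
    and P: "P = {p. up_right_step p q \<and> p \<in> half_space}" "P \<noteq> {}"
  shows "last_passage w (0,0) q = Max (last_passage w (0,0) ` P) + w q"
proof -
  define U where "U = (\<Union>p\<in>P. up_right_paths (0,0) p)"
  define f where "f = (\<lambda>\<pi>. \<Sum>p\<in>set \<pi> - {(0,0)}. w p)"
  have finP: "finite P" by (rule finite_subset[OF _ finite_up_right_step[of q]]) (auto simp: P)
  have fin: "finite (up_right_paths (0,0) p)" for p
    using finite_up_right_paths[of "fst p" "snd p"] by simp
  have ne: "up_right_paths (0,0) p \<noteq> {}" if "p \<in> P" for p
    using up_right_paths_nonempty[of "snd p" "fst p"] that by (auto simp: P half_space_def)
  have finU: "finite U" "U \<noteq> {}" using fin finP P ne by (auto simp: U_def)
  \<comment> \<open>Predecessors outside the half-space are not reached by any path, so the union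
    may be restricted to \<open>P\<close>.\<close>
  have paths: "up_right_paths (0,0) q = (\<lambda>\<pi>. \<pi> @ [q]) ` U"
    unfolding up_right_paths_step[OF assms(1,2)] U_def P(1)
    using up_right_paths_outside by (intro arg_cong[of _ _ "\<lambda>A. (\<lambda>\<pi>. \<pi> @ [q]) ` A"]) blast
  have f: "f (\<pi> @ [q]) = f \<pi> + w q" if pi: "\<pi> \<in> U" for \<pi>
  proof -
    obtain p where p: "p \<in> P" "\<pi> \<in> up_right_paths (0,0) p" using pi unfolding U_def by blast
    \<comment> \<open>Weights are summed over the set of visited points, so \<open>w q\<close>
      splits off only if \<open>q\<close> is new.\<close>
    have "q \<notin> set \<pi>"
      using up_right_path_sum_le[OF p(2), of q] p(1) by (auto simp: P up_right_step_def)
    then have "set (\<pi> @ [q]) - {(0,0)} = insert q (set \<pi> - {(0,0)})" "q \<notin> set \<pi> - {(0,0)}"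
      using assms(1) by auto
    then show ?thesis unfolding f_def by (simp only: sum.insert finite_Diff finite_set) simp
  qed
  have "last_passage w (0,0) q = Max (f ` (\<lambda>\<pi>. \<pi> @ [q]) ` U)"
    by (simp add: last_passage_def paths f_def)
  also have "f ` (\<lambda>\<pi>. \<pi> @ [q]) ` U = (\<lambda>\<pi>. f \<pi> + w q) ` U"
    unfolding image_image by (rule image_cong[OF refl f])
  also have "Max \<dots> = Max (f ` U) + w q" by (rule Max_add_const_image[of U f "w q", OF finU])
  also have "Max (f ` U) = Max (last_passage w (0,0) ` P)"
  proof (rule antisym)
    show "Max (f ` U) \<le> Max (last_passage w (0,0) ` P)"
    proof (rule Max.boundedI)
      fix y assume "y \<in> f ` U"
      then obtain p \<pi> where "p \<in> P" "\<pi> \<in> up_right_paths (0,0) p" "y = f \<pi>" by (auto simp: U_def)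
      then have "y \<le> last_passage w (0,0) p"
        unfolding last_passage_def f_def using fin by simp
      also have "\<dots> \<le> Max (last_passage w (0,0) ` P)" using \<open>p \<in> P\<close> finP by (intro Max_ge) auto
      finally show "y \<le> Max (last_passage w (0,0) ` P)" .
    qed (use finU in auto)
    show "Max (last_passage w (0,0) ` P) \<le> Max (f ` U)"
    proof (rule Max.boundedI)
      fix y assume "y \<in> last_passage w (0,0) ` P"
      then obtain p where p: "p \<in> P" "y = Max (f ` up_right_paths (0,0) p)"
        by (auto simp: last_passage_def f_def)
      show "y \<le> Max (f ` U)" unfolding p(2)
        by (rule Max_mono) (use p finU ne in \<open>auto simp: U_def\<close>)
    qed (use finP P(2) in auto)
  qed
  finally show ?thesis .
qed

text \<open>On the diagonal the left neighbour lies outside the half-space, which is why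
  \<open>lpp\<close> then looks only below. Above the diagonal the recursion still returns a number,
  but one without meaning; hence the hypothesis.\<close>

lemma last_passage_eq_lpp: "j \<le> i \<Longrightarrow> last_passage w (0,0) (i,j) = lpp w i j"
proof (induction w i j rule: lpp.induct)
  case (1 w j)
  then show ?case by (simp add: last_passage_def up_right_paths_refl half_space_def)
next
  case (2 w i)
  have "{p. up_right_step p (Suc i, 0) \<and> p \<in> half_space} = {(i,0)}"
    by (auto simp: up_right_step_def half_space_def)
  then show ?case using 2 by (subst last_passage_step[OF _ _ refl]) (auto simp: half_space_def)
next
  case (3 w i j)
  have "{p. up_right_step p (Suc i, Suc j) \<and> p \<in> half_space} = (if j < i then {(i,Suc j), (Suc i, j)} else {(Suc i, j)})"
    using 3 by (auto simp: up_right_step_def half_space_def)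
  then show ?case using 3 by (subst last_passage_step[OF _ _ refl]) (auto simp: half_space_def)
qed

section \<open>Deterministic properties of last passage times\<close>

text \<open>All models are built on one family \<open>E\<close> of standard exponential weights,
  with \<open>x\<close> and \<open>y\<close> the means of the boundary and diagonal weights.
  Stationarity is the relation \<open>1 / x + 1 / y = 1\<close>, that is
  \<open>x = 1 / (1 - \<rho>)\<close> and \<open>y = 1 / \<rho>\<close>; other pairs give the
  perturbed and mixed models in the same environment.\<close>

definition scaled_weights :: "real \<Rightarrow> real \<Rightarrow> (nat \<times> nat \<Rightarrow> real) \<Rightarrow> nat \<times> nat \<Rightarrow> real" where
  "scaled_weights x y E = (\<lambda>(i, j). if j = 0 then x * E (i, j) else if i = j then y * E (i, j) else E (i, j))"

definition diag_lpp :: "real \<Rightarrow> real \<Rightarrow> (nat \<times> nat \<Rightarrow> real) \<Rightarrow> nat \<Rightarrow> real" where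
  "diag_lpp x y E n = lpp (scaled_weights x y E) n n"

section \<open>Dependence of passage times on the weights\<close>

lemma lpp_cong:
  assumes "\<And>k l. 1 \<le> k \<Longrightarrow> k \<le> i \<Longrightarrow> l \<le> k \<Longrightarrow> w (k, l) = w' (k, l)" "j \<le> i"
  shows "lpp w i j = lpp w' i j"
  using assms
proof (induction w i j rule: lpp.induct)
  case (3 w i j)
  then show ?case
    by (cases "j < i") auto
qed auto

text \<open>A maximum of linear functionals of the weights is convex; the recursion preserves this
  since \<open>max\<close> is monotone and jointly convex.\<close>

lemma lpp_convex:
  assumes "0 \<le> t" "t \<le> 1"
  shows "lpp (\<lambda>p. (1 - t) * w p + t * w' p) i j \<le> (1 - t) * lpp w i j + t * lpp w' i j"
proof (induction "\<lambda>p. (1 - t) * w p + t * w' p" i j rule: lpp.induct)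
  case (3 i j)
  have "(1 - t) * a + t * b \<le> (1 - t) * max a c + t * max b d" for a b c d :: real
    using assms by (intro add_mono mult_left_mono) auto
  moreover have "(1 - t) * a + t * b \<le> (1 - t) * max c a + t * max d b" for a b c d :: real
    using assms by (intro add_mono mult_left_mono) auto
  ultimately have "max u v \<le> (1 - t) * max a c + t * max b d"
    if "u \<le> (1 - t) * a + t * b" "v \<le> (1 - t) * c + t * d" for u v a b c d :: real
    using that by (meson max.boundedI order_trans)
  from this[OF 3(1,2)] 3(3) show ?case
    by (auto simp: algebra_simps)
qed (auto simp: algebra_simps)

lemma diag_lpp_convex:
  assumes "y1 \<le> y" "y \<le> y2" "y1 < y2"
  shows "diag_lpp x y E n
    \<le> (y2 - y) / (y2 - y1) * diag_lpp x y1 E n + (y - y1) / (y2 - y1) * diag_lpp x y2 E n"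
proof -
  define t where "t = (y - y1) / (y2 - y1)"
  have t: "0 \<le> t" "t \<le> 1" "1 - t = (y2 - y) / (y2 - y1)"
    using assms by (auto simp: t_def field_simps)
  have "t * (y2 - y1) = y - y1" using assms by (simp add: t_def)
  then have y: "y = (1 - t) * y1 + t * y2" by (simp add: algebra_simps)
  have "scaled_weights x y E = (\<lambda>p. (1 - t) * scaled_weights x y1 E p + t * scaled_weights x y2 E p)"
    unfolding scaled_weights_def by (subst y) (auto simp: fun_eq_iff algebra_simps)
  then show ?thesis
    using lpp_convex[OF t(1,2), of "scaled_weights x y1 E" "scaled_weights x y2 E" n n] t(3)
    by (simp add: diag_lpp_def t_def)
qed

text \<open>Only bottom-row and diagonal weights depend on the scales, and \<open>max\<close> is
  nonexpansive. The resulting bound grows linearly in \<open>i\<close>, far above the fluctuations,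
  but it is applied only to parameters at distance of order \<open>1 / i\<close>.\<close>

lemma lpp_lipschitz:
  assumes "j \<le> i"
  shows "\<bar>lpp (scaled_weights x y E) i j - lpp (scaled_weights x' y' E) i j\<bar>
    \<le> \<bar>x - x'\<bar> * (\<Sum>k=1..i. \<bar>E (k, 0)\<bar>) + \<bar>y - y'\<bar> * (\<Sum>k=1..j. \<bar>E (k, k)\<bar>)"
  using assms
proof (induction "scaled_weights x y E" i j rule: lpp.induct)
  case (2 i)
  have "\<bar>x * e - x' * e\<bar> = \<bar>x - x'\<bar> * \<bar>e\<bar>" for e by (metis abs_mult left_diff_distrib)
  from this[of "E (Suc i, 0)"] show ?case using 2 by (simp add: scaled_weights_def algebra_simps)
next
  case (3 i j)
  let ?w = "scaled_weights x y E" and ?w' = "scaled_weights x' y' E"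
  show ?case
  proof (cases "j < i")
    case True
    have "\<bar>max a b - max a' b'\<bar> \<le> c" if "\<bar>a - a'\<bar> \<le> c" "\<bar>b - b'\<bar> \<le> c" for a b a' b' c :: real
      using that by linarith
    moreover have "(\<Sum>k=1..i. \<bar>E (k, 0)\<bar>) \<le> (\<Sum>k=1..Suc i. \<bar>E (k, 0)\<bar>)"
      "(\<Sum>k=1..j. \<bar>E (k, k)\<bar>) \<le> (\<Sum>k=1..Suc j. \<bar>E (k, k)\<bar>)" by auto
    ultimately have "\<bar>max (lpp ?w i (Suc j)) (lpp ?w (Suc i) j) - max (lpp ?w' i (Suc j)) (lpp ?w' (Suc i) j)\<bar>
      \<le> \<bar>x - x'\<bar> * (\<Sum>k=1..Suc i. \<bar>E (k, 0)\<bar>) + \<bar>y - y'\<bar> * (\<Sum>k=1..Suc j. \<bar>E (k, k)\<bar>)"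
      using 3(1,2) True
      by (smt (verit, best) Suc_leI abs_ge_zero less_imp_le_nat mult_left_mono le_SucI)
    then show ?thesis using True by (simp add: scaled_weights_def)
  next
    case False
    then have ij: "i = j" using 3 by simp
    have "\<bar>y * e - y' * e\<bar> = \<bar>y - y'\<bar> * \<bar>e\<bar>" for e by (metis abs_mult left_diff_distrib)
    from this[of "E (Suc i, Suc i)"] show ?thesis using 3(3) ij
      by (simp add: scaled_weights_def algebra_simps) linarith
  qed
qed auto

lemma lpp_bottom_row: "lpp (scaled_weights x y E) i 0 = lpp (scaled_weights x y' E) i 0"
  by (induction i) (auto simp: scaled_weights_def)

text \<open>Before the first visit to the diagonal a path of the mixed model sees the weights of the
  first model only, afterwards those of the second model only.\<close>
lemma lpp_mixed:
  assumes C: "\<And>a. 1 \<le> a \<Longrightarrow> a \<le> n \<Longrightarrow>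
      diag_lpp x1 y1 E a - diag_lpp x2 y2 E a + (y2 - y1) * E (a, a) \<le> C"
    and "j \<le> i" "j \<le> n"
  shows "lpp (scaled_weights x1 y2 E) i j
       \<le> max (lpp (scaled_weights x1 y1 E) i j) (lpp (scaled_weights x2 y2 E) i j + C)"
    and "i = j \<Longrightarrow> 1 \<le> i \<Longrightarrow> lpp (scaled_weights x1 y2 E) i j \<le> lpp (scaled_weights x2 y2 E) i j + C"
proof -
  have "lpp (scaled_weights x1 y2 E) i j
       \<le> max (lpp (scaled_weights x1 y1 E) i j) (lpp (scaled_weights x2 y2 E) i j + C) \<and>
     (i = j \<longrightarrow> 1 \<le> i \<longrightarrow> lpp (scaled_weights x1 y2 E) i j \<le> lpp (scaled_weights x2 y2 E) i j + C)"
    using assms(2,3)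
  proof (induction "scaled_weights x1 y2 E" i j rule: lpp.induct)
    case (1 j) then show ?case by auto
  next
    case (2 i)
    \<comment> \<open>On the bottom row no diagonal weight has been collected yet, so the first
      alternative holds with equality.\<close>
    then show ?case using lpp_bottom_row[of x1 y2 E "Suc i" y1] by simp
  next
    case (3 i j)
    show ?case
    proof (cases "j < i")
      case True
      then show ?thesis using 3(1,2) 3(4,5) by (auto simp: scaled_weights_def)
    next
      case False
      then have ij: "i = j" using 3 by simp
      \<comment> \<open>A diagonal vertex is entered from below, where both alternatives are still
        open. The hypothesis on \<open>C\<close> turns the first into the second once the diagonal
        weight is changed from \<open>y1\<close> to \<open>y2\<close>.\<close>
      have "lpp (scaled_weights x1 y2 E) (Suc j) j \<le>
          max (lpp (scaled_weights x1 y1 E) (Suc j) j) (lpp (scaled_weights x2 y2 E) (Suc j) j + C)"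
        using 3(3,5) ij by simp
      moreover have "diag_lpp x y E (Suc j) = lpp (scaled_weights x y E) (Suc j) j + y * E (Suc j, Suc j)" for x y
        by (simp add: diag_lpp_def scaled_weights_def)
      ultimately show ?thesis using C[of "Suc j"] 3(5) ij
        by (simp add: scaled_weights_def algebra_simps split: if_splits)
    qed
  qed
  then show "lpp (scaled_weights x1 y2 E) i j
       \<le> max (lpp (scaled_weights x1 y1 E) i j) (lpp (scaled_weights x2 y2 E) i j + C)"
    and "i = j \<Longrightarrow> 1 \<le> i \<Longrightarrow> lpp (scaled_weights x1 y2 E) i j \<le> lpp (scaled_weights x2 y2 E) i j + C"
    by auto
qed

text \<open>Above row 1, the weights of rows 0 and 1 enter only through the passage times along row
  1, hence through their increments. The model with its lowest row removed is therefore a half-space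
  model of the same kind.\<close>

lemma lpp_from_first_row:
  assumes "j \<le> i"
    and w0: "\<And>k. 1 \<le> k \<Longrightarrow> k \<le> i \<Longrightarrow> w' (k, 0) = lpp w (Suc k) 1 - lpp w k 1"
    and w1: "\<And>k l. 1 \<le> l \<Longrightarrow> l \<le> k \<Longrightarrow> k \<le> i \<Longrightarrow> w' (k, l) = w (Suc k, Suc l)"
  shows "lpp w (Suc i) (Suc j) = lpp w 1 1 + lpp w' i j"
  using assms
proof (induction w' i j rule: lpp.induct)
  case (2 w' i)
  then show ?case by (cases i) auto
next
  case (3 w' i j)
  show ?case
  proof (cases "j < i")
    case True
    have "lpp w (Suc i) (Suc (Suc j)) = lpp w 1 1 + lpp w' i (Suc j)"
      by (rule 3(1)[OF True]) (use True 3(4-) in auto)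
    moreover have "lpp w (Suc (Suc i)) (Suc j) = lpp w 1 1 + lpp w' (Suc i) j"
      by (rule 3(2)[OF True]) (use True 3(4-) in auto)
    moreover have "w' (Suc i, Suc j) = w (Suc (Suc i), Suc (Suc j))" using 3 True by auto
    ultimately show ?thesis using True by (subst lpp.simps(3)) (auto simp del: One_nat_def)
  next
    case False
    have "lpp w (Suc (Suc i)) (Suc j) = lpp w 1 1 + lpp w' (Suc i) j"
      by (rule 3(3)[OF False]) (use False 3(4-) in auto)
    moreover have "w' (Suc i, Suc j) = w (Suc (Suc i), Suc (Suc j))" using 3 False by auto
    ultimately show ?thesis using False by (subst lpp.simps(3)) (auto simp del: One_nat_def)
  qed
qed auto

text \<open>One corner of the lattice in the first row: from the horizontal increment below it, the
  vertical increment to its left and its own weight to the opposite increments. The new weight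
  makes the map an involution preserving the product law.\<close>
definition corner_flip :: "real \<Rightarrow> real \<Rightarrow> nat \<Rightarrow> (nat \<times> nat \<Rightarrow> real) \<Rightarrow> nat \<times> nat \<Rightarrow> real" where
  "corner_flip x y k E = E(
     (k, 0) := (max (x * E (k, 0) - y * E (1, 1)) 0 + E (k, 1)) / x,
     (1, 1) := (max (y * E (1, 1) - x * E (k, 0)) 0 + E (k, 1)) / y,
     (k, 1) := min (x * E (k, 0)) (y * E (1, 1)))"

text \<open>The columns \<open>2, ..., Suc n\<close> are processed from left to right; entry
  \<open>(1, 1)\<close> carries the current vertical increment between the two rows, divided by
  \<open>y\<close>.\<close>

primrec corner_flips :: "real \<Rightarrow> real \<Rightarrow> nat \<Rightarrow> (nat \<times> nat \<Rightarrow> real) \<Rightarrow> nat \<times> nat \<Rightarrow> real" where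
  "corner_flips x y 0 E = E"
| "corner_flips x y (Suc n) E = corner_flip x y (Suc (Suc n)) (corner_flips x y n E)"

text \<open>Row 1 and the entry \<open>(1, 0)\<close> are skipped: after the flips, row 1 holds the
  last vertical increment and the dual weights of the processed columns, which the passage times
  above do not see. As the map is injective, the selected entries of an i.i.d. family are again
  i.i.d.\<close>

definition row_shift :: "nat \<times> nat \<Rightarrow> nat \<times> nat" where
  "row_shift = (\<lambda>(k, l). if l = 0 then (if k = 0 then (0, 0) else (Suc k, 0)) else (Suc k, Suc l))"

definition next_row :: "real \<Rightarrow> real \<Rightarrow> nat \<Rightarrow> (nat \<times> nat \<Rightarrow> real) \<Rightarrow> nat \<times> nat \<Rightarrow> real" where
  "next_row x y n E = (\<lambda>p\<in>half_space. corner_flips x y n E (row_shift p))"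

lemma corner_flips_untouched:
  "Suc n < k \<Longrightarrow> corner_flips x y n E (k, 0) = E (k, 0)"
  "Suc n < k \<Longrightarrow> corner_flips x y n E (k, 1) = E (k, 1)"
  "corner_flips x y n E (1, 0) = E (1, 0)"
  "2 \<le> l \<Longrightarrow> corner_flips x y n E (k, l) = E (k, l)"
  by (induction n) (auto simp: corner_flip_def)

text \<open>With I and J the horizontal and vertical increments entering a corner of weight w, the
  recursion yields the outgoing increments max (I - J) 0 + w and max (J - I) 0 + w. The flips write
  exactly these, divided by the scales.\<close>

lemma corner_flips_increments:
  fixes E :: "nat \<times> nat \<Rightarrow> real"
  assumes "x \<noteq> 0" "y \<noteq> 0"
  defines "w \<equiv> scaled_weights x y E"
  shows "y * corner_flips x y n E (1, 1) = lpp w (Suc n) 1 - lpp w (Suc n) 0"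
    and "2 \<le> k \<Longrightarrow> k \<le> Suc n \<Longrightarrow> x * corner_flips x y n E (k, 0) = lpp w k 1 - lpp w (k - 1) 1"
proof -
  have "y * corner_flips x y n E (1, 1) = lpp w (Suc n) 1 - lpp w (Suc n) 0 \<and>
    (\<forall>k. 2 \<le> k \<longrightarrow> k \<le> Suc n \<longrightarrow> x * corner_flips x y n E (k, 0) = lpp w k 1 - lpp w (k - 1) 1)"
  proof (induction n)
    case 0
    show ?case by (auto simp: w_def scaled_weights_def)
  next
    case (Suc n)
    let ?F = "corner_flips x y n E"
    have un: "?F (Suc (Suc n), 0) = E (Suc (Suc n), 0)" "?F (Suc (Suc n), 1) = E (Suc (Suc n), 1)"
      by (simp_all add: corner_flips_untouched del: One_nat_def)
    have l: "lpp w (Suc (Suc n)) 1 = max (lpp w (Suc n) 1) (lpp w (Suc (Suc n)) 0) + E (Suc (Suc n), 1)"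
      "lpp w (Suc (Suc n)) 0 = lpp w (Suc n) 0 + x * E (Suc (Suc n), 0)"
      by (simp_all add: w_def scaled_weights_def)
    show ?case
    proof (intro conjI allI impI)
      show "y * corner_flips x y (Suc n) E (1, 1) = lpp w (Suc (Suc n)) 1 - lpp w (Suc (Suc n)) 0"
        using Suc assms(2) un l by (simp add: corner_flip_def)
      fix k assume k: "2 \<le> k" "k \<le> Suc (Suc n)"
      show "x * corner_flips x y (Suc n) E (k, 0) = lpp w k 1 - lpp w (k - 1) 1"
      proof (cases "k = Suc (Suc n)")
        case True
        then show ?thesis using Suc assms(1) un l by (simp add: corner_flip_def)
      next
        case False
        then show ?thesis using Suc k by (simp add: corner_flip_def)
      qed
    qed
  qed
  then show "y * corner_flips x y n E (1, 1) = lpp w (Suc n) 1 - lpp w (Suc n) 0"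
    and "2 \<le> k \<Longrightarrow> k \<le> Suc n \<Longrightarrow> x * corner_flips x y n E (k, 0) = lpp w k 1 - lpp w (k - 1) 1"
    by auto
qed

text \<open>A single \<open>n\<close> serves all \<open>i \<le> n\<close>, so that a difference of
  two passage times along the diagonal becomes a difference in one common environment
  \<open>next_row x y n E\<close>.\<close>

lemma diag_lpp_next_row:
  assumes "x \<noteq> 0" "y \<noteq> 0" "i \<le> n"
  shows "diag_lpp x y E (Suc i) = x * E (1, 0) + y * E (1, 1) + diag_lpp x y (next_row x y n E) i"
proof -
  have "lpp (scaled_weights x y E) (Suc i) (Suc i)
      = lpp (scaled_weights x y E) 1 1 + lpp (scaled_weights x y (next_row x y n E)) i i"
  proof (rule lpp_from_first_row)
    fix k assume "1 \<le> k" "k \<le> i"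
    then show "scaled_weights x y (next_row x y n E) (k, 0)
        = lpp (scaled_weights x y E) (Suc k) 1 - lpp (scaled_weights x y E) k 1"
      using corner_flips_increments(2)[OF assms(1,2), of "Suc k" n] assms(3)
      by (simp add: scaled_weights_def next_row_def row_shift_def half_space_def)
  next
    fix k l assume "1 \<le> l" "l \<le> k" "k \<le> i"
    then show "scaled_weights x y (next_row x y n E) (k, l) = scaled_weights x y E (Suc k, Suc l)"
      by (simp add: scaled_weights_def next_row_def row_shift_def half_space_def corner_flips_untouched)
  qed simp
  then show ?thesis by (simp add: diag_lpp_def scaled_weights_def)
qed

section \<open>The Burke property of exponential weights\<close>

lemma sets_exp_law [simp, measurable_cong]: "sets (exp_law r) = sets borel"
  and space_exp_law [simp]: "space (exp_law r) = UNIV"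
  by (simp_all add: exp_law_def)

lemma prob_space_exp_law: "0 < r \<Longrightarrow> prob_space (exp_law r)"
  unfolding exp_law_def by (rule prob_space_exponential_density)

lemma nn_integral_exp_law:
  assumes [measurable]: "f \<in> borel_measurable borel"
  shows "(\<integral>\<^sup>+u. f u \<partial>exp_law r) = (\<integral>\<^sup>+u. ennreal (exponential_density r u) * f u \<partial>lborel)"
  unfolding exp_law_def by (subst nn_integral_density) auto

lemma nn_integral_exp_law_scale:
  assumes f [measurable]: "f \<in> borel_measurable borel" and "0 < r" "0 < c"
  shows "(\<integral>\<^sup>+u. f (c * u) \<partial>exp_law r) = (\<integral>\<^sup>+u. f u \<partial>exp_law (r / c))"
proof -
  have "(\<integral>\<^sup>+u. f u \<partial>exp_law (r / c))
      = (\<integral>\<^sup>+u. ennreal (exponential_density (r / c) u) * f u \<partial>lborel)"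
    by (simp add: nn_integral_exp_law)
  also have "\<dots> = c * (\<integral>\<^sup>+u. ennreal (exponential_density (r / c) (0 + c * u)) * f (0 + c * u) \<partial>lborel)"
    using assms by (subst nn_integral_real_affine[where c = c and t = 0]) auto
  also have "\<dots> = (\<integral>\<^sup>+u. ennreal (exponential_density r u) * f (c * u) \<partial>lborel)"
    using assms
    by (subst nn_integral_cmult[symmetric])
       (auto simp: exponential_density_def mult.assoc[symmetric] ennreal_mult'[symmetric] mult_less_0_iff intro!: nn_integral_cong)
  finally show ?thesis by (simp add: nn_integral_exp_law)
qed

text \<open>Fubini with the index set kept whole: the value at \<open>b\<close> in the outer
  integral is overwritten and integrates to one. The law of a few coordinates can thus be changed
  without leaving the space of environments.\<close>

lemma nn_integral_PiM_resample:
  assumes M: "\<And>i. i \<in> I \<Longrightarrow> prob_space (M i)" and b: "b \<in> I"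
    and F [measurable]: "F \<in> borel_measurable (PiM I M)"
  shows "(\<integral>\<^sup>+E. F E \<partial>PiM I M) = (\<integral>\<^sup>+E. \<integral>\<^sup>+u. F (E(b := u)) \<partial>M b \<partial>PiM I M)"
proof -
  define J where "J = I - {b}"
  have I: "insert b J = I" using b by (auto simp: J_def)
  interpret Mb: prob_space "M b" using M b by auto
  interpret PJ: prob_space "PiM J M" using M by (intro prob_space_PiM) (auto simp: J_def)
  interpret pair_sigma_finite "M b" "PiM J M" ..
  have [measurable]: "(\<lambda>(u, X). X(b := u)) \<in> measurable (M b \<Otimes>\<^sub>M PiM J M) (PiM I M)"
    unfolding I[symmetric] by measurable
  have distr: "distr (M b \<Otimes>\<^sub>M PiM J M) (PiM I M) (\<lambda>(u, X). X(b := u)) = PiM I M"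
    using distr_pair_PiM_eq_PiM[of J M b] M b unfolding I by (auto simp: J_def)
  have split: "(\<integral>\<^sup>+E. G E \<partial>PiM I M) = (\<integral>\<^sup>+X. \<integral>\<^sup>+u. G (X(b := u)) \<partial>M b \<partial>PiM J M)"
    if [measurable]: "G \<in> borel_measurable (PiM I M)" for G :: "_ \<Rightarrow> ennreal"
  proof -
    have [measurable]: "(\<lambda>(u, X). G (X(b := u))) \<in> borel_measurable (M b \<Otimes>\<^sub>M PiM J M)"
      using measurable_compose[of "\<lambda>(u, X). X(b := u)" "M b \<Otimes>\<^sub>M PiM J M" "PiM I M" G]
      by (simp add: case_prod_beta')
    have "(\<integral>\<^sup>+E. G E \<partial>PiM I M) = (\<integral>\<^sup>+z. G ((\<lambda>(u, X). X(b := u)) z) \<partial>(M b \<Otimes>\<^sub>M PiM J M))"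
      by (subst distr[symmetric], subst nn_integral_distr) auto
    also have "\<dots> = (\<integral>\<^sup>+X. \<integral>\<^sup>+u. G (X(b := u)) \<partial>M b \<partial>PiM J M)"
      by (subst nn_integral_snd[symmetric]) (auto simp: case_prod_beta')
    finally show ?thesis .
  qed
  have [measurable]: "(\<lambda>(E, u). F (E(b := u))) \<in> borel_measurable (PiM I M \<Otimes>\<^sub>M M b)"
    using measurable_compose[OF measurable_add_dim[of b I M], of F] by (simp add: insert_absorb b case_prod_beta')
  have "(\<integral>\<^sup>+E. \<integral>\<^sup>+u. F (E(b := u)) \<partial>M b \<partial>PiM I M)
      = (\<integral>\<^sup>+X. \<integral>\<^sup>+v. \<integral>\<^sup>+u. F ((X(b := v))(b := u)) \<partial>M b \<partial>M b \<partial>PiM J M)"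
    by (rule split) (rule Mb.borel_measurable_nn_integral, measurable)
  also have "\<dots> = (\<integral>\<^sup>+X. \<integral>\<^sup>+u. F (X(b := u)) \<partial>M b \<partial>PiM J M)"
    by (simp add: Mb.emeasure_space_1)
  also have "\<dots> = (\<integral>\<^sup>+E. F E \<partial>PiM I M)" by (rule split[symmetric]) fact
  finally show ?thesis ..
qed

lemma measurable_apply3:
  fixes K :: "real \<Rightarrow> real \<Rightarrow> real \<Rightarrow> ennreal"
  assumes "(\<lambda>(u, v, w). K u v w) \<in> borel_measurable (borel \<Otimes>\<^sub>M borel \<Otimes>\<^sub>M borel)"
    and "f \<in> borel_measurable M" "g \<in> borel_measurable M" "h \<in> borel_measurable M"
  shows "(\<lambda>x. K (f x) (g x) (h x)) \<in> borel_measurable M"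
  using measurable_compose[OF _ assms(1), of "\<lambda>x. (f x, g x, h x)" M] assms(2-) by simp

abbreviation lborel3 :: "(real \<Rightarrow> real \<Rightarrow> real \<Rightarrow> ennreal) \<Rightarrow> ennreal" where
  "lborel3 K \<equiv> \<integral>\<^sup>+u. \<integral>\<^sup>+v. \<integral>\<^sup>+w. K u v w \<partial>lborel \<partial>lborel \<partial>lborel"

abbreviation exp3 :: "real \<Rightarrow> real \<Rightarrow> (real \<Rightarrow> real \<Rightarrow> real \<Rightarrow> ennreal) \<Rightarrow> ennreal" where
  "exp3 \<beta> \<alpha> K \<equiv> \<integral>\<^sup>+u. \<integral>\<^sup>+v. \<integral>\<^sup>+w. K u v w \<partial>exp_law 1 \<partial>exp_law \<alpha> \<partial>exp_law \<beta>"

lemma nn_integral_lborel_perm3: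
  fixes K :: "real \<Rightarrow> real \<Rightarrow> real \<Rightarrow> ennreal"
  assumes K [measurable]: "(\<lambda>(u, v, w). K u v w) \<in> borel_measurable (borel \<Otimes>\<^sub>M borel \<Otimes>\<^sub>M borel)"
  shows "lborel3 (\<lambda>u v w. K u v w)
       = lborel3 (\<lambda>v w u. K u v w)"
    and "lborel3 (\<lambda>u v w. K u v w)
       = lborel3 (\<lambda>u w v. K u v w)"
proof -
  note [measurable (raw)] = measurable_apply3[OF K]
  have "lborel3 (\<lambda>u v w. K u v w)
      = lborel3 (\<lambda>v u w. K u v w)"
    by (rule lborel_pair.Fubini'[symmetric]) measurable
  also have "\<dots> = lborel3 (\<lambda>v w u. K u v w)"
    by (intro nn_integral_cong lborel_pair.Fubini'[symmetric]) measurable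
  finally show "lborel3 (\<lambda>u v w. K u v w)
       = lborel3 (\<lambda>v w u. K u v w)" .
  show "lborel3 (\<lambda>u v w. K u v w)
       = lborel3 (\<lambda>u w v. K u v w)"
    by (intro nn_integral_cong lborel_pair.Fubini'[symmetric]) measurable
qed

lemma nn_integral_lborel_translate:
  fixes f :: "real \<Rightarrow> ennreal"
  assumes [measurable]: "f \<in> borel_measurable borel"
  shows "(\<integral>\<^sup>+x. f x \<partial>lborel) = (\<integral>\<^sup>+x. f (x + t) \<partial>lborel)"
  using nn_integral_real_affine[of f 1 t] by (simp add: add.commute)

text \<open>The joint density is \<open>\<alpha> * \<beta> * exp (- (\<beta> * u + \<alpha> * v +
  w))\<close> on the positive octant. On each of the regions \<open>v \<le> u\<close> and
  \<open>u < v\<close> the flip is a linear bijection of the region onto itself, a permutation of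
  coordinates combined with a translation of one of them. It preserves Lebesgue measure, and it
  leaves the exponent unchanged because \<open>\<alpha> + \<beta> = 1\<close>.\<close>

lemma nn_integral_burke:
  fixes H :: "real \<Rightarrow> real \<Rightarrow> real \<Rightarrow> ennreal"
  assumes H [measurable]: "(\<lambda>(u, v, w). H u v w) \<in> borel_measurable (borel \<Otimes>\<^sub>M borel \<Otimes>\<^sub>M borel)"
    and r: "0 < \<beta>" "0 < \<alpha>" "\<alpha> + \<beta> = 1"
  shows "exp3 \<beta> \<alpha> (\<lambda>u v w. H (max (u - v) 0 + w) (max (v - u) 0 + w) (min u v))
       = exp3 \<beta> \<alpha> (\<lambda>u v w. H u v w)"
proof -
  note [measurable (raw)] = measurable_apply3[OF H]
  define d where "d u v w = ennreal (exponential_density \<beta> u) *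
      (ennreal (exponential_density \<alpha> v) * ennreal (exponential_density 1 w))" for u v w
  have [measurable]: "(\<lambda>(u, v, w). d u v w) \<in> borel_measurable (borel \<Otimes>\<^sub>M borel \<Otimes>\<^sub>M borel)"
    unfolding d_def by measurable
  have to_lborel: "exp3 \<beta> \<alpha> (\<lambda>u v w. G u v w)
      = lborel3 (\<lambda>u v w. d u v w * G u v w)"
    if [measurable]: "(\<lambda>(u, v, w). G u v w) \<in> borel_measurable (borel \<Otimes>\<^sub>M borel \<Otimes>\<^sub>M borel)" for G
  proof -
    note [measurable (raw)] = measurable_apply3[OF that]
    have "lborel3 (\<lambda>u v w. d u v w * G u v w)
       = (\<integral>\<^sup>+u. ennreal (exponential_density \<beta> u) * (\<integral>\<^sup>+v. ennreal (exponential_density \<alpha> v) *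
          (\<integral>\<^sup>+w. ennreal (exponential_density 1 w) * G u v w \<partial>lborel) \<partial>lborel) \<partial>lborel)"
      unfolding d_def
      by (simp add: nn_integral_cmult[symmetric] mult.assoc)
    also have "\<dots> = exp3 \<beta> \<alpha> (\<lambda>u v w. G u v w)"
      by (subst nn_integral_exp_law, measurable)+
    finally show ?thesis ..
  qed
  define T where "T u v w = d u v w * H u v w" for u v w
  define K where "K u v w = d u v w * H (max (u - v) 0 + w) (max (v - u) 0 + w) (min u v)" for u v w
  have TK: "(\<lambda>(u, v, w). T u v w) \<in> borel_measurable (borel \<Otimes>\<^sub>M borel \<Otimes>\<^sub>M borel)"
    "(\<lambda>(u, v, w). K u v w) \<in> borel_measurable (borel \<Otimes>\<^sub>M borel \<Otimes>\<^sub>M borel)"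
    unfolding T_def K_def d_def case_prod_beta by measurable
  note [measurable (raw)] = TK[THEN measurable_apply3]
  have d_eq: "d u v w = ennreal (if u < 0 \<or> v < 0 \<or> w < 0 then 0 else \<alpha> * \<beta> * exp (- (u * \<beta> + v * \<alpha> + w)))" for u v w
    using r by (auto simp: d_def exponential_density_def ennreal_mult'[symmetric] exp_add[symmetric] algebra_simps)
  have \<alpha>: "\<alpha> = 1 - \<beta>" using r by simp
  \<comment> \<open>The term \<open>u - w + v\<close> is the old first coordinate in terms of the
    new triple \<open>(u, w, v)\<close>; the indicator keeps the positivity constraints of both
    sides equivalent.\<close>
  have dens1: "d (u - w + v) v w * (if w \<le> u then 1 else 0) = d u w v * (if w \<le> u then 1 else 0)" for u v w
  proof (cases "w \<le> u \<and> 0 \<le> v \<and> 0 \<le> w")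
    case True
    have "(u - w + v) * \<beta> + v * \<alpha> + w = u * \<beta> + w * \<alpha> + v" by (simp add: \<alpha> algebra_simps)
    then show ?thesis using True by (simp add: d_eq)
  qed (auto simp: d_eq)
  have dens2: "d u (v + u - w) w * (if w < v then 1 else 0) = d w v u * (if w < v then 1 else 0)" for u v w
  proof (cases "w < v \<and> 0 \<le> u \<and> 0 \<le> w")
    case True
    have "u * \<beta> + (v + u - w) * \<alpha> + w = w * \<beta> + v * \<alpha> + u" by (simp add: \<alpha> algebra_simps)
    then show ?thesis using True by (simp add: d_eq)
  qed (auto simp: d_eq)
  have 1: "lborel3 (\<lambda>u v w. K u v w * (if v \<le> u then 1 else 0))
      = lborel3 (\<lambda>u v w. T u v w * (if v \<le> u then 1 else 0))"
  proof -
    have "lborel3 (\<lambda>u v w. K u v w * (if v \<le> u then 1 else 0))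
       = lborel3 (\<lambda>v w u. K u v w * (if v \<le> u then 1 else 0))"
      by (rule nn_integral_lborel_perm3) measurable
    also have "\<dots> = lborel3 (\<lambda>v w u. T u w v * (if w \<le> u then 1 else 0))"
    proof (rule nn_integral_cong, rule nn_integral_cong)
      \<comment> \<open>For fixed \<open>v\<close> and \<open>w\<close> the flip acts on
        \<open>u\<close> as the translation by \<open>w - v\<close>, undone here by a change of
        variables without Jacobian.\<close>
      fix v w :: real
      have "(\<integral>\<^sup>+u. K u v w * (if v \<le> u then 1 else 0) \<partial>lborel)
          = (\<integral>\<^sup>+u. K (u + (v - w)) v w * (if v \<le> (u + (v - w)) then 1 else 0) \<partial>lborel)"
        by (rule nn_integral_lborel_translate) measurable
      also have "\<dots> = (\<integral>\<^sup>+u. T u w v * (if w \<le> u then 1 else 0) \<partial>lborel)"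
      proof (intro nn_integral_cong)
        fix u
        show "K (u + (v - w)) v w * (if v \<le> (u + (v - w)) then 1 else 0) = T u w v * (if w \<le> u then 1 else 0)"
          using dens1[of u w v] by (auto simp: K_def T_def algebra_simps)
      qed
      finally show "(\<integral>\<^sup>+u. K u v w * (if v \<le> u then 1 else 0) \<partial>lborel) = (\<integral>\<^sup>+u. T u w v * (if w \<le> u then 1 else 0) \<partial>lborel)" .
    qed
    also have "\<dots> = lborel3 (\<lambda>w u v. T u w v * (if w \<le> u then 1 else 0))"
      by (rule nn_integral_lborel_perm3) measurable
    also have "\<dots> = lborel3 (\<lambda>u v w. T u v w * (if v \<le> u then 1 else 0))"
      by (rule lborel_pair.Fubini') measurable
    finally show ?thesis .
  qed
  have 2: "lborel3 (\<lambda>u v w. K u v w * (if u < v then 1 else 0))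
      = lborel3 (\<lambda>u v w. T u v w * (if u < v then 1 else 0))"
  proof -
    have "lborel3 (\<lambda>u v w. K u v w * (if u < v then 1 else 0))
       = lborel3 (\<lambda>u w v. K u v w * (if u < v then 1 else 0))"
      by (rule nn_integral_lborel_perm3) measurable
    also have "\<dots> = lborel3 (\<lambda>u w v. T w v u * (if w < v then 1 else 0))"
    proof (rule nn_integral_cong, rule nn_integral_cong)
      fix u w :: real
      have "(\<integral>\<^sup>+v. K u v w * (if u < v then 1 else 0) \<partial>lborel)
          = (\<integral>\<^sup>+v. K u (v + (u - w)) w * (if u < (v + (u - w)) then 1 else 0) \<partial>lborel)"
        by (rule nn_integral_lborel_translate) measurable
      also have "\<dots> = (\<integral>\<^sup>+v. T w v u * (if w < v then 1 else 0) \<partial>lborel)"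
      proof (intro nn_integral_cong)
        fix v
        show "K u (v + (u - w)) w * (if u < (v + (u - w)) then 1 else 0) = T w v u * (if w < v then 1 else 0)"
          using dens2[of u v w] by (auto simp: K_def T_def algebra_simps)
      qed
      finally show "(\<integral>\<^sup>+v. K u v w * (if u < v then 1 else 0) \<partial>lborel) = (\<integral>\<^sup>+v. T w v u * (if w < v then 1 else 0) \<partial>lborel)" .
    qed
    also have "\<dots> = lborel3 (\<lambda>w v u. T w v u * (if w < v then 1 else 0))"
      by (rule nn_integral_lborel_perm3) measurable
    finally show ?thesis .
  qed
  have split: "lborel3 (\<lambda>u v w. G u v w)
     = lborel3 (\<lambda>u v w. G u v w * (if v \<le> u then 1 else 0))
     + lborel3 (\<lambda>u v w. G u v w * (if u < v then 1 else 0))"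
    if [measurable]: "(\<lambda>(u, v, w). G u v w) \<in> borel_measurable (borel \<Otimes>\<^sub>M borel \<Otimes>\<^sub>M borel)"
    for G :: "real \<Rightarrow> real \<Rightarrow> real \<Rightarrow> ennreal"
  proof -
    note [measurable (raw)] = measurable_apply3[OF that]
    have "lborel3 (\<lambda>u v w. G u v w)
       = lborel3 (\<lambda>u v w. G u v w * (if v \<le> u then 1 else 0) + G u v w * (if u < v then 1 else 0))"
      by (intro nn_integral_cong) auto
    also have "\<dots> = lborel3 (\<lambda>u v w. G u v w * (if v \<le> u then 1 else 0))
     + lborel3 (\<lambda>u v w. G u v w * (if u < v then 1 else 0))"
      by (simp add: nn_integral_add)
    finally show ?thesis .
  qed
  have "exp3 \<beta> \<alpha> (\<lambda>u v w. H (max (u - v) 0 + w) (max (v - u) 0 + w) (min u v))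
      = lborel3 (\<lambda>u v w. K u v w)"
    unfolding K_def by (rule to_lborel) (simp only: case_prod_beta', measurable)
  also have "\<dots> = lborel3 (\<lambda>u v w. T u v w)"
    by (simp only: split[OF TK(1)] split[OF TK(2)] 1 2)
  also have "\<dots> = exp3 \<beta> \<alpha> (\<lambda>u v w. H u v w)"
    unfolding T_def by (rule to_lborel[symmetric]) fact
  finally show ?thesis .
qed

lemma sigma_finite_exp_law_1: "sigma_finite_measure (exp_law 1)"
  using prob_space_exp_law[of 1] by (simp add: prob_space_imp_sigma_finite)

lemma nn_integral_exp_law_scale3:
  fixes K :: "real \<Rightarrow> real \<Rightarrow> real \<Rightarrow> ennreal"
  assumes K: "(\<lambda>(u, v, w). K u v w) \<in> borel_measurable (borel \<Otimes>\<^sub>M borel \<Otimes>\<^sub>M borel)"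
    and xy: "0 < x" "0 < y"
  shows "exp3 1 1 (\<lambda>u v w. K (x * u) (y * v) w)
    = exp3 (1 / x) (1 / y) (\<lambda>u v w. K u v w)"
proof -
  note [measurable (raw)] = measurable_apply3[OF K]
  interpret sigma_finite_measure "exp_law 1" by (rule sigma_finite_exp_law_1)
  interpret Y: sigma_finite_measure "exp_law (1 / y)"
    using prob_space_exp_law[of "1 / y"] xy by (simp add: prob_space_imp_sigma_finite)
  have m1: "(\<lambda>v. \<integral>\<^sup>+w. K u v w \<partial>exp_law 1) \<in> borel_measurable borel" for u
    by (rule borel_measurable_nn_integral, simp only: case_prod_beta', rule measurable_apply3[OF K]) measurable
  have m2: "(\<lambda>u. \<integral>\<^sup>+v. \<integral>\<^sup>+w. K u v w \<partial>exp_law 1 \<partial>exp_law (1 / y)) \<in> borel_measurable borel"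
    by (rule Y.borel_measurable_nn_integral, simp only: case_prod_beta', rule borel_measurable_nn_integral,
        simp only: case_prod_beta', rule measurable_apply3[OF K]) measurable
  have "(\<integral>\<^sup>+v. \<integral>\<^sup>+w. K u (y * v) w \<partial>exp_law 1 \<partial>exp_law 1) = (\<integral>\<^sup>+v. \<integral>\<^sup>+w. K u v w \<partial>exp_law 1 \<partial>exp_law (1 / y))" for u
    using xy by (intro nn_integral_exp_law_scale m1) simp_all
  then have "exp3 1 1 (\<lambda>u v w. K (x * u) (y * v) w)
     = exp3 1 (1 / y) (\<lambda>u v w. K (x * u) v w)" by simp
  also have "\<dots> = exp3 (1 / x) (1 / y) (\<lambda>u v w. K u v w)"
    using xy by (intro nn_integral_exp_law_scale[OF m2]) simp_all
  finally show ?thesis .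
qed

section \<open>Stationarity and exponential moments\<close>

definition iid_env :: "(nat \<times> nat \<Rightarrow> real) measure" where
  "iid_env = PiM half_space (\<lambda>_. exp_law 1)"

abbreviation envint :: "((nat \<times> nat \<Rightarrow> real) \<Rightarrow> ennreal) \<Rightarrow> ennreal" where
  "envint F \<equiv> \<integral>\<^sup>+E. F E \<partial>iid_env"

lemma prob_space_iid_env: "prob_space iid_env"
  unfolding iid_env_def by (intro prob_space_PiM prob_space_exp_law) simp

lemma measurable_iid_env_component:
  "p \<in> half_space \<Longrightarrow> (\<lambda>E. E p) \<in> borel_measurable iid_env"
  using measurable_component_singleton[of p half_space "\<lambda>_. exp_law 1"]
  by (simp add: iid_env_def cong: measurable_cong_sets)

lemma measurable_iid_env_upd:
  assumes "G \<in> measurable N iid_env" "h \<in> borel_measurable N" "p \<in> half_space"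
  shows "(\<lambda>E. (G E)(p := h E)) \<in> measurable N iid_env"
  unfolding iid_env_def
  by (rule measurable_fun_upd[where J = half_space])
     (use assms in \<open>auto simp: iid_env_def cong: measurable_cong_sets\<close>)

lemma nn_integral_iid_env_resample:
  assumes "F \<in> borel_measurable iid_env" "b \<in> half_space"
  shows "envint (\<lambda>E. F E) = envint (\<lambda>E. \<integral>\<^sup>+u. F (E(b := u)) \<partial>exp_law 1)"
  using assms unfolding iid_env_def
  by (intro nn_integral_PiM_resample) (auto intro: prob_space_exp_law)

lemma borel_measurable_iid_env_resample:
  assumes "F \<in> borel_measurable iid_env" "b \<in> half_space"
  shows "(\<lambda>E. \<integral>\<^sup>+u. F (E(b := u)) \<partial>exp_law 1) \<in> borel_measurable iid_env"
proof -
  interpret sigma_finite_measure "exp_law 1" by (rule sigma_finite_exp_law_1)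
  show ?thesis unfolding case_prod_beta'
    by (rule borel_measurable_nn_integral, unfold case_prod_beta',
        rule measurable_compose[OF measurable_iid_env_upd assms(1)]) (use assms in auto)
qed

lemma nn_integral_iid_env_resample3:
  assumes F: "F \<in> borel_measurable iid_env"
    and hs: "a \<in> half_space" "b \<in> half_space" "c \<in> half_space"
  shows "envint (\<lambda>E. F E) = envint (\<lambda>E. \<integral>\<^sup>+u. \<integral>\<^sup>+v. \<integral>\<^sup>+w. F (E(a := u, b := v, c := w))
      \<partial>exp_law 1 \<partial>exp_law 1 \<partial>exp_law 1)"
proof -
  note meas = borel_measurable_iid_env_resample[OF F hs(3)]
  have "envint (\<lambda>E. F E) = envint (\<lambda>E. \<integral>\<^sup>+w. F (E(c := w)) \<partial>exp_law 1)"
    by (rule nn_integral_iid_env_resample) fact+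
  also have "\<dots> = envint (\<lambda>E. \<integral>\<^sup>+v. \<integral>\<^sup>+w. F (E(b := v, c := w)) \<partial>exp_law 1 \<partial>exp_law 1)"
    by (rule nn_integral_iid_env_resample[OF meas hs(2)])
  also have "\<dots> = envint (\<lambda>E. \<integral>\<^sup>+u. \<integral>\<^sup>+v. \<integral>\<^sup>+w. F (E(a := u, b := v, c := w))
      \<partial>exp_law 1 \<partial>exp_law 1 \<partial>exp_law 1)"
    by (rule nn_integral_iid_env_resample[OF borel_measurable_iid_env_resample[OF meas hs(2)] hs(1)])
  finally show ?thesis .
qed

lemma measurable_corner_flip [measurable]:
  "1 \<le> k \<Longrightarrow> corner_flip x y k \<in> measurable iid_env iid_env"
  unfolding corner_flip_def[abs_def]
  by (intro measurable_iid_env_upd measurable_ident borel_measurable_add borel_measurable_divide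
        borel_measurable_max borel_measurable_min borel_measurable_diff borel_measurable_times
        borel_measurable_const measurable_iid_env_component) (auto simp: half_space_def)

text \<open>The three coordinates involved are resampled. Multiplication by \<open>x\<close> and
  \<open>y\<close> turns two standard exponentials into exponentials of rates \<open>1 / x\<close>
  and \<open>1 / y\<close>, whose sum is 1 as \<open>nn_integral_burke\<close> demands.\<close>

lemma nn_integral_corner_flip:
  assumes F [measurable]: "F \<in> borel_measurable iid_env"
    and xy: "0 < x" "0 < y" "1 / x + 1 / y = 1" and k: "2 \<le> k"
  shows "envint (\<lambda>E. F (corner_flip x y k E)) = envint (\<lambda>E. F E)"
proof -
  let ?a = "(k, 0::nat)" and ?b = "(1::nat, 1::nat)" and ?c = "(k, 1::nat)"
  have hs: "?a \<in> half_space" "?b \<in> half_space" "?c \<in> half_space"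
    using k by (auto simp: half_space_def)
  have "envint (\<lambda>E. F (corner_flip x y k E))
    = envint (\<lambda>E. \<integral>\<^sup>+u. \<integral>\<^sup>+v. \<integral>\<^sup>+w. F (corner_flip x y k (E(?a := u, ?b := v, ?c := w)))
      \<partial>exp_law 1 \<partial>exp_law 1 \<partial>exp_law 1)"
    by (rule nn_integral_iid_env_resample3[OF measurable_compose[OF measurable_corner_flip F] hs]) (use k in simp)
  also have "\<dots> = envint (\<lambda>E. \<integral>\<^sup>+u. \<integral>\<^sup>+v. \<integral>\<^sup>+w. F (E(?a := u, ?b := v, ?c := w))
      \<partial>exp_law 1 \<partial>exp_law 1 \<partial>exp_law 1)"
  proof (rule nn_integral_cong)
    fix E assume E: "E \<in> space iid_env"
    define H where "H u v w = F (E(?a := u / x, ?b := v / y, ?c := w))" for u v w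
    have H: "(\<lambda>(u, v, w). H u v w) \<in> borel_measurable (borel \<Otimes>\<^sub>M borel \<Otimes>\<^sub>M borel)"
      unfolding H_def case_prod_beta' using E hs
      by (intro measurable_compose[OF measurable_iid_env_upd F] measurable_iid_env_upd) (auto simp: measurable_const)
    note [measurable (raw)] = measurable_apply3[OF H]
    have "exp3 1 1 (\<lambda>u v w. F (corner_flip x y k (E(?a := u, ?b := v, ?c := w))))
      = exp3 1 1 (\<lambda>u v w. H (max (x * u - y * v) 0 + w) (max (y * v - x * u) 0 + w) (min (x * u) (y * v)))"
      using k by (intro nn_integral_cong) (simp add: H_def corner_flip_def fun_upd_twist)
    also have "\<dots> = exp3 (1 / x) (1 / y) (\<lambda>u v w. H (max (u - v) 0 + w) (max (v - u) 0 + w) (min u v))"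
      by (rule nn_integral_exp_law_scale3[OF _ xy(1,2), where K = "\<lambda>u v w. H (max (u - v) 0 + w) (max (v - u) 0 + w) (min u v)"])
         (simp only: case_prod_beta', measurable)
    also have "\<dots> = exp3 (1 / x) (1 / y) (\<lambda>u v w. H u v w)"
      by (rule nn_integral_burke[OF H]) (use xy in auto)
    also have "\<dots> = exp3 1 1 (\<lambda>u v w. H (x * u) (y * v) w)"
      by (rule nn_integral_exp_law_scale3[OF H xy(1,2), symmetric])
    also have "\<dots> = exp3 1 1 (\<lambda>u v w. F (E(?a := u, ?b := v, ?c := w)))" using xy by (simp add: H_def)
    finally show "exp3 1 1 (\<lambda>u v w. F (corner_flip x y k (E(?a := u, ?b := v, ?c := w)))) = \<dots>" .
  qed
  also have "\<dots> = envint (\<lambda>E. F E)"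
    by (rule nn_integral_iid_env_resample3[OF F hs, symmetric])
  finally show ?thesis .
qed

lemma measurable_corner_flips [measurable]: "corner_flips x y n \<in> measurable iid_env iid_env"
proof (induction n)
  case (Suc n)
  then show ?case using measurable_compose[OF Suc measurable_corner_flip[of "Suc (Suc n)" x y]]
    by (simp add: fun_eq_iff[symmetric] cong: measurable_cong)
qed (simp cong: measurable_cong)

lemma nn_integral_corner_flips:
  assumes F [measurable]: "F \<in> borel_measurable iid_env"
    and xy: "0 < x" "0 < y" "1 / x + 1 / y = 1"
  shows "envint (\<lambda>E. F (corner_flips x y n E)) = envint (\<lambda>E. F E)"
  using F
proof (induction n arbitrary: F)
  case (Suc n)
  note [measurable] = Suc.prems
  have "envint (\<lambda>E. F (corner_flip x y (Suc (Suc n)) (corner_flips x y n E)))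
      = envint (\<lambda>E. F (corner_flip x y (Suc (Suc n)) E))"
    by (rule Suc.IH) measurable
  also have "\<dots> = envint (\<lambda>E. F E)" by (rule nn_integral_corner_flip) (use xy Suc.prems in auto)
  finally show ?case by simp
qed simp

lemma inj_on_row_shift: "inj_on row_shift half_space" "row_shift \<in> half_space \<rightarrow> half_space"
  by (auto simp: inj_on_def row_shift_def half_space_def split: if_splits)

lemma measurable_row_shift [measurable]:
  "(\<lambda>E. \<lambda>p\<in>half_space. E (row_shift p)) \<in> measurable iid_env iid_env"
proof -
  have "(\<lambda>E. \<lambda>p\<in>half_space. E (row_shift p)) \<in> measurable iid_env (PiM half_space (\<lambda>_. exp_law 1))"
    by (intro measurable_restrict)
       (use inj_on_row_shift(2) measurable_iid_env_component in \<open>auto simp: Pi_iff cong: measurable_cong_sets\<close>)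
  then show ?thesis by (simp only: iid_env_def)
qed

lemma measurable_next_row [measurable]: "next_row x y n \<in> measurable iid_env iid_env"
  unfolding next_row_def[abs_def]
  by (rule measurable_compose[OF measurable_corner_flips measurable_row_shift])

text \<open>The flips preserve the i.i.d. law and \<open>row_shift\<close> selects distinct
  coordinates, so removing a row from the stationary model reproduces the law of the
  environment.\<close>

lemma nn_integral_next_row:
  assumes F [measurable]: "F \<in> borel_measurable iid_env"
    and xy: "0 < x" "0 < y" "1 / x + 1 / y = 1"
  shows "envint (\<lambda>E. F (next_row x y n E)) = envint (\<lambda>E. F E)"
proof -
  have "envint (\<lambda>E. F (next_row x y n E)) = envint (\<lambda>E. F (\<lambda>p\<in>half_space. E (row_shift p)))"
    unfolding next_row_def
    by (rule nn_integral_corner_flips[where F = "\<lambda>E. F (\<lambda>p\<in>half_space. E (row_shift p))"]) (use xy in auto)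
  also have "\<dots> = (\<integral>\<^sup>+E. F E \<partial>distr iid_env iid_env (\<lambda>E. \<lambda>p\<in>half_space. E (row_shift p)))"
    by (subst nn_integral_distr[OF measurable_row_shift]) (use F in auto)
  also have "distr iid_env iid_env (\<lambda>E. \<lambda>p\<in>half_space. E (row_shift p)) = iid_env"
    unfolding iid_env_def
    by (rule distr_PiM_reindex[of half_space "\<lambda>_. exp_law 1"]) (use inj_on_row_shift prob_space_exp_law in auto)
  finally show ?thesis .
qed

lemma measurable_lpp_scaled [measurable]:
  "j \<le> i \<Longrightarrow> (\<lambda>E. lpp (scaled_weights x y E) i j) \<in> borel_measurable iid_env"
proof (induction "\<lambda>_::nat\<times>nat. 0::real" i j rule: lpp.induct)
  case (2 i)
  have "(\<lambda>E. x * E (Suc i, 0)) \<in> borel_measurable iid_env"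
    by (intro borel_measurable_times borel_measurable_const measurable_iid_env_component)
       (simp add: half_space_def)
  moreover have "lpp (scaled_weights x y E) (Suc i) 0 = lpp (scaled_weights x y E) i 0 + x * E (Suc i, 0)" for E
    by (simp add: scaled_weights_def)
  ultimately show ?case using 2 by simp
next
  case (3 i j)
  have [measurable]: "(\<lambda>E. E (Suc i, Suc j)) \<in> borel_measurable iid_env"
    by (rule measurable_iid_env_component) (use 3 in \<open>simp add: half_space_def\<close>)
  have "lpp (scaled_weights x y E) (Suc i) (Suc j) = (if j < i
      then max (lpp (scaled_weights x y E) i (Suc j)) (lpp (scaled_weights x y E) (Suc i) j) + E (Suc i, Suc j)
      else lpp (scaled_weights x y E) (Suc i) j + y * E (Suc i, Suc j))" for E
    using 3(4) by (simp add: scaled_weights_def)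
  moreover have "(\<lambda>E. E (Suc i, Suc i)) \<in> borel_measurable iid_env"
    by (rule measurable_iid_env_component) (simp add: half_space_def)
  moreover have "j = i" if "\<not> j < i" using 3(4) that by simp
  ultimately show ?case using 3 by (cases "j < i") simp_all
qed simp

lemma measurable_diag_lpp [measurable]: "(\<lambda>E. diag_lpp x y E n) \<in> borel_measurable iid_env"
  unfolding diag_lpp_def by measurable

text \<open>By \<open>diag_lpp_next_row\<close>, the increment started at \<open>Suc m\<close>
  equals the increment started at \<open>m\<close> in the next environment, which has the same law.
  Iteration moves the starting point to the origin.\<close>

theorem diag_lpp_stationary_increments:
  assumes f [measurable]: "f \<in> borel_measurable borel"
    and xy: "0 < x" "0 < y" "1 / x + 1 / y = 1"
  shows "envint (\<lambda>E. f (diag_lpp x y E (m + k) - diag_lpp x y E m)) = envint (\<lambda>E. f (diag_lpp x y E k))"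
proof (induction m)
  case 0
  then show ?case by (simp add: diag_lpp_def)
next
  case (Suc m)
  have "envint (\<lambda>E. f (diag_lpp x y E (Suc m + k) - diag_lpp x y E (Suc m)))
     = envint (\<lambda>E. f (diag_lpp x y (next_row x y (m + k) E) (m + k) - diag_lpp x y (next_row x y (m + k) E) m))"
    using xy by (simp add: diag_lpp_next_row[where n = "m + k"])
  also have "\<dots> = envint (\<lambda>E. f (diag_lpp x y E (m + k) - diag_lpp x y E m))"
    by (rule nn_integral_next_row) (use xy in auto)
  finally show ?case using Suc by simp
qed

section \<open>Exponential moments of the perturbed model\<close>

lemma corner_flips_upd_first: "corner_flips x y n (E((1, 0) := u)) = (corner_flips x y n E)((1, 0) := u)"
  by (induction n) (auto simp: corner_flip_def fun_eq_iff)

lemma next_row_upd_first: "next_row x y n (E((1, 0) := u)) = next_row x y n E"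
  by (auto simp: next_row_def corner_flips_upd_first row_shift_def fun_eq_iff simp del: One_nat_def split: prod.split)

text \<open>The flips see the corner weight only through the product \<open>y * E (1, 1)\<close>. A
  perturbed diagonal scale therefore acts on the next row like a rescaling of one weight followed by
  the stationary map, and the latter preserves the law.\<close>

lemma corner_flips_rescale_corner:
  assumes "0 < y" "0 < y'"
  shows "corner_flips x y n (E((1, 1) := y' / y * E (1, 1)))
       = (corner_flips x y' n E)((1, 1) := y' / y * corner_flips x y' n E (1, 1))"
  using assms by (induction n) (auto simp: corner_flip_def fun_eq_iff)

lemma next_row_rescale_corner:
  assumes "0 < y" "0 < y'"
  shows "next_row x y' n E = next_row x y n (E((1, 1) := y' / y * E (1, 1)))"
  unfolding next_row_def corner_flips_rescale_corner[OF assms]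
  by (auto simp: row_shift_def fun_eq_iff simp del: One_nat_def split: prod.split)

text \<open>The flips never read \<open>(1, 0)\<close> and \<open>row_shift\<close> skips it, so
  this weight is independent of the next environment.\<close>

lemma nn_integral_first_weight_next_row:
  assumes g: "g \<in> borel_measurable borel" and Q: "Q \<in> borel_measurable iid_env"
    and xy: "0 < x" "0 < y" "1 / x + 1 / y = 1"
  shows "envint (\<lambda>E. g (E (1, 0)) * Q (next_row x y n E))
      = (\<integral>\<^sup>+u. g u \<partial>exp_law 1) * envint (\<lambda>E. Q E)"
proof -
  have hs: "(1, 0) \<in> half_space" by (simp add: half_space_def)
  have QN: "(\<lambda>E. Q (next_row x y n E)) \<in> borel_measurable iid_env"
    by (rule measurable_compose[OF measurable_next_row Q])
  have "envint (\<lambda>E. g (E (1, 0)) * Q (next_row x y n E))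
     = envint (\<lambda>E. \<integral>\<^sup>+u. g u * Q (next_row x y n E) \<partial>exp_law 1)"
    by (subst nn_integral_iid_env_resample[OF _ hs])
       (use QN measurable_compose[OF measurable_iid_env_component[OF hs] g] in \<open>auto simp: next_row_upd_first simp del: One_nat_def\<close>)
  also have "\<dots> = envint (\<lambda>E. (\<integral>\<^sup>+u. g u \<partial>exp_law 1) * Q (next_row x y n E))"
    using g by (intro nn_integral_cong nn_integral_multc) (auto cong: measurable_cong_sets)
  also have "\<dots> = (\<integral>\<^sup>+u. g u \<partial>exp_law 1) * envint (\<lambda>E. Q (next_row x y n E))"
    by (rule nn_integral_cmult[OF QN])
  finally show ?thesis by (simp add: nn_integral_next_row[OF Q xy])
qed

text \<open>The weight \<open>y' * u\<close> has rate \<open>1 / y'\<close>; tilting by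
  \<open>s\<close> changes the rate to \<open>1 / y' - s = 1 / y\<close>, at the price of the
  normalising constant \<open>y / y'\<close>. Under the tilted law \<open>y' / y * u\<close> is
  again standard exponential.\<close>

lemma nn_integral_exp_law_tilt:
  assumes f [measurable]: "f \<in> borel_measurable borel"
    and "0 < y" "0 < y'" "s = 1 / y' - 1 / y"
  shows "(\<integral>\<^sup>+u. ennreal (exp (s * (y' * u))) * f (y' / y * u) \<partial>exp_law 1)
      = ennreal (y / y') * (\<integral>\<^sup>+u. f u \<partial>exp_law 1)"
proof -
  define c where "c = y / y'"
  have c: "0 < c" "s * (y' * (c * u)) = y * u / y' - u" for u
    unfolding c_def assms(4) using assms(2,3) by (auto simp: field_simps)
  have "(\<integral>\<^sup>+u. ennreal (exp (s * (y' * u))) * f (y' / y * u) \<partial>exp_law 1)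
     = (\<integral>\<^sup>+u. ennreal (exponential_density 1 u) * (ennreal (exp (s * (y' * u))) * f (y' / y * u)) \<partial>lborel)"
    by (rule nn_integral_exp_law) measurable
  also have "\<dots> = c * (\<integral>\<^sup>+u. ennreal (exponential_density 1 (0 + c * u)) *
      (ennreal (exp (s * (y' * (0 + c * u)))) * f (y' / y * (0 + c * u))) \<partial>lborel)"
    using c by (subst nn_integral_real_affine[where c = c and t = 0]) auto
  also have "(\<integral>\<^sup>+u. ennreal (exponential_density 1 (0 + c * u)) *
      (ennreal (exp (s * (y' * (0 + c * u)))) * f (y' / y * (0 + c * u))) \<partial>lborel)
     = (\<integral>\<^sup>+u. ennreal (exponential_density 1 u) * f u \<partial>lborel)"
  proof (rule nn_integral_cong)
    fix u
    have "y' / y * (c * u) = u" using assms by (simp add: c_def)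
    moreover have "c * u < 0 \<longleftrightarrow> u < 0" using c by (simp add: mult_less_0_iff)
    moreover have "- (c * u) + (y * u / y' - u) = - u" by (simp add: c_def)
    then have "exp (- (c * u)) * exp (y * u / y' - u) = exp (- u)" by (simp only: exp_add[symmetric])
    ultimately show "ennreal (exponential_density 1 (0 + c * u)) *
      (ennreal (exp (s * (y' * (0 + c * u)))) * f (y' / y * (0 + c * u))) = ennreal (exponential_density 1 u) * f u"
      using c(2)[of u] by (auto simp: exponential_density_def mult.assoc[symmetric] ennreal_mult'[symmetric])
  qed
  also have "\<dots> = (\<integral>\<^sup>+u. f u \<partial>exp_law 1)" by (simp add: nn_integral_exp_law)
  finally show ?thesis by (simp add: c_def)
qed

lemma nn_integral_exp_law_mgf:
  assumes "t < 1"
  shows "(\<integral>\<^sup>+u. ennreal (exp (t * u)) \<partial>exp_law 1) = ennreal (1 / (1 - t))"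
proof -
  have "(\<integral>\<^sup>+u. ennreal (exp (t * (1 * u))) * 1 \<partial>exp_law 1)
      = ennreal (1 / (1 - t) / 1) * (\<integral>\<^sup>+u. 1 \<partial>exp_law 1)"
    by (rule nn_integral_exp_law_tilt) (use assms in auto)
  then show ?thesis using prob_space.emeasure_space_1[OF prob_space_exp_law[of 1]] by simp
qed

text \<open>Tilting the diagonal weights by the exponential of the last passage time turns the model with
  diagonal scale \<open>y'\<close> into the stationary one.\<close>
theorem diag_lpp_mgf:
  assumes xy: "0 < x" "0 < y" "1 / x + 1 / y = 1"
    and s: "0 < y'" "s = 1 / y' - 1 / y" "s * x < 1"
  shows "envint (\<lambda>E. ennreal (exp (s * diag_lpp x y' E n))) = ennreal (((y / y') / (1 - s * x)) ^ n)"
proof (induction n)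
  case 0
  then show ?case using prob_space.emeasure_space_1[OF prob_space_iid_env] by (simp add: diag_lpp_def)
next
  case (Suc n)
  have hs: "(1, 1) \<in> half_space" "(1, 0) \<in> half_space" by (auto simp: half_space_def)
  note [measurable] = measurable_iid_env_component[OF hs(1)] measurable_iid_env_component[OF hs(2)]
  define g where "g u = ennreal (exp (s * x * u))" for u
  define Q where "Q E = ennreal (exp (s * diag_lpp x y' E n))" for E
  have [measurable]: "g \<in> borel_measurable borel" "Q \<in> borel_measurable iid_env"
    unfolding g_def Q_def by measurable
  have QN [measurable]: "(\<lambda>E. Q (next_row x z n E)) \<in> borel_measurable iid_env" for z
    by (rule measurable_compose[OF measurable_next_row]) simp
  \<comment> \<open>The factors are the boundary weight, the corner weight and the rest. The first
    is independent of the others; the second also enters the third, through the flips.\<close>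
  have exp_Suc: "ennreal (exp (s * diag_lpp x y' E (Suc n)))
      = g (E (1, 0)) * ennreal (exp (s * (y' * E (1, 1)))) * Q (next_row x y' n E)" for E
    using xy s by (simp add: diag_lpp_next_row[where n = n] g_def Q_def exp_add distrib_left ennreal_mult'[symmetric] mult_ac)
  have "envint (\<lambda>E. ennreal (exp (s * diag_lpp x y' E (Suc n))))
      = envint (\<lambda>E. \<integral>\<^sup>+u. g (E (1, 0)) * (ennreal (exp (s * (y' * u)))
          * Q (next_row x y n (E((1, 1) := y' / y * u)))) \<partial>exp_law 1)"
    unfolding exp_Suc
    by (subst nn_integral_iid_env_resample[OF _ hs(1)], measurable)
       (simp add: next_row_rescale_corner[OF xy(2) s(1)] mult.assoc)
  \<comment> \<open>The tilt of the corner weight replaces \<open>y' / y * u\<close> by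
    \<open>u\<close>, leaving the stationary row map applied to an untilted corner.\<close>
  also have "\<dots> = envint (\<lambda>E. g (E (1, 0)) * (ennreal (y / y') *
      (\<integral>\<^sup>+u. Q (next_row x y n (E((1, 1) := u))) \<partial>exp_law 1)))"
  proof (rule nn_integral_cong)
    fix E assume E: "E \<in> space iid_env"
    define q where "q u = Q (next_row x y n (E((1, 1) := u)))" for u
    have q: "q \<in> borel_measurable borel"
      unfolding q_def
      by (rule measurable_compose[OF measurable_iid_env_upd QN]) (use E hs in \<open>auto simp: measurable_const\<close>)
    have "(\<integral>\<^sup>+u. g (E (1, 0)) * (ennreal (exp (s * (y' * u))) * q (y' / y * u)) \<partial>exp_law 1)
       = g (E (1, 0)) * (\<integral>\<^sup>+u. ennreal (exp (s * (y' * u))) * q (y' / y * u) \<partial>exp_law 1)"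
      using measurable_compose[of "\<lambda>u. y' / y * u" borel borel q] q
      by (intro nn_integral_cmult) (auto cong: measurable_cong_sets)
    also have "\<dots> = g (E (1, 0)) * (ennreal (y / y') * (\<integral>\<^sup>+u. q u \<partial>exp_law 1))"
      by (subst nn_integral_exp_law_tilt[OF q xy(2) s(1,2)]) simp
    finally show "(\<integral>\<^sup>+u. g (E (1, 0)) * (ennreal (exp (s * (y' * u)))
          * Q (next_row x y n (E((1, 1) := y' / y * u)))) \<partial>exp_law 1) = g (E (1, 0)) * (ennreal (y / y') *
      (\<integral>\<^sup>+u. Q (next_row x y n (E((1, 1) := u))) \<partial>exp_law 1))" by (simp only: q_def)
  qed
  also have "\<dots> = ennreal (y / y') * envint (\<lambda>E. g (E (1, 0)) *
      (\<integral>\<^sup>+u. Q (next_row x y n (E((1, 1) := u))) \<partial>exp_law 1))"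
    by (subst nn_integral_cmult[symmetric])
       (use borel_measurable_iid_env_resample[OF QN hs(1)] in \<open>auto intro!: nn_integral_cong simp: mult_ac simp del: One_nat_def\<close>)
  \<comment> \<open>With the resampled corner put back, \<open>Q\<close> is evaluated in an
    environment with the law of \<open>E\<close>, so that the induction hypothesis applies.\<close>
  also have "envint (\<lambda>E. g (E (1, 0)) * (\<integral>\<^sup>+u. Q (next_row x y n (E((1, 1) := u))) \<partial>exp_law 1))
      = envint (\<lambda>E. g (E (1, 0)) * Q (next_row x y n E))"
  proof -
    have gQ: "(\<lambda>E. g (E (1, 0)) * Q (next_row x y n E)) \<in> borel_measurable iid_env"
      by measurable
    have "envint (\<lambda>E. g (E (1, 0)) * Q (next_row x y n E))
        = envint (\<lambda>E. \<integral>\<^sup>+u. g (E (1, 0)) * Q (next_row x y n (E((1, 1) := u))) \<partial>exp_law 1)"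
      using nn_integral_iid_env_resample[OF gQ hs(1)] by (simp del: One_nat_def)
    also have "\<dots> = envint (\<lambda>E. g (E (1, 0)) * (\<integral>\<^sup>+u. Q (next_row x y n (E((1, 1) := u))) \<partial>exp_law 1))"
    proof (rule nn_integral_cong)
      fix E assume E: "E \<in> space iid_env"
      show "(\<integral>\<^sup>+u. g (E (1, 0)) * Q (next_row x y n (E((1, 1) := u))) \<partial>exp_law 1)
        = g (E (1, 0)) * (\<integral>\<^sup>+u. Q (next_row x y n (E((1, 1) := u))) \<partial>exp_law 1)"
        by (rule nn_integral_cmult, rule measurable_compose[OF measurable_iid_env_upd QN])
           (use E hs in \<open>auto simp: measurable_const intro: measurable_ident_sets\<close>)
    qed
    finally show ?thesis ..
  qed
  also have "\<dots> = ennreal (1 / (1 - s * x)) * ennreal (((y / y') / (1 - s * x)) ^ n)"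
  proof -
    have "(\<integral>\<^sup>+u. g u \<partial>exp_law 1) = ennreal (1 / (1 - s * x))"
      unfolding g_def by (rule nn_integral_exp_law_mgf[OF s(3)])
    moreover have "envint (\<lambda>E. Q E) = ennreal (((y / y') / (1 - s * x)) ^ n)"
      unfolding Q_def by (rule Suc)
    ultimately show ?thesis by (subst nn_integral_first_weight_next_row) (use xy in auto)
  qed
  also have "ennreal (y / y') * (ennreal (1 / (1 - s * x)) * ennreal (((y / y') / (1 - s * x)) ^ n))
      = ennreal (((y / y') / (1 - s * x)) ^ Suc n)"
    using xy s by (simp add: ennreal_mult'[symmetric])
  finally show ?case .
qed

section \<open>Fourth moments and chaining\<close>

lemma pow4_le_exp: "0 \<le> u \<Longrightarrow> u ^ 4 \<le> 24 * exp (u::real)"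
proof -
  assume u: "0 \<le> u"
  have "summable (\<lambda>n. u ^ n /\<^sub>R fact n)" by (rule summable_exp_generic)
  moreover have "0 \<le> u ^ n /\<^sub>R fact n" for n using u by simp
  ultimately have "(\<Sum>n\<in>{4}. u ^ n /\<^sub>R fact n) \<le> (\<Sum>n. u ^ n /\<^sub>R fact n)"
    by (intro sum_le_suminf) auto
  moreover have "(\<Sum>n\<in>{4::nat}. u ^ n /\<^sub>R fact n) = u ^ 4 / 24" by (simp add: fact_numeral)
  ultimately have "u ^ 4 / 24 \<le> exp u" by (simp only: exp_def)
  then show ?thesis by simp
qed

lemma pow4_sum_le2: "(a + b) ^ 4 \<le> 8 * (a ^ 4 + b ^ 4)" for a b :: real
proof -
  have "8 * (a ^ 4 + b ^ 4) - (a + b) ^ 4 = (a - b) ^ 2 * (7 * a\<^sup>2 + 10 * a * b + 7 * b\<^sup>2)"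
    by (simp add: power_def algebra_simps numeral_eq_Suc)
  also have "7 * a\<^sup>2 + 10 * a * b + 7 * b\<^sup>2 = 5 * (a + b)\<^sup>2 + 2 * a\<^sup>2 + 2 * b\<^sup>2"
    by (simp add: power2_eq_square algebra_simps)
  finally show ?thesis by (smt (verit) mult_nonneg_nonneg zero_le_power2)
qed

lemma pow4_sum_le3: "(a + b + c) ^ 4 \<le> 64 * (a ^ 4 + b ^ 4 + c ^ 4)" for a b c :: real
  using pow4_sum_le2[of "a + b" c] pow4_sum_le2[of a b] by (smt (verit) zero_le_power_eq_numeral even_numeral)

text \<open>Jensen's inequality for \<open>u + v = 1/11 * (11 * u) + 10/11 * (11/10 * v)\<close>.
  The coefficient of \<open>v ^ 4\<close> has to stay close to 1, since it enters the growth rate of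
  the recursion in \<open>chaining_dyadic\<close>.\<close>

lemma pow4_sum_weighted:
  fixes u v :: real
  assumes "0 \<le> u" "0 \<le> v"
  shows "(u + v) ^ 4 \<le> 1331 * u ^ 4 + 1331 / 1000 * v ^ 4"
proof -
  have "convex_on {0..} (\<lambda>x::real. x ^ 4)" by (rule convex_on_realI[where f' = "\<lambda>x. 4 * x ^ 3"]) (auto intro!: derivative_eq_intros power_mono)
  then have "((1 - 10 / 11) *\<^sub>R (11 * u) + (10 / 11) *\<^sub>R (11 / 10 * v)) ^ 4
      \<le> (1 - 10 / 11) * (11 * u) ^ 4 + (10 / 11) * (11 / 10 * v) ^ 4"
    by (rule convex_onD) (use assms in auto)
  then show ?thesis by (simp add: power_mult_distrib power_divide)
qed

lemma nn_integral_lincomb_le: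
  assumes [measurable]: "g \<in> borel_measurable M" "h \<in> borel_measurable M"
    and "0 \<le> a" "0 \<le> b" "0 \<le> c" "0 \<le> d" "\<And>\<omega>. 0 \<le> g \<omega>" "\<And>\<omega>. 0 \<le> h \<omega>"
    and "(\<integral>\<^sup>+\<omega>. ennreal (g \<omega>) \<partial>M) \<le> ennreal c" "(\<integral>\<^sup>+\<omega>. ennreal (h \<omega>) \<partial>M) \<le> ennreal d"
    and le: "\<And>\<omega>. f \<omega> \<le> a * g \<omega> + b * h \<omega>"
  shows "(\<integral>\<^sup>+\<omega>. ennreal (f \<omega>) \<partial>M) \<le> ennreal (a * c + b * d)"
proof -
  have "(\<integral>\<^sup>+\<omega>. ennreal (f \<omega>) \<partial>M) \<le> (\<integral>\<^sup>+\<omega>. ennreal a * ennreal (g \<omega>) + ennreal b * ennreal (h \<omega>) \<partial>M)"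
  proof (rule nn_integral_mono)
    fix \<omega>
    have "ennreal (f \<omega>) \<le> ennreal (a * g \<omega> + b * h \<omega>)" by (rule ennreal_leI[OF le])
    then show "ennreal (f \<omega>) \<le> ennreal a * ennreal (g \<omega>) + ennreal b * ennreal (h \<omega>)"
      using assms by (simp add: ennreal_plus ennreal_mult)
  qed
  also have "\<dots> = ennreal a * (\<integral>\<^sup>+\<omega>. ennreal (g \<omega>) \<partial>M) + ennreal b * (\<integral>\<^sup>+\<omega>. ennreal (h \<omega>) \<partial>M)"
    by (simp add: nn_integral_add nn_integral_cmult)
  also have "\<dots> \<le> ennreal a * ennreal c + ennreal b * ennreal d"
    using assms by (intro add_mono mult_left_mono) auto
  also have "\<dots> = ennreal (a * c + b * d)" using assms by (simp add: ennreal_plus ennreal_mult)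
  finally show ?thesis .
qed

lemma nn_integral_pow4_from_mgf:
  assumes Z [measurable]: "Z \<in> borel_measurable M" and "0 < t" "0 \<le> c"
    and "(\<integral>\<^sup>+E. ennreal (exp (t * Z E)) \<partial>M) \<le> ennreal c"
  shows "(\<integral>\<^sup>+E. ennreal (max (Z E) 0 ^ 4) \<partial>M) \<le> ennreal (24 * c / t ^ 4)"
proof -
  have "max (Z E) 0 ^ 4 \<le> 24 / t ^ 4 * exp (t * Z E)" for E
  proof (cases "0 \<le> Z E")
    case True
    then show ?thesis using pow4_le_exp[of "t * Z E"] assms(2) by (simp add: field_simps)
  qed (use assms(2) in auto)
  then have "(\<integral>\<^sup>+E. ennreal (max (Z E) 0 ^ 4) \<partial>M) \<le> (\<integral>\<^sup>+E. ennreal (24 / t ^ 4) * ennreal (exp (t * Z E)) \<partial>M)"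
    using assms(2) by (intro nn_integral_mono) (simp add: ennreal_mult'[symmetric] ennreal_leI)
  also have "\<dots> = ennreal (24 / t ^ 4) * (\<integral>\<^sup>+E. ennreal (exp (t * Z E)) \<partial>M)"
    by (rule nn_integral_cmult) measurable
  also have "\<dots> \<le> ennreal (24 / t ^ 4) * ennreal c" by (rule mult_left_mono[OF assms(4)]) simp
  finally show ?thesis using assms by (simp add: ennreal_mult'[symmetric])
qed

lemma nn_integral_pow4_from_mgf2:
  assumes Z [measurable]: "Z \<in> borel_measurable M" and "0 < t" "0 \<le> c"
    and "(\<integral>\<^sup>+E. ennreal (exp (t * Z E)) \<partial>M) \<le> ennreal c"
    and "(\<integral>\<^sup>+E. ennreal (exp (- t * Z E)) \<partial>M) \<le> ennreal c"
  shows "(\<integral>\<^sup>+E. ennreal (Z E ^ 4) \<partial>M) \<le> ennreal (48 * c / t ^ 4)"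
proof -
  have "ennreal (Z E ^ 4) = ennreal (max (Z E) 0 ^ 4) + ennreal (max (- Z E) 0 ^ 4)" for E
    by (auto simp: max_def)
  then have "(\<integral>\<^sup>+E. ennreal (Z E ^ 4) \<partial>M)
      = (\<integral>\<^sup>+E. ennreal (max (Z E) 0 ^ 4) \<partial>M) + (\<integral>\<^sup>+E. ennreal (max (- Z E) 0 ^ 4) \<partial>M)"
    by (simp add: nn_integral_add)
  also have "\<dots> \<le> ennreal (24 * c / t ^ 4) + ennreal (24 * c / t ^ 4)"
    using assms by (intro add_mono nn_integral_pow4_from_mgf) auto
  finally show ?thesis using assms by (simp add: ennreal_plus[symmetric] del: ennreal_plus)
qed

lemma inverse_one_minus_le_exp:
  fixes v :: real
  assumes "\<bar>v\<bar> \<le> 1 / 2"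
  shows "1 / (1 - v) \<le> exp (v + 2 * v\<^sup>2)"
proof -
  have "- (v + 2 * v\<^sup>2) \<le> ln (1 - v)"
  proof (cases "0 \<le> v")
    case True
    then show ?thesis using ln_one_minus_pos_lower_bound[of v] assms by simp
  next
    case False
    then have "- v - v\<^sup>2 \<le> ln (1 - v)" using ln_one_plus_pos_lower_bound[of "- v"] assms by simp
    then show ?thesis using zero_le_power2[of v] by linarith
  qed
  then have "exp (- (v + 2 * v\<^sup>2)) \<le> exp (ln (1 - v))" by (simp only: exp_le_cancel_iff)
  also have "\<dots> = 1 - v" using assms by simp
  finally have "inverse (1 - v) \<le> inverse (exp (- (v + 2 * v\<^sup>2)))" by (intro le_imp_inverse_le) auto
  then show ?thesis by (simp only: exp_minus inverse_inverse_eq inverse_eq_divide[symmetric])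
qed

text \<open>The hypothesis is the moment generating function of a sum of \<open>n\<close>
  independent exponentials of mean \<open>x\<close>. Exponential moments at \<open>t\<close> of
  order \<open>1 / (x * sqrt n)\<close> give deviations of order \<open>x * sqrt n\<close>.\<close>

lemma nn_integral_pow4_gamma:
  assumes Z [measurable]: "Z \<in> borel_measurable M" and x: "0 < x"
    and n: "1 \<le> n"
    and mgf: "\<And>t. t * x < 1 \<Longrightarrow> (\<integral>\<^sup>+E. ennreal (exp (t * Z E)) \<partial>M) = ennreal ((1 / (1 - t * x)) ^ n)"
  shows "(\<integral>\<^sup>+E. ennreal ((Z E - n * x) ^ 4) \<partial>M) \<le> ennreal (2 ^ 11 * x ^ 4 * (real n)\<^sup>2)"
proof -
  \<comment> \<open>Chosen so that \<open>n * v\<^sup>2 = 1/4\<close>: after centring, the exponent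
    \<open>n * (2 * v\<^sup>2)\<close> equals \<open>1/2\<close> for every \<open>n\<close>.\<close>
  define v where "v = 1 / (2 * sqrt n)"
  have v2: "v\<^sup>2 = 1 / (4 * n)" using n by (simp add: v_def power_divide power_mult_distrib)
  have "v ^ 4 = (v\<^sup>2)\<^sup>2" by simp
  also have "\<dots> = 1 / (16 * n\<^sup>2)" unfolding v2 by (simp add: power_divide power_mult_distrib)
  finally have v4: "v ^ 4 = 1 / (16 * n\<^sup>2)" .
  have "1 \<le> sqrt n" using n by simp
  then have v: "0 < v" "\<bar>v\<bar> \<le> 1 / 2" "n * v\<^sup>2 = 1 / 4" "v ^ 4 = 1 / (16 * n\<^sup>2)"
    using n v4 unfolding v2 by (auto simp: v_def field_simps)
  define t where "t = v / x"
  have one: "(\<integral>\<^sup>+E. ennreal (exp (w / x * (Z E - n * x))) \<partial>M) \<le> ennreal (exp (1 / 2))"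
    if w: "\<bar>w\<bar> = v" for w
  proof -
    have "(\<integral>\<^sup>+E. ennreal (exp (w / x * (Z E - n * x))) \<partial>M)
        = (\<integral>\<^sup>+E. ennreal (exp (- (n * w))) * ennreal (exp (w / x * Z E)) \<partial>M)"
      using x by (intro nn_integral_cong) (simp add: ennreal_mult'[symmetric] exp_add[symmetric] right_diff_distrib mult.commute)
    also have "\<dots> = ennreal (exp (- (n * w))) * ennreal ((1 / (1 - w)) ^ n)"
      using x v w mgf[of "w / x"] by (subst nn_integral_cmult) auto
    also have "\<dots> = ennreal (exp (- (n * w)) * (1 / (1 - w)) ^ n)"
      using v w by (subst ennreal_mult') auto
    also have "\<dots> \<le> ennreal (exp (- (n * w)) * exp (w + 2 * w\<^sup>2) ^ n)"
      using v w by (intro ennreal_leI mult_left_mono power_mono inverse_one_minus_le_exp) auto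
    also have "exp (- (n * w)) * exp (w + 2 * w\<^sup>2) ^ n = exp (1 / 2)"
    proof -
      have "w\<^sup>2 = v\<^sup>2" using w by (metis power2_abs)
      then show ?thesis using v(3) by (simp add: exp_of_nat_mult[symmetric] exp_add[symmetric] distrib_left)
    qed
    finally show ?thesis .
  qed
  have "(\<integral>\<^sup>+E. ennreal ((Z E - n * x) ^ 4) \<partial>M) \<le> ennreal (48 * exp (1 / 2) / t ^ 4)"
    using one[of v] one[of "- v"] v x by (intro nn_integral_pow4_from_mgf2) (auto simp: t_def)
  also have "\<dots> \<le> ennreal (2 ^ 11 * x ^ 4 * (real n)\<^sup>2)"
  proof (rule ennreal_leI)
    have "exp (1 / 2) \<le> (2::real)" using exp_bound[of "1 / 2 :: real"] by (simp add: power2_eq_square)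
    then have "48 * exp (1 / 2) / t ^ 4 \<le> 48 * 2 / t ^ 4" using v x by (intro divide_right_mono) (auto simp: t_def)
    also have "48 * 2 / t ^ 4 = 1536 * x ^ 4 * (real n)\<^sup>2" using v x n by (simp add: t_def power_divide field_simps)
    also have "\<dots> \<le> 2 ^ 11 * x ^ 4 * (real n)\<^sup>2" using x by (intro mult_right_mono) auto
    finally show "48 * exp (1 / 2) / t ^ 4 \<le> 2 ^ 11 * x ^ 4 * (real n)\<^sup>2" .
  qed
  finally show ?thesis .
qed

section \<open>The diffusive a priori bound\<close>

lemma measurable_diag_sum [measurable]: "(\<lambda>E. \<Sum>j=1..n. E (j, j)) \<in> borel_measurable iid_env"
  by (intro borel_measurable_sum measurable_iid_env_component) (simp add: half_space_def)

lemma nn_integral_exp_diag_sum: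
  assumes t: "t < 1"
  shows "envint (\<lambda>E. ennreal (exp (t * (\<Sum>j=1..n. E (j, j))))) = ennreal ((1 / (1 - t)) ^ n)"
proof (induction n)
  case 0
  then show ?case using prob_space.emeasure_space_1[OF prob_space_iid_env] by simp
next
  case (Suc n)
  have hs: "(j, j) \<in> half_space" for j by (simp add: half_space_def)
  have meas: "(\<lambda>E. ennreal (exp (t * (\<Sum>j=1..k. E (j, j))))) \<in> borel_measurable iid_env" for k
    using measurable_compose[OF measurable_diag_sum, of "\<lambda>z. ennreal (exp (t * z))" borel k] by simp
  have split: "ennreal (exp (t * (\<Sum>j=1..Suc n. (E((Suc n, Suc n) := u)) (j, j))))
      = ennreal (exp (t * u)) * ennreal (exp (t * (\<Sum>j=1..n. E (j, j))))" for E :: "nat \<times> nat \<Rightarrow> real" and u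
  proof -
    have "(\<Sum>j=1..n. (E((Suc n, Suc n) := u)) (j, j)) = (\<Sum>j=1..n. E (j, j))" by (intro sum.cong) auto
    then show ?thesis by (simp add: distrib_left exp_add ennreal_mult'[symmetric] mult.commute)
  qed
  have "envint (\<lambda>E. ennreal (exp (t * (\<Sum>j=1..Suc n. E (j, j)))))
     = envint (\<lambda>E. \<integral>\<^sup>+u. ennreal (exp (t * u)) * ennreal (exp (t * (\<Sum>j=1..n. E (j, j)))) \<partial>exp_law 1)"
    by (subst nn_integral_iid_env_resample[OF meas hs[of "Suc n"]]) (simp only: split)
  also have "\<dots> = envint (\<lambda>E. ennreal (1 / (1 - t)) * ennreal (exp (t * (\<Sum>j=1..n. E (j, j)))))"
    using nn_integral_exp_law_mgf[OF t]
    by (intro nn_integral_cong) (subst nn_integral_multc, auto cong: measurable_cong_sets)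
  also have "\<dots> = ennreal (1 / (1 - t)) * ennreal ((1 / (1 - t)) ^ n)"
    by (subst nn_integral_cmult[OF meas]) (simp only: Suc)
  also have "\<dots> = ennreal ((1 / (1 - t)) ^ Suc n)" using t by (simp add: ennreal_mult'[symmetric])
  finally show ?case .
qed

lemma diag_sum_next_row: "(\<Sum>j=1..n. next_row x y n E (j, j)) = (\<Sum>j=2..Suc n. E (j, j))"
proof -
  have "(\<Sum>j=1..n. next_row x y n E (j, j)) = (\<Sum>j=1..n. E (Suc j, Suc j))"
    by (intro sum.cong) (auto simp: next_row_def row_shift_def half_space_def corner_flips_untouched)
  also have "\<dots> = (\<Sum>j=Suc 1..Suc n. E (j, j))" by (rule sum.shift_bounds_cl_Suc_ivl[symmetric])
  finally show ?thesis by (simp add: numeral_2_eq_2)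
qed

text \<open>Subtracting the diagonal weights removes \<open>y * E (1, 1)\<close> from
  \<open>diag_lpp_next_row\<close>, and the later diagonal weights are untouched by the flips. What
  remains is in law a sum of \<open>n\<close> independent exponentials of mean \<open>x\<close>, one
  per removed row.\<close>

lemma nn_integral_exp_offdiag_part:
  assumes xy: "0 < x" "0 < y" "1 / x + 1 / y = 1" and t: "t * x < 1"
  shows "envint (\<lambda>E. ennreal (exp (t * (diag_lpp x y E n - y * (\<Sum>j=1..n. E (j, j))))))
       = ennreal ((1 / (1 - t * x)) ^ n)"
proof (induction n)
  case 0
  then show ?case using prob_space.emeasure_space_1[OF prob_space_iid_env] by (simp add: diag_lpp_def)
next
  case (Suc n)
  define g where "g u = ennreal (exp (t * x * u))" for u
  define Q where "Q E = ennreal (exp (t * (diag_lpp x y E n - y * (\<Sum>j=1..n. E (j, j)))))" for E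
  have meas: "g \<in> borel_measurable borel" "Q \<in> borel_measurable iid_env"
    unfolding g_def Q_def by measurable
  have "(\<Sum>j=1..Suc n. E (j, j)) = E (1, 1) + (\<Sum>j=2..Suc n. E (j, j))" for E :: "nat \<times> nat \<Rightarrow> real"
    by (subst sum.atLeast_Suc_atMost) (auto simp: numeral_2_eq_2)
  then have "ennreal (exp (t * (diag_lpp x y E (Suc n) - y * (\<Sum>j=1..Suc n. E (j, j)))))
      = g (E (1, 0)) * Q (next_row x y n E)" for E
    using xy by (simp add: diag_lpp_next_row[where n = n] g_def Q_def diag_sum_next_row ennreal_mult'[symmetric]
        exp_add[symmetric] algebra_simps del: sum.cl_ivl_Suc One_nat_def)
  then have "envint (\<lambda>E. ennreal (exp (t * (diag_lpp x y E (Suc n) - y * (\<Sum>j=1..Suc n. E (j, j))))))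
    = (\<integral>\<^sup>+u. g u \<partial>exp_law 1) * envint (\<lambda>E. Q E)"
    by (simp only: nn_integral_first_weight_next_row[OF meas xy])
  also have "(\<integral>\<^sup>+u. g u \<partial>exp_law 1) = ennreal (1 / (1 - t * x))"
    unfolding g_def by (rule nn_integral_exp_law_mgf[OF t])
  also have "envint (\<lambda>E. Q E) = ennreal ((1 / (1 - t * x)) ^ n)" unfolding Q_def by (rule Suc)
  finally show ?case using t by (simp add: ennreal_mult'[symmetric])
qed

text \<open>For \<open>0 < \<rho> < 1\<close> the subtracted term is the exact mean: by stationarity
  each diagonal step adds, in mean, one boundary and one diagonal weight.\<close>

definition centered_lpp :: "real \<Rightarrow> (nat \<times> nat \<Rightarrow> real) \<Rightarrow> nat \<Rightarrow> real" where
  "centered_lpp \<rho> E n = diag_lpp (1 / (1 - \<rho>)) (1 / \<rho>) E n - n * (1 / (1 - \<rho>) + 1 / \<rho>)"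

lemma measurable_centered_lpp [measurable]: "(\<lambda>E. centered_lpp \<rho> E n) \<in> borel_measurable iid_env"
  unfolding centered_lpp_def by measurable

definition fourth_moment :: "real \<Rightarrow> nat \<Rightarrow> ennreal" where
  "fourth_moment \<rho> n = envint (\<lambda>E. ennreal (centered_lpp \<rho> E n ^ 4))"

text \<open>The passage time is a sum of two variables with gamma moment generating functions, which
  gives size \<open>sqrt n\<close>. This crude bound starts the bootstrap and settles parameters
  well below \<open>1/2\<close>.\<close>

lemma fourth_moment_trivial:
  assumes \<rho>: "1 / 4 \<le> \<rho>" "\<rho> \<le> 3 / 4"
  shows "fourth_moment \<rho> n \<le> ennreal (2 ^ 23 * (real n)\<^sup>2)"
proof (cases "1 \<le> n")
  case True
  define x where "x = 1 / (1 - \<rho>)"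
  define y where "y = 1 / \<rho>"
  have xy: "0 < x" "0 < y" "1 / x + 1 / y = 1" "x \<le> 4" "y \<le> 4"
    using \<rho> by (auto simp: x_def y_def field_simps)
  define U where "U E = diag_lpp x y E n - y * (\<Sum>j=1..n. E (j, j))" for E
  define S where "S E = (\<Sum>j=1..n. E (j, j))" for E :: "nat \<times> nat \<Rightarrow> real"
  have [measurable]: "U \<in> borel_measurable iid_env" "S \<in> borel_measurable iid_env"
    unfolding U_def S_def by measurable
  have mgfs: "envint (\<lambda>E. ennreal (exp (t * U E))) = ennreal ((1 / (1 - t * x)) ^ n)" if "t * x < 1" for t
    unfolding U_def by (rule nn_integral_exp_offdiag_part[OF xy(1-3) that])
  have mgfs': "envint (\<lambda>E. ennreal (exp (t * S E))) = ennreal ((1 / (1 - t * 1)) ^ n)" if "t * 1 < 1" for t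
    unfolding S_def using nn_integral_exp_diag_sum[of t n] that by simp
  have U: "envint (\<lambda>E. ennreal ((U E - n * x) ^ 4)) \<le> ennreal (2 ^ 11 * x ^ 4 * (real n)\<^sup>2)"
    by (rule nn_integral_pow4_gamma[OF _ xy(1) True mgfs]) measurable
  have S: "envint (\<lambda>E. ennreal ((S E - real n * 1) ^ 4)) \<le> ennreal (2 ^ 11 * 1 ^ 4 * (real n)\<^sup>2)"
    by (rule nn_integral_pow4_gamma[OF _ _ True mgfs']) auto
  have "centered_lpp \<rho> E n ^ 4 \<le> 8 * (U E - n * x) ^ 4 + 8 * y ^ 4 * (S E - real n * 1) ^ 4" for E
  proof -
    have "centered_lpp \<rho> E n = (U E - n * x) + y * (S E - real n * 1)"
      by (simp add: centered_lpp_def U_def S_def x_def y_def algebra_simps)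
    then show ?thesis using pow4_sum_le2[of "U E - n * x" "y * (S E - real n * 1)"] by (simp add: power_mult_distrib)
  qed
  then have "fourth_moment \<rho> n \<le> ennreal (8 * (2 ^ 11 * x ^ 4 * (real n)\<^sup>2) + 8 * y ^ 4 * (2 ^ 11 * 1 ^ 4 * (real n)\<^sup>2))"
    unfolding fourth_moment_def using U S by (intro nn_integral_lincomb_le) auto
  also have "8 * (2 ^ 11 * x ^ 4 * (real n)\<^sup>2) + 8 * y ^ 4 * (2 ^ 11 * 1 ^ 4 * (real n)\<^sup>2)
      = 2 ^ 14 * (x ^ 4 + y ^ 4) * (real n)\<^sup>2" by (simp add: algebra_simps)
  also have "ennreal \<dots> \<le> ennreal (2 ^ 23 * (real n)\<^sup>2)"
  proof (rule ennreal_leI, rule mult_right_mono)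
    have "x ^ 4 \<le> 4 ^ 4" "y ^ 4 \<le> 4 ^ 4" using xy power_mono[of x 4 4] power_mono[of y 4 4] by simp_all
    then show "2 ^ 14 * (x ^ 4 + y ^ 4) \<le> (2 ^ 23 :: real)" by simp
  qed simp
  finally show ?thesis .
next
  case False
  then have "n = 0" by simp
  then show ?thesis by (simp add: fourth_moment_def centered_lpp_def diag_lpp_def)
qed

text \<open>The maximum over length \<open>2 ^ Suc k\<close> is attained in the left half, or in the
  right half after the increment to the midpoint. Its fourth moment thus costs at most
  \<open>m + 1331/1000 * m + 1331 * D * q ^ k\<close>, where \<open>m\<close> bounds one half. The
  constant 8000 closes the recursion because
  \<open>1 + 1331/1000 + 1331/8000 \<le> 5/2 \<le> q\<close>.\<close>

lemma chaining_dyadic: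
  fixes Y :: "nat \<Rightarrow> 'a \<Rightarrow> real"
  assumes Y [measurable]: "\<And>i. Y i \<in> borel_measurable M"
    and q: "5 / 2 \<le> q" and D: "0 \<le> D"
    and inc: "\<And>a k. (\<integral>\<^sup>+\<omega>. ennreal ((Y (a + 2 ^ k) \<omega> - Y a \<omega>) ^ 4) \<partial>M) \<le> ennreal (D * q ^ k)"
  shows "(\<integral>\<^sup>+\<omega>. ennreal (Max ((\<lambda>i. \<bar>Y (a + i) \<omega> - Y a \<omega>\<bar>) ` {..2 ^ k}) ^ 4) \<partial>M) \<le> ennreal (8000 * D * q ^ k)"
proof (induction k arbitrary: a)
  case 0
  have "{..2 ^ 0} = {0, 1::nat}" by auto
  then have "Max ((\<lambda>i. \<bar>Y (a + i) \<omega> - Y a \<omega>\<bar>) ` {..2 ^ 0}) = \<bar>Y (a + 2 ^ 0) \<omega> - Y a \<omega>\<bar>" for \<omega>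
    by (auto simp: max_def)
  then have "(\<integral>\<^sup>+\<omega>. ennreal (Max ((\<lambda>i. \<bar>Y (a + i) \<omega> - Y a \<omega>\<bar>) ` {..2 ^ 0}) ^ 4) \<partial>M) \<le> ennreal (D * q ^ 0)"
    using inc[of a 0] by simp
  also have "\<dots> \<le> ennreal (8000 * D * q ^ 0)" using D by (intro ennreal_leI) auto
  finally show ?case .
next
  case (Suc k)
  define m where "m a \<omega> = Max ((\<lambda>i. \<bar>Y (a + i) \<omega> - Y a \<omega>\<bar>) ` {..2 ^ k})" for a \<omega>
  have [measurable]: "m a \<in> borel_measurable M" for a unfolding m_def by measurable
  have m_ge: "\<bar>Y (a + i) \<omega> - Y a \<omega>\<bar> \<le> m a \<omega>" if "i \<le> 2 ^ k" for a i \<omega>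
    unfolding m_def using that by (intro Max_ge) auto
  have m0: "0 \<le> m a \<omega>" for a \<omega> using m_ge[of 0 a \<omega>] by simp
  define b where "b = a + 2 ^ k"
  have max: "Max ((\<lambda>i. \<bar>Y (a + i) \<omega> - Y a \<omega>\<bar>) ` {..2 ^ Suc k}) \<le> max (m a \<omega>) (\<bar>Y b \<omega> - Y a \<omega>\<bar> + m b \<omega>)" for \<omega>
  proof (rule Max.boundedI)
    fix z assume "z \<in> (\<lambda>i. \<bar>Y (a + i) \<omega> - Y a \<omega>\<bar>) ` {..2 ^ Suc k}"
    then obtain i where i: "i \<le> 2 * 2 ^ k" "z = \<bar>Y (a + i) \<omega> - Y a \<omega>\<bar>" by auto
    show "z \<le> max (m a \<omega>) (\<bar>Y b \<omega> - Y a \<omega>\<bar> + m b \<omega>)"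
    proof (cases "i \<le> 2 ^ k")
      case True then show ?thesis using m_ge[OF True, of a \<omega>] i by simp
    next
      case False
      then have "a + i = b + (i - 2 ^ k)" "i - 2 ^ k \<le> 2 ^ k" using i by (auto simp: b_def)
      moreover from this have "\<bar>Y (a + i) \<omega> - Y b \<omega>\<bar> \<le> m b \<omega>"
        using m_ge[of "i - 2 ^ k" b \<omega>] by simp
      ultimately show ?thesis unfolding i(2) by linarith
    qed
  qed auto
  have "Max ((\<lambda>i. \<bar>Y (a + i) \<omega> - Y a \<omega>\<bar>) ` {..2 ^ Suc k}) ^ 4
      \<le> m a \<omega> ^ 4 + (1331 * (Y b \<omega> - Y a \<omega>) ^ 4 + 1331 / 1000 * m b \<omega> ^ 4)" for \<omega>
  proof -
    have "0 \<le> Max ((\<lambda>i. \<bar>Y (a + i) \<omega> - Y a \<omega>\<bar>) ` {..2 ^ Suc k})"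
    proof (rule order_trans)
      show "\<bar>Y (a + 0) \<omega> - Y a \<omega>\<bar> \<le> Max ((\<lambda>i. \<bar>Y (a + i) \<omega> - Y a \<omega>\<bar>) ` {..2 ^ Suc k})"
        by (intro Max_ge imageI) auto
    qed simp
    then have "Max ((\<lambda>i. \<bar>Y (a + i) \<omega> - Y a \<omega>\<bar>) ` {..2 ^ Suc k}) ^ 4 \<le> max (m a \<omega>) (\<bar>Y b \<omega> - Y a \<omega>\<bar> + m b \<omega>) ^ 4"
      by (intro power_mono max)
    also have "\<dots> \<le> m a \<omega> ^ 4 + (\<bar>Y b \<omega> - Y a \<omega>\<bar> + m b \<omega>) ^ 4"
      using m0[of a \<omega>] m0[of b \<omega>] by (auto simp: max_def)
    also have "(\<bar>Y b \<omega> - Y a \<omega>\<bar> + m b \<omega>) ^ 4 \<le> 1331 * \<bar>Y b \<omega> - Y a \<omega>\<bar> ^ 4 + 1331 / 1000 * m b \<omega> ^ 4"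
      by (rule pow4_sum_weighted) (auto simp: m0)
    finally show ?thesis by simp
  qed
  moreover have "(\<integral>\<^sup>+\<omega>. ennreal (1331 * (Y b \<omega> - Y a \<omega>) ^ 4 + 1331 / 1000 * m b \<omega> ^ 4) \<partial>M)
      \<le> ennreal (1331 * (D * q ^ k) + 1331 / 1000 * (8000 * D * q ^ k))"
    using inc[of a k] Suc[of b] q D by (intro nn_integral_lincomb_le) (auto simp: b_def m_def)
  ultimately have "(\<integral>\<^sup>+\<omega>. ennreal (Max ((\<lambda>i. \<bar>Y (a + i) \<omega> - Y a \<omega>\<bar>) ` {..2 ^ Suc k}) ^ 4) \<partial>M)
     \<le> ennreal (1 * (8000 * D * q ^ k) + 1 * (1331 * (D * q ^ k) + 1331 / 1000 * (8000 * D * q ^ k)))"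
    using Suc[of a] q D m0
    by (intro nn_integral_lincomb_le[where a = 1 and b = 1 and c = "8000 * D * q ^ k" and g = "\<lambda>\<omega>. m a \<omega> ^ 4"
          and d = "1331 * (D * q ^ k) + 1331 / 1000 * (8000 * D * q ^ k)" and h = "\<lambda>\<omega>. 1331 * (Y b \<omega> - Y a \<omega>) ^ 4 + 1331 / 1000 * m b \<omega> ^ 4"]) (auto simp flip: m_def)
  also have "\<dots> = ennreal (8000 * D * q ^ k * (1 + 1331 / 8000 + 1331 / 1000))"
    by (simp add: algebra_simps)
  also have "\<dots> \<le> ennreal (8000 * D * q ^ k * q)"
    using q D by (intro ennreal_leI mult_left_mono) auto
  finally show ?case by (simp add: mult_ac)
qed

text \<open>The first summand is the critical fluctuation size, the second the Gaussian one whose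
  variance is proportional to the distance from \<open>\<rho> = 1/2\<close>.\<close>

definition fluct_scale :: "real \<Rightarrow> nat \<Rightarrow> real" where
  "fluct_scale \<rho> n = real n powr (1 / 3) + sqrt (real n * \<bar>\<rho> - 1 / 2\<bar>)"

lemma fluct_scale_nonneg: "0 \<le> fluct_scale \<rho> n"
  by (simp add: fluct_scale_def)

lemma fluct_scale_ge: "real n powr (1 / 3) \<le> fluct_scale \<rho> n" "sqrt (real n * \<bar>\<rho> - 1 / 2\<bar>) \<le> fluct_scale \<rho> n"
  by (simp_all add: fluct_scale_def)

lemma fluct_scale_bounds:
  shows "real n \<le> fluct_scale \<rho> n ^ 3" "real n * \<bar>\<rho> - 1 / 2\<bar> \<le> (fluct_scale \<rho> n)\<^sup>2"
    and "1 \<le> n \<Longrightarrow> 1 \<le> fluct_scale \<rho> n"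
proof -
  have "real n = (real n powr (1 / 3)) ^ 3"
    by (cases "n = 0") (simp_all add: powr_realpow[symmetric] powr_powr)
  also have "\<dots> \<le> fluct_scale \<rho> n ^ 3" by (rule power_mono[OF fluct_scale_ge(1)]) simp
  finally show "real n \<le> fluct_scale \<rho> n ^ 3" .
  have "real n * \<bar>\<rho> - 1 / 2\<bar> = (sqrt (real n * \<bar>\<rho> - 1 / 2\<bar>))\<^sup>2" by simp
  also have "\<dots> \<le> (fluct_scale \<rho> n)\<^sup>2" by (rule power_mono[OF fluct_scale_ge(2)]) simp
  finally show "real n * \<bar>\<rho> - 1 / 2\<bar> \<le> (fluct_scale \<rho> n)\<^sup>2" .
  assume "1 \<le> n"
  then have "1 \<le> real n powr (1 / 3)" by (simp add: ge_one_powr_ge_zero)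
  then show "1 \<le> fluct_scale \<rho> n" using fluct_scale_ge(1)[of n \<rho>] by linarith
qed

text \<open>With \<open>r = d / n \<le> 1\<close>, both summands shrink at least like
  \<open>r powr (1/3)\<close>, as \<open>sqrt r \<le> r powr (1/3)\<close>. The fourth power has
  exponent \<open>4/3 > 1\<close>, as chaining needs.\<close>

lemma fluct_scale_mono_ratio:
  assumes "d \<le> n" "1 \<le> n"
  shows "fluct_scale \<rho> d ^ 4 \<le> (real d / real n) powr (4 / 3) * fluct_scale \<rho> n ^ 4"
proof -
  define r where "r = real d / real n"
  have r: "0 \<le> r" "r \<le> 1" "real d = r * real n" using assms by (auto simp: r_def)
  have sqrt_le: "sqrt r \<le> r powr (1 / 3)"
  proof (cases "r = 0")
    case False
    then have "sqrt r = r powr (1 / 2)" using r by (simp add: powr_half_sqrt)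
    also have "\<dots> \<le> r powr (1 / 3)" using r False by (intro powr_mono') auto
    finally show ?thesis .
  qed simp
  have "fluct_scale \<rho> d = r powr (1 / 3) * real n powr (1 / 3) + sqrt r * sqrt (real n * \<bar>\<rho> - 1 / 2\<bar>)"
    unfolding fluct_scale_def r(3) using r by (simp add: powr_mult real_sqrt_mult mult.assoc)
  also have "\<dots> \<le> r powr (1 / 3) * fluct_scale \<rho> n"
    unfolding fluct_scale_def distrib_left using sqrt_le by (intro add_mono mult_right_mono) auto
  finally have "fluct_scale \<rho> d ^ 4 \<le> (r powr (1 / 3) * fluct_scale \<rho> n) ^ 4"
    by (rule power_mono) (rule fluct_scale_nonneg)
  also have "(r powr (1 / 3)) ^ 4 = r powr (4 / 3)"
    using r by (cases "r = 0") (simp_all add: powr_realpow[symmetric] powr_powr)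
  then have "(r powr (1 / 3) * fluct_scale \<rho> n) ^ 4 = r powr (4 / 3) * fluct_scale \<rho> n ^ 4"
    by (simp add: power_mult_distrib)
  finally show ?thesis by (simp add: r_def)
qed

lemma centered_lpp_stationary:
  assumes "0 < \<rho>" "\<rho> < 1" "a \<le> b"
  shows "envint (\<lambda>E. ennreal ((centered_lpp \<rho> E b - centered_lpp \<rho> E a) ^ 4)) = fourth_moment \<rho> (b - a)"
proof -
  let ?\<mu> = "1 / (1 - \<rho>) + 1 / \<rho>"
  have "envint (\<lambda>E. ennreal ((centered_lpp \<rho> E b - centered_lpp \<rho> E a) ^ 4))
     = envint (\<lambda>E. ennreal ((diag_lpp (1 / (1 - \<rho>)) (1 / \<rho>) E (a + (b - a)) - diag_lpp (1 / (1 - \<rho>)) (1 / \<rho>) E a - real (b - a) * ?\<mu>) ^ 4))"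
  proof -
    have "centered_lpp \<rho> E b - centered_lpp \<rho> E a = diag_lpp (1 / (1 - \<rho>)) (1 / \<rho>) E (a + (b - a))
        - diag_lpp (1 / (1 - \<rho>)) (1 / \<rho>) E a - real (b - a) * ?\<mu>" for E
      using assms(3) by (simp add: centered_lpp_def of_nat_diff left_diff_distrib)
    then show ?thesis by simp
  qed
  also have "\<dots> = fourth_moment \<rho> (b - a)"
    unfolding fourth_moment_def centered_lpp_def
    by (rule diag_lpp_stationary_increments[where f = "\<lambda>z. ennreal ((z - real (b - a) * ?\<mu>) ^ 4)"])
       (use assms in auto)
  finally show ?thesis .
qed

text \<open>By stationarity every increment has the fourth moment of a passage time of the same
  length, so the bound assumed for passage times controls all increments in the chaining.\<close>

lemma maximal_inequality:
  assumes \<rho>: "0 < \<rho>" "\<rho> < 1" and N: "1 \<le> N" and K: "0 \<le> K"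
    and fm: "\<And>n. n \<le> N \<Longrightarrow> fourth_moment \<rho> n \<le> ennreal (K * fluct_scale \<rho> n ^ 4)"
  shows "envint (\<lambda>E. ennreal (Max ((\<lambda>i. \<bar>centered_lpp \<rho> E i\<bar>) ` {..N}) ^ 4))
    \<le> ennreal (32000 * K * fluct_scale \<rho> N ^ 4)"
proof -
  define S where "S = fluct_scale \<rho> N ^ 4"
  have S: "0 \<le> S" by (simp add: S_def)
  define q where "q = 2 powr (4 / 3 :: real)"
  define D where "D = K * S / real N powr (4 / 3)"
  \<comment> \<open>Freezing the process at time \<open>N\<close> extends it to a dyadic length
    while all increments keep a length of at most \<open>N\<close>.\<close>
  define Y where "Y i E = centered_lpp \<rho> E (min i N)" for i E
  \<comment> \<open>The value \<open>2 powr (4/3)\<close> is about 2.52, just above the threshold of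
    the chaining lemma.\<close>
  have q: "5 / 2 \<le> q"
  proof (rule ccontr)
    assume "\<not> 5 / 2 \<le> q"
    then have "q ^ 3 < (5 / 2) ^ 3" by (intro power_strict_mono) (auto simp: q_def)
    moreover have "q ^ 3 = 2 powr 4" by (simp add: q_def powr_realpow[symmetric] powr_powr)
    ultimately show False by (simp add: power_divide)
  qed
  have D: "0 \<le> D" using K S by (simp add: D_def)
  obtain k where k: "N \<le> 2 ^ k" "2 ^ k \<le> 2 * N"
  proof -
    define k where "k = (LEAST k. N \<le> 2 ^ k)"
    have le: "N \<le> 2 ^ k" unfolding k_def by (rule LeastI[of _ N]) (simp add: less_imp_le)
    have "2 ^ k \<le> 2 * N"
    proof (cases k)
      case (Suc j)
      then have "\<not> N \<le> 2 ^ j" using not_less_Least[of j "\<lambda>k. N \<le> 2 ^ k"] by (simp add: k_def)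
      then show ?thesis using Suc by simp
    qed (use N in simp)
    with le show ?thesis by (rule that)
  qed
  have [measurable]: "Y i \<in> borel_measurable iid_env" for i unfolding Y_def by measurable
  have qk: "(2 ^ k) powr (4 / 3) = q ^ k" for k :: nat
    by (simp add: q_def powr_realpow[symmetric] powr_powr mult.commute)
  have "envint (\<lambda>E. ennreal (Max ((\<lambda>i. \<bar>Y (0 + i) E - Y 0 E\<bar>) ` {..2 ^ k}) ^ 4)) \<le> ennreal (8000 * D * q ^ k)"
  proof (rule chaining_dyadic[OF _ q D])
    fix a k
    define d where "d = min (a + 2 ^ k) N - min a N"
    have d: "d \<le> N" "d \<le> 2 ^ k" by (auto simp: d_def)
    have "envint (\<lambda>E. ennreal ((Y (a + 2 ^ k) E - Y a E) ^ 4)) = fourth_moment \<rho> d"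
      unfolding Y_def d_def by (rule centered_lpp_stationary[OF \<rho>]) auto
    also have "\<dots> \<le> ennreal (K * fluct_scale \<rho> d ^ 4)" by (rule fm) (rule d)
    also have "\<dots> \<le> ennreal (D * q ^ k)"
    proof (rule ennreal_leI)
      have "fluct_scale \<rho> d ^ 4 \<le> (real d / real N) powr (4 / 3) * S"
        unfolding S_def by (rule fluct_scale_mono_ratio[OF d(1) N])
      also have "\<dots> \<le> (2 ^ k / real N) powr (4 / 3) * S"
      proof (intro mult_right_mono powr_mono2 divide_right_mono)
        show "real d \<le> 2 ^ k" using d(2) by (metis of_nat_le_iff of_nat_numeral of_nat_power)
      qed (use S in auto)
      also have "\<dots> = q ^ k * S / real N powr (4 / 3)" by (simp add: powr_divide qk)
      finally have "K * fluct_scale \<rho> d ^ 4 \<le> K * (q ^ k * S / real N powr (4 / 3))"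
        using K by (rule mult_left_mono)
      then show "K * fluct_scale \<rho> d ^ 4 \<le> D * q ^ k" by (simp add: D_def mult_ac)
    qed
    finally show "envint (\<lambda>E. ennreal ((Y (a + 2 ^ k) E - Y a E) ^ 4)) \<le> ennreal (D * q ^ k)" .
  qed measurable
  moreover have "Max ((\<lambda>i. \<bar>centered_lpp \<rho> E i\<bar>) ` {..N}) \<le> Max ((\<lambda>i. \<bar>Y (0 + i) E - Y 0 E\<bar>) ` {..2 ^ k})" for E
  proof (rule Max_mono)
    have "Y 0 E = 0" by (simp add: Y_def centered_lpp_def diag_lpp_def)
    then have "\<bar>centered_lpp \<rho> E i\<bar> = \<bar>Y (0 + i) E - Y 0 E\<bar> \<and> i \<in> {..2 ^ k}" if "i \<le> N" for i
      using k(1) that by (simp add: Y_def)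
    then show "(\<lambda>i. \<bar>centered_lpp \<rho> E i\<bar>) ` {..N} \<subseteq> (\<lambda>i. \<bar>Y (0 + i) E - Y 0 E\<bar>) ` {..2 ^ k}"
      by blast
  qed auto
  then have "envint (\<lambda>E. ennreal (Max ((\<lambda>i. \<bar>centered_lpp \<rho> E i\<bar>) ` {..N}) ^ 4))
     \<le> envint (\<lambda>E. ennreal (Max ((\<lambda>i. \<bar>Y (0 + i) E - Y 0 E\<bar>) ` {..2 ^ k}) ^ 4))"
    by (intro nn_integral_mono ennreal_leI power_mono) (auto simp: Max_ge_iff)
  \<comment> \<open>Rounding \<open>N\<close> up to \<open>2 ^ k \<le> 2 * N\<close> costs
    \<open>2 powr (4/3) \<le> 4\<close>, which turns 8000 into 32000.\<close>
  moreover have "8000 * D * q ^ k \<le> 32000 * K * S"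
  proof -
    have "q ^ k \<le> (2 * real N) powr (4 / 3)"
      unfolding qk[symmetric] using of_nat_mono[OF k(2), where 'a = real] by (intro powr_mono2) auto
    also have "\<dots> \<le> 4 * real N powr (4 / 3)"
    proof -
      have "2 powr (4 / 3) \<le> (2::real) powr 2" by (intro powr_mono) auto
      then show ?thesis by (simp add: powr_mult mult_right_mono)
    qed
    finally have "8000 * D * q ^ k \<le> 8000 * D * (4 * real N powr (4 / 3))" using D by (intro mult_left_mono) auto
    also have "\<dots> = 32000 * K * S" using N by (simp add: D_def)
    finally show ?thesis .
  qed
  ultimately show ?thesis
    unfolding S_def by (meson ennreal_leI order_trans)
qed

section \<open>Sub- and supercritical perturbations\<close>

lemma ln_one_plus_le_cubic: "0 \<le> u \<Longrightarrow> ln (1 + u) \<le> u - u\<^sup>2 / 2 + u ^ 3 / 3" for u :: real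
proof -
  assume u: "0 \<le> u"
  have "(\<lambda>u. u - u\<^sup>2 / 2 + u ^ 3 / 3 - ln (1 + u)) 0 \<le> (\<lambda>u. u - u\<^sup>2 / 2 + u ^ 3 / 3 - ln (1 + u)) u"
  proof (rule DERIV_nonneg_imp_nondecreasing[OF u])
    fix t :: real assume t: "0 \<le> t" "t \<le> u"
    have "((\<lambda>u. u - u\<^sup>2 / 2 + u ^ 3 / 3 - ln (1 + u)) has_real_derivative 1 - t + t\<^sup>2 - 1 / (1 + t)) (at t)"
      using t by (auto intro!: derivative_eq_intros simp: field_simps)
    moreover have "1 - t + t\<^sup>2 - 1 / (1 + t) = t ^ 3 / (1 + t)"
      using t by (simp add: field_simps power2_eq_square power3_eq_cube)
    ultimately show "\<exists>y. ((\<lambda>u. u - u\<^sup>2 / 2 + u ^ 3 / 3 - ln (1 + u)) has_real_derivative y) (at t) \<and> 0 \<le> y"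
      using t by (auto intro!: exI[of _ "t ^ 3 / (1 + t)"])
  qed
  then show ?thesis by simp
qed

lemma neg_ln_one_minus_le_cubic: "0 \<le> v \<Longrightarrow> v \<le> 1 / 2 \<Longrightarrow> - ln (1 - v) \<le> v + v\<^sup>2 / 2 + v ^ 3" for v :: real
proof -
  assume v: "0 \<le> v" "v \<le> 1 / 2"
  have "(\<lambda>v. v + v\<^sup>2 / 2 + v ^ 3 + ln (1 - v)) 0 \<le> (\<lambda>v. v + v\<^sup>2 / 2 + v ^ 3 + ln (1 - v)) v"
  proof (rule DERIV_nonneg_imp_nondecreasing[OF v(1)])
    fix t :: real assume t: "0 \<le> t" "t \<le> v"
    have "((\<lambda>v. v + v\<^sup>2 / 2 + v ^ 3 + ln (1 - v)) has_real_derivative 1 + t + 3 * t\<^sup>2 - 1 / (1 - t)) (at t)"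
      using t v by (auto intro!: derivative_eq_intros simp: field_simps)
    moreover have "1 + t + 3 * t\<^sup>2 - 1 / (1 - t) = t\<^sup>2 * (2 - 3 * t) / (1 - t)"
      using t v by (simp add: field_simps power2_eq_square power3_eq_cube)
    ultimately show "\<exists>y. ((\<lambda>v. v + v\<^sup>2 / 2 + v ^ 3 + ln (1 - v)) has_real_derivative y) (at t) \<and> 0 \<le> y"
      using t v by (auto intro!: exI[of _ "t\<^sup>2 * (2 - 3 * t) / (1 - t)"])
  qed
  then show ?thesis by simp
qed

lemma ln_one_minus_le_quadratic: "0 \<le> u \<Longrightarrow> u < 1 \<Longrightarrow> ln (1 - u) \<le> - u - u\<^sup>2 / 2" for u :: real
proof -
  assume u: "0 \<le> u" "u < 1"
  have "(\<lambda>u. - u - u\<^sup>2 / 2 - ln (1 - u)) 0 \<le> (\<lambda>u. - u - u\<^sup>2 / 2 - ln (1 - u)) u"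
  proof (rule DERIV_nonneg_imp_nondecreasing[OF u(1)])
    fix t :: real assume t: "0 \<le> t" "t \<le> u"
    have "((\<lambda>u. - u - u\<^sup>2 / 2 - ln (1 - u)) has_real_derivative - 1 - t + 1 / (1 - t)) (at t)"
      using t u by (auto intro!: derivative_eq_intros simp: field_simps)
    moreover have "- 1 - t + 1 / (1 - t) = t\<^sup>2 / (1 - t)"
      using t u by (simp add: field_simps power2_eq_square)
    ultimately show "\<exists>y. ((\<lambda>u. - u - u\<^sup>2 / 2 - ln (1 - u)) has_real_derivative y) (at t) \<and> 0 \<le> y"
      using t u by (auto intro!: exI[of _ "t\<^sup>2 / (1 - t)"])
  qed
  then show ?thesis by simp
qed

lemma neg_ln_one_plus_le_quadratic: "0 \<le> v \<Longrightarrow> - ln (1 + v) \<le> - v + v\<^sup>2 / 2" for v :: real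
proof -
  assume v: "0 \<le> v"
  have "(\<lambda>v. ln (1 + v) - v + v\<^sup>2 / 2) 0 \<le> (\<lambda>v. ln (1 + v) - v + v\<^sup>2 / 2) v"
  proof (rule DERIV_nonneg_imp_nondecreasing[OF v])
    fix t :: real assume t: "0 \<le> t" "t \<le> v"
    have "((\<lambda>v. ln (1 + v) - v + v\<^sup>2 / 2) has_real_derivative 1 / (1 + t) - 1 + t) (at t)"
      using t by (auto intro!: derivative_eq_intros simp: field_simps)
    moreover have "1 / (1 + t) - 1 + t = t\<^sup>2 / (1 + t)"
      using t by (simp add: field_simps power2_eq_square)
    ultimately show "\<exists>y. ((\<lambda>v. ln (1 + v) - v + v\<^sup>2 / 2) has_real_derivative y) (at t) \<and> 0 \<le> y"
      using t by (auto intro!: exI[of _ "t\<^sup>2 / (1 + t)"])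
  qed
  then show ?thesis by simp
qed

lemma parameter_product_lower:
  fixes \<rho> :: real
  assumes "1 / 4 \<le> \<rho>" "\<rho> \<le> 3 / 4"
  shows "3 / 16 \<le> \<rho> * (1 - \<rho>)"
proof -
  have "0 \<le> (\<rho> - 1 / 4) * (3 / 4 - \<rho>)" using assms by (intro mult_nonneg_nonneg) auto
  also have "\<dots> = \<rho> * (1 - \<rho>) - 3 / 16" by (simp add: field_simps)
  finally show ?thesis by simp
qed

text \<open>This is twice the coefficient of \<open>s\<^sup>2\<close> in the centred logarithmic
  moments below. It vanishes at \<open>\<rho> = 1/2\<close>, and this cancellation is the source of
  the cube-root scale. The constant 58 rounds up \<open>2 / (3/16)\<^sup>2\<close>.\<close>

lemma inverse_square_gap:
  fixes \<rho> :: real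
  assumes "1 / 4 \<le> \<rho>" "\<rho> \<le> 3 / 4"
  shows "1 / (1 - \<rho>)\<^sup>2 - 1 / \<rho>\<^sup>2 \<le> 58 * \<bar>\<rho> - 1 / 2\<bar>"
proof -
  note p = parameter_product_lower[OF assms]
  have "1 / (1 - \<rho>)\<^sup>2 - 1 / \<rho>\<^sup>2 = 2 * (\<rho> - 1 / 2) / (\<rho> * (1 - \<rho>))\<^sup>2"
  proof -
    have num: "2 * (\<rho> - 1 / 2) = \<rho>\<^sup>2 - (1 - \<rho>)\<^sup>2" by (simp add: power2_eq_square algebra_simps)
    show ?thesis unfolding num using assms by (subst diff_frac_eq) (auto simp: power_mult_distrib mult.commute)
  qed
  also have "\<dots> \<le> 2 * \<bar>\<rho> - 1 / 2\<bar> / (\<rho> * (1 - \<rho>))\<^sup>2"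
    by (intro divide_right_mono mult_left_mono abs_ge_self) auto
  also have "\<dots> \<le> 2 * \<bar>\<rho> - 1 / 2\<bar> / (3 / 16)\<^sup>2"
    using p by (intro divide_left_mono power_mono mult_pos_pos) auto
  also have "\<dots> \<le> 58 * \<bar>\<rho> - 1 / 2\<bar>" by (simp add: power2_eq_square field_simps)
  finally show ?thesis .
qed

lemma nn_integral_exp_centered:
  assumes xy: "0 < x" "0 < y" "1 / x + 1 / y = 1"
    and s: "0 < y'" "s = 1 / y' - 1 / y" "s * x < 1"
    and ex: "ln (y / y') - ln (1 - s * x) - s * \<mu> \<le> c"
  shows "envint (\<lambda>E. ennreal (exp (s * (diag_lpp x y' E n - n * \<mu>)))) \<le> ennreal (exp (n * c))"
proof -
  have "envint (\<lambda>E. ennreal (exp (s * (diag_lpp x y' E n - n * \<mu>))))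
     = envint (\<lambda>E. ennreal (exp (- (n * (s * \<mu>)))) * ennreal (exp (s * diag_lpp x y' E n)))"
    by (intro nn_integral_cong) (simp add: ennreal_mult'[symmetric] exp_add[symmetric] algebra_simps)
  also have "\<dots> = ennreal (exp (- (n * (s * \<mu>)))) * ennreal (((y / y') / (1 - s * x)) ^ n)"
    by (subst nn_integral_cmult) (auto simp: diag_lpp_mgf[OF xy s])
  also have "\<dots> = ennreal (exp (- (n * (s * \<mu>))) * ((y / y') / (1 - s * x)) ^ n)"
    using xy s by (simp add: ennreal_mult'[symmetric])
  also have "((y / y') / (1 - s * x)) = exp (ln (y / y') - ln (1 - s * x))"
    using xy s by (simp add: exp_diff)
  also have "exp (- (n * (s * \<mu>))) * exp (ln (y / y') - ln (1 - s * x)) ^ n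
     = exp (n * (ln (y / y') - ln (1 - s * x) - s * \<mu>))"
    by (simp add: exp_of_nat_mult[symmetric] exp_add[symmetric] algebra_simps)
  also have "ennreal \<dots> \<le> ennreal (exp (n * c))"
    using ex by (intro ennreal_leI) (simp add: mult_left_mono)
  finally show ?thesis .
qed

text \<open>The diagonal rate \<open>\<rho> + s\<close> makes the tilt in
  \<open>diag_lpp_mgf\<close> equal to \<open>s\<close>, and the linear terms cancel against the
  stationary mean. For \<open>s = 1 / fluct_scale \<rho> n\<close> the exponent is bounded, which
  controls the upper tail on the right scale.\<close>

lemma subcritical_exp_moment:
  assumes \<rho>: "1 / 4 \<le> \<rho>" "\<rho> \<le> 3 / 4" and s: "0 < s" "s \<le> 1 / 8"
  shows "envint (\<lambda>E. ennreal (exp (s * (diag_lpp (1 / (1 - \<rho>)) (1 / (\<rho> + s)) E n - n * (1 / (1 - \<rho>) + 1 / \<rho>)))))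
      \<le> ennreal (exp (n * (29 * s\<^sup>2 * \<bar>\<rho> - 1 / 2\<bar> + 86 * s ^ 3)))"
proof (rule nn_integral_exp_centered[where y = "1 / \<rho>"])
  define u where "u = s / \<rho>"
  define v where "v = s / (1 - \<rho>)"
  have uv: "0 \<le> u" "0 \<le> v" "v \<le> 1 / 2" "u \<le> 4 * s" "v \<le> 4 * s" using \<rho> s by (auto simp: u_def v_def field_simps)
  have "v < 1" using uv(3) by simp
  then show "s * (1 / (1 - \<rho>)) < 1" by (simp add: v_def)
  have "ln ((1 / \<rho>) / (1 / (\<rho> + s))) - ln (1 - s * (1 / (1 - \<rho>))) - s * (1 / (1 - \<rho>) + 1 / \<rho>)
      = ln (1 + u) - ln (1 - v) - u - v"
    using \<rho> s by (simp add: u_def v_def field_simps)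
  also have "\<dots> \<le> (v\<^sup>2 - u\<^sup>2) / 2 + (u ^ 3 / 3 + v ^ 3)"
    using ln_one_plus_le_cubic[OF uv(1)] neg_ln_one_minus_le_cubic[OF uv(2,3)] by (simp add: field_simps)
  also have "u ^ 3 / 3 + v ^ 3 \<le> (4 * s) ^ 3 / 3 + (4 * s) ^ 3"
    using uv by (intro add_mono divide_right_mono power_mono) auto
  also have "\<dots> \<le> 86 * s ^ 3" using s by (simp add: power_mult_distrib field_simps)
  also have "(v\<^sup>2 - u\<^sup>2) / 2 = s\<^sup>2 * (1 / (1 - \<rho>)\<^sup>2 - 1 / \<rho>\<^sup>2) / 2"
    by (simp add: u_def v_def power_divide right_diff_distrib)
  also have "\<dots> \<le> s\<^sup>2 * (58 * \<bar>\<rho> - 1 / 2\<bar>) / 2"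
    by (intro divide_right_mono mult_left_mono inverse_square_gap \<rho>) auto
  finally show "ln ((1 / \<rho>) / (1 / (\<rho> + s))) - ln (1 - s * (1 / (1 - \<rho>))) - s * (1 / (1 - \<rho>) + 1 / \<rho>)
      \<le> 29 * s\<^sup>2 * \<bar>\<rho> - 1 / 2\<bar> + 86 * s ^ 3" by simp
qed (use \<rho> s in \<open>auto simp: field_simps\<close>)

text \<open>The rate \<open>\<rho> - s\<close> forces the tilt \<open>- s\<close>, which controls
  the lower tail. The cubic terms now have a favourable sign and are dropped.\<close>

lemma supercritical_exp_moment:
  assumes \<rho>: "1 / 4 \<le> \<rho>" "\<rho> \<le> 3 / 4" and s: "0 < s" "s \<le> 1 / 8"
  shows "envint (\<lambda>E. ennreal (exp (- s * (diag_lpp (1 / (1 - \<rho>)) (1 / (\<rho> - s)) E n - n * (1 / (1 - \<rho>) + 1 / \<rho>)))))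
      \<le> ennreal (exp (n * (29 * s\<^sup>2 * \<bar>\<rho> - 1 / 2\<bar>)))"
proof (rule nn_integral_exp_centered[where y = "1 / \<rho>"])
  define u where "u = s / \<rho>"
  define v where "v = s / (1 - \<rho>)"
  have uv: "0 \<le> u" "0 \<le> v" "u < 1" using \<rho> s by (auto simp: u_def v_def field_simps)
  show "- s * (1 / (1 - \<rho>)) < 1" using uv(2) by (simp add: v_def)
  have "ln ((1 / \<rho>) / (1 / (\<rho> - s))) - ln (1 - - s * (1 / (1 - \<rho>))) - - s * (1 / (1 - \<rho>) + 1 / \<rho>)
      = ln (1 - u) - ln (1 + v) + u + v"
    using \<rho> s by (simp add: u_def v_def field_simps)
  also have "\<dots> \<le> (v\<^sup>2 - u\<^sup>2) / 2"
    using ln_one_minus_le_quadratic[OF uv(1,3)] neg_ln_one_plus_le_quadratic[OF uv(2)] by (simp add: field_simps)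
  also have "(v\<^sup>2 - u\<^sup>2) / 2 = s\<^sup>2 * (1 / (1 - \<rho>)\<^sup>2 - 1 / \<rho>\<^sup>2) / 2"
    by (simp add: u_def v_def power_divide right_diff_distrib)
  also have "\<dots> \<le> s\<^sup>2 * (58 * \<bar>\<rho> - 1 / 2\<bar>) / 2"
    by (intro divide_right_mono mult_left_mono inverse_square_gap \<rho>) auto
  finally show "ln ((1 / \<rho>) / (1 / (\<rho> - s))) - ln (1 - - s * (1 / (1 - \<rho>))) - - s * (1 / (1 - \<rho>) + 1 / \<rho>)
      \<le> 29 * s\<^sup>2 * \<bar>\<rho> - 1 / 2\<bar>" by simp
qed (use \<rho> s in \<open>auto simp: field_simps\<close>)

text \<open>Here \<open>C\<close> bounds the advantage of the first model over the second at any
  diagonal point. The term \<open>max (\<mu>1 - \<mu>2) 0\<close> in \<open>C\<close> and the final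
  difference \<open>\<mu>2 - \<mu>1\<close> add up to \<open>max (\<mu>2 - \<mu>1) 0\<close>, so
  only an excess of the second mean costs anything.\<close>

lemma mixed_gain_bound:
  fixes \<mu>1 \<mu>2 :: real
  assumes "1 \<le> N" and y: "y1 < y2"
    and W1: "\<And>i. i \<le> N \<Longrightarrow> \<bar>diag_lpp x1 y1 E i - i * \<mu>1\<bar> \<le> W1"
    and W2: "\<And>i. i \<le> N \<Longrightarrow> \<bar>diag_lpp x2 y2 E i - i * \<mu>2\<bar> \<le> W2"
    and S: "\<And>i. 1 \<le> i \<Longrightarrow> i \<le> N \<Longrightarrow> \<bar>E (i, i)\<bar> \<le> S"
  shows "diag_lpp x1 y2 E N - diag_lpp x1 y1 E N \<le> 2 * W1 + 2 * W2 + N * max (\<mu>2 - \<mu>1) 0 + (y2 - y1) * S"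
proof -
  define C where "C = W1 + W2 + N * max (\<mu>1 - \<mu>2) 0 + (y2 - y1) * S"
  have "lpp (scaled_weights x1 y2 E) N N \<le> lpp (scaled_weights x2 y2 E) N N + C"
  proof (rule lpp_mixed(2))
    fix a assume a: "1 \<le> a" "a \<le> N"
    have "(y2 - y1) * E (a, a) \<le> (y2 - y1) * S"
      using S[OF a] y by (intro mult_left_mono) auto
    moreover have "real a * (\<mu>1 - \<mu>2) \<le> real N * max (\<mu>1 - \<mu>2) 0"
      using a by (intro order_trans[OF mult_left_mono[of "\<mu>1 - \<mu>2" "max (\<mu>1 - \<mu>2) 0"] mult_right_mono]) auto
    ultimately show "diag_lpp x1 y1 E a - diag_lpp x2 y2 E a + (y2 - y1) * E (a, a) \<le> C"
      using W1[OF a(2)] W2[OF a(2)] by (simp add: C_def abs_le_iff algebra_simps)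
  qed (use assms in auto)
  then have "diag_lpp x1 y2 E N \<le> diag_lpp x2 y2 E N + C" by (simp add: diag_lpp_def)
  moreover have "N * max (\<mu>1 - \<mu>2) 0 + N * (\<mu>2 - \<mu>1) = N * max (\<mu>2 - \<mu>1) 0"
    by (simp add: max_def algebra_simps)
  ultimately show ?thesis
    using W1[of N] W2[of N] by (simp add: C_def abs_le_iff algebra_simps)
qed

text \<open>By convexity in the diagonal scale the stationary model lies, up to a small multiple of the
  gain from a larger perturbation, between a sub- and a supercritical model.\<close>
lemma centered_lpp_sandwich:
  assumes \<rho>: "0 < \<rho>" "\<rho> < 1" and se: "0 < s" "s < e" "e < \<rho>"
    and R: "diag_lpp (1 / (1 - \<rho>)) (1 / (\<rho> - e)) E N - diag_lpp (1 / (1 - \<rho>)) (1 / \<rho>) E N \<le> R" "0 \<le> R"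
  defines "\<mu> \<equiv> 1 / (1 - \<rho>) + 1 / \<rho>"
  shows "\<bar>centered_lpp \<rho> E N\<bar> \<le> max (diag_lpp (1 / (1 - \<rho>)) (1 / (\<rho> + s)) E N - N * \<mu>) 0
      + max (- (diag_lpp (1 / (1 - \<rho>)) (1 / (\<rho> - s)) E N - N * \<mu>)) 0 + s / e * R"
proof -
  let ?g = "\<lambda>y. diag_lpp (1 / (1 - \<rho>)) y E N"
  \<comment> \<open>These are distances between diagonal means, the variable in which
    \<open>diag_lpp\<close> is convex. They are differences of reciprocals of the rates, and their
    ratios stay below \<open>s / e\<close>.\<close>
  define A where "A = 1 / \<rho> - 1 / (\<rho> + s)"
  define A' where "A' = 1 / (\<rho> - s) - 1 / \<rho>"
  define B where "B = 1 / (\<rho> - e) - 1 / \<rho>"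
  have pos: "0 < A" "0 < A'" "0 < B" "A' \<le> B"
    using \<rho> se by (auto simp: A_def A'_def B_def frac_less2 intro!: divide_left_mono mult_pos_pos)
  have "A / B = s / e * ((\<rho> - e) / (\<rho> + s))" "A' / B = s / e * ((\<rho> - e) / (\<rho> - s))"
    using \<rho> se by (simp_all add: A_def A'_def B_def divide_simps)
  moreover have "(\<rho> - e) / (\<rho> + s) \<le> 1" "(\<rho> - e) / (\<rho> - s) \<le> 1" using \<rho> se by auto
  moreover have "s / e * c \<le> s / e" if "c \<le> 1" for c using se that by (intro mult_left_le) auto
  ultimately have ratio: "A / B \<le> s / e" "A' / B \<le> s / e" by metis+
  \<comment> \<open>A chord of a convex function ending at \<open>1 / \<rho>\<close> has at most the
    slope of a chord starting there.\<close>
  have 1: "?g (1 / \<rho>) - ?g (1 / (\<rho> + s)) \<le> s / e * R"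
  proof -
    have "?g (1 / \<rho>) \<le> B / (A + B) * ?g (1 / (\<rho> + s)) + A / (A + B) * ?g (1 / (\<rho> - e))"
      using diag_lpp_convex[of "1 / (\<rho> + s)" "1 / \<rho>" "1 / (\<rho> - e)" "1 / (1 - \<rho>)" E N] pos
      by (simp add: A_def B_def)
    also have "\<dots> = (B * ?g (1 / (\<rho> + s)) + A * ?g (1 / (\<rho> - e))) / (A + B)" by (simp add: add_divide_distrib)
    finally have "(A + B) * ?g (1 / \<rho>) \<le> B * ?g (1 / (\<rho> + s)) + A * ?g (1 / (\<rho> - e))"
      using pos by (simp add: pos_le_divide_eq mult.commute)
    then have "B * (?g (1 / \<rho>) - ?g (1 / (\<rho> + s))) \<le> A * (?g (1 / (\<rho> - e)) - ?g (1 / \<rho>))"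
      by (simp add: algebra_simps)
    also have "\<dots> \<le> A * R" using R pos by (intro mult_left_mono) auto
    finally have "?g (1 / \<rho>) - ?g (1 / (\<rho> + s)) \<le> A / B * R" using pos by (simp add: field_simps)
    also have "\<dots> \<le> s / e * R" using ratio R(2) by (intro mult_right_mono) auto
    finally show ?thesis .
  qed
  \<comment> \<open>Both chords start at \<open>1 / \<rho>\<close>; by convexity the slope of the
    shorter one is not larger.\<close>
  have 2: "?g (1 / (\<rho> - s)) - ?g (1 / \<rho>) \<le> s / e * R"
  proof -
    have "?g (1 / (\<rho> - s)) \<le> (B - A') / B * ?g (1 / \<rho>) + A' / B * ?g (1 / (\<rho> - e))"
      using diag_lpp_convex[of "1 / \<rho>" "1 / (\<rho> - s)" "1 / (\<rho> - e)" "1 / (1 - \<rho>)" E N] pos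
      by (simp add: A'_def B_def)
    then have "?g (1 / (\<rho> - s)) - ?g (1 / \<rho>) \<le> A' / B * (?g (1 / (\<rho> - e)) - ?g (1 / \<rho>))"
      using pos by (simp add: field_simps)
    also have "\<dots> \<le> A' / B * R" using R pos by (intro mult_left_mono) auto
    also have "\<dots> \<le> s / e * R" using ratio R(2) by (intro mult_right_mono) auto
    finally show ?thesis .
  qed
  show ?thesis using 1 2 by (simp add: centered_lpp_def \<mu>_def)
qed

section \<open>The uniform fourth moment bound\<close>

lemma nn_integral_weight_pow4:
  assumes hs: "p \<in> half_space"
  shows "envint (\<lambda>E. ennreal (E p ^ 4)) \<le> ennreal 1536"
proof -
  have meas: "(\<lambda>E. E p) \<in> borel_measurable iid_env" by (rule measurable_iid_env_component[OF hs])
  have mgf: "envint (\<lambda>E. ennreal (exp (t * E p))) = ennreal (1 / (1 - t))" if "t < 1" for t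
  proof -
    have "envint (\<lambda>E. ennreal (exp (t * E p))) = envint (\<lambda>E. \<integral>\<^sup>+u. ennreal (exp (t * u)) \<partial>exp_law 1)"
      using measurable_compose[OF meas, of "\<lambda>z. ennreal (exp (t * z))" borel]
      by (subst nn_integral_iid_env_resample[OF _ hs]) auto
    then show ?thesis using prob_space.emeasure_space_1[OF prob_space_iid_env]
      by (simp add: nn_integral_exp_law_mgf[OF that])
  qed
  have "envint (\<lambda>E. ennreal (E p ^ 4)) \<le> ennreal (48 * 2 / (1 / 2) ^ 4)"
  proof (rule nn_integral_pow4_from_mgf2[OF meas])
    show "envint (\<lambda>E. ennreal (exp (1 / 2 * E p))) \<le> ennreal 2"
      by (subst mgf) auto
    show "envint (\<lambda>E. ennreal (exp (- (1 / 2) * E p))) \<le> ennreal 2"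
      using mgf[of "- (1 / 2)"] ennreal_leI[of "1 / (1 - - (1 / 2))" 2] by simp
  qed auto
  then show ?thesis by (simp add: power_divide)
qed

text \<open>An l4 norm in place of the maximum of the diagonal weights: it dominates each of them
  and its fourth moment is linear in \<open>N\<close>, which is affordable because
  \<open>N \<le> fluct_scale \<rho> N ^ 3\<close>.\<close>

definition diag_norm4 :: "nat \<Rightarrow> (nat \<times> nat \<Rightarrow> real) \<Rightarrow> real" where
  "diag_norm4 N E = root 4 (\<Sum>a=1..N. E (a, a) ^ 4)"

lemma diag_norm4_props:
  "0 \<le> diag_norm4 N E" "diag_norm4 N E ^ 4 = (\<Sum>a=1..N. E (a, a) ^ 4)"
  "1 \<le> a \<Longrightarrow> a \<le> N \<Longrightarrow> \<bar>E (a, a)\<bar> \<le> diag_norm4 N E"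
proof -
  show nonneg: "0 \<le> diag_norm4 N E" and pow: "diag_norm4 N E ^ 4 = (\<Sum>a=1..N. E (a, a) ^ 4)"
    unfolding diag_norm4_def by (simp_all add: sum_nonneg)
  assume a: "1 \<le> a" "a \<le> N"
  have "\<bar>E (a, a)\<bar> ^ 4 \<le> diag_norm4 N E ^ 4"
    unfolding pow using a member_le_sum[of a "{1..N}" "\<lambda>a. E (a, a) ^ 4"] by simp
  then show "\<bar>E (a, a)\<bar> \<le> diag_norm4 N E" by (rule power_le_imp_le_base[of _ 3, simplified numeral_eq_Suc, simplified]) (use nonneg in \<open>simp_all add: numeral_eq_Suc\<close>)
qed

lemma measurable_diag_norm4 [measurable]: "diag_norm4 N \<in> borel_measurable iid_env"
proof -
  have "(\<lambda>E. \<Sum>a=1..N. E (a, a) ^ 4) \<in> borel_measurable iid_env"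
    by (intro borel_measurable_sum borel_measurable_power measurable_iid_env_component) (simp add: half_space_def)
  then show ?thesis unfolding diag_norm4_def[abs_def]
    by (rule measurable_compose) measurable
qed

lemma nn_integral_diag_norm4: "envint (\<lambda>E. ennreal (diag_norm4 N E ^ 4)) \<le> ennreal (1536 * real N)"
proof -
  have "envint (\<lambda>E. ennreal (diag_norm4 N E ^ 4)) = envint (\<lambda>E. (\<Sum>a=1..N. ennreal (E (a, a) ^ 4)))"
    by (simp add: diag_norm4_props sum_ennreal)
  also have "\<dots> = (\<Sum>a=1..N. \<integral>\<^sup>+E. ennreal (E (a, a) ^ 4) \<partial>iid_env)"
    by (rule nn_integral_sum, rule measurable_compose[OF measurable_iid_env_component, of _ "\<lambda>z. ennreal (z ^ 4)"])
       (auto simp: half_space_def)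
  also have "\<dots> \<le> (\<Sum>a=1..N. ennreal 1536)" by (intro sum_mono nn_integral_weight_pow4) (simp add: half_space_def)
  also have "\<dots> = ennreal (1536 * real N)" by (simp add: ennreal_mult' ennreal_of_nat_eq_real_of_nat mult.commute)
  finally show ?thesis .
qed

text \<open>The stationary mean \<open>1 / (t * (1 - t))\<close> is minimal at
  \<open>t = 1/2\<close>, so lowering the parameter by \<open>e\<close> raises it only to second
  order in \<open>e\<close> and the distance from \<open>1/2\<close>. For \<open>e\<close> of order
  \<open>1 / fluct_scale \<rho> N\<close> the total over \<open>N\<close> steps has the order of the
  fluctuations.\<close>

lemma mean_gap:
  fixes \<rho> e :: real
  assumes "1 / 4 \<le> \<rho> - e" "\<rho> \<le> 3 / 4" "0 < e"
  shows "(1 / (1 - (\<rho> - e)) + 1 / (\<rho> - e)) - (1 / (1 - \<rho>) + 1 / \<rho>) \<le> 29 * (e * (e + 2 * \<bar>\<rho> - 1 / 2\<bar>))"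
proof -
  define r where "r = \<rho> - e"
  have pr: "3 / 16 \<le> r * (1 - r)" "3 / 16 \<le> \<rho> * (1 - \<rho>)" using parameter_product_lower[of r] parameter_product_lower[of \<rho>] assms by (simp_all add: r_def)
  have eq: "1 / (1 - t) + 1 / t = 1 / (t * (1 - t))" if "0 < t" "t < 1" for t :: real
    using that by (simp add: field_simps)
  have rr: "0 < r" "r < 1" "0 < \<rho>" "\<rho> < 1" using assms by (auto simp: r_def)
  have "(1 / (1 - r) + 1 / r) - (1 / (1 - \<rho>) + 1 / \<rho>)
      = (\<rho> * (1 - \<rho>) - r * (1 - r)) / ((r * (1 - r)) * (\<rho> * (1 - \<rho>)))"
    unfolding eq[OF rr(1,2)] eq[OF rr(3,4)] using rr by (subst diff_frac_eq) auto
  also have "\<rho> * (1 - \<rho>) - r * (1 - r) = e * (e - 2 * (\<rho> - 1 / 2))" by (simp add: r_def field_simps)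
  also have "e * (e - 2 * (\<rho> - 1 / 2)) / ((r * (1 - r)) * (\<rho> * (1 - \<rho>)))
      \<le> e * (e + 2 * \<bar>\<rho> - 1 / 2\<bar>) / ((r * (1 - r)) * (\<rho> * (1 - \<rho>)))"
  proof (intro divide_right_mono mult_left_mono)
    show "e - 2 * (\<rho> - 1 / 2) \<le> e + 2 * \<bar>\<rho> - 1 / 2\<bar>"
      by (cases "\<rho> \<le> 1 / 2") auto
  qed (use assms rr in auto)
  also have "\<dots> \<le> e * (e + 2 * \<bar>\<rho> - 1 / 2\<bar>) / ((3 / 16) * (3 / 16))"
    using assms pr rr by (intro divide_left_mono mult_mono mult_nonneg_nonneg mult_pos_pos) auto
  also have "\<dots> \<le> 29 * (e * (e + 2 * \<bar>\<rho> - 1 / 2\<bar>))" using assms by simp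
  finally show ?thesis by (simp add: r_def)
qed

text \<open>With \<open>\<sigma> = fluct_scale \<rho> N\<close>, the added distance from criticality
  contributes \<open>sqrt (N * e) \<le> sqrt (\<sigma> ^ 3 * e) \<le> c * \<sigma>\<close>. For
  \<open>e = \<Lambda> / \<sigma>\<close> the scale grows by a factor of order
  \<open>sqrt \<Lambda>\<close>, less than the factor \<open>\<Lambda>\<close> gained by
  convexity.\<close>

lemma fluct_scale_shift:
  assumes "0 \<le> e" "e * fluct_scale \<rho> N \<le> c\<^sup>2" "0 \<le> c" "1 \<le> N"
  shows "fluct_scale (\<rho> - e) N \<le> (1 + c) * fluct_scale \<rho> N"
proof -
  let ?\<sigma> = "fluct_scale \<rho> N"
  have \<sigma>: "1 \<le> ?\<sigma>" by (rule fluct_scale_bounds(3)[OF assms(4)])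
  have "real N * e \<le> ?\<sigma> ^ 3 * e" by (intro mult_right_mono fluct_scale_bounds assms)
  also have "\<dots> = ?\<sigma>\<^sup>2 * (e * ?\<sigma>)" by (simp add: power2_eq_square power3_eq_cube)
  also have "\<dots> \<le> ?\<sigma>\<^sup>2 * c\<^sup>2" by (intro mult_left_mono assms) auto
  finally have Ne: "real N * e \<le> (c * ?\<sigma>)\<^sup>2" by (simp add: power_mult_distrib mult.commute)
  have "sqrt (real N * \<bar>\<rho> - e - 1 / 2\<bar>) \<le> sqrt (real N * \<bar>\<rho> - 1 / 2\<bar> + real N * e)"
    unfolding distrib_left[symmetric] using assms(1) by (intro real_sqrt_le_mono mult_left_mono) auto
  also have "\<dots> \<le> sqrt (real N * \<bar>\<rho> - 1 / 2\<bar>) + sqrt (real N * e)"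
    using assms(1) by (intro sqrt_add_le_add_sqrt) auto
  also have "sqrt (real N * e) \<le> c * ?\<sigma>"
    using real_sqrt_le_mono[OF Ne] assms(3) \<sigma> by simp
  finally show ?thesis by (simp add: fluct_scale_def algebra_simps)
qed

text \<open>The maxima, the only terms involving \<open>K\<close>, enter with the factor
  \<open>1 / \<Lambda>\<close>; hence \<open>K\<close> returns halved. The conditions
  \<open>3/8 \<le> \<rho>\<close> and \<open>2 ^ 23 \<le> fluct_scale \<rho> N\<close> give
  \<open>e \<le> 1/8\<close> and keep \<open>\<rho> - e\<close> inside \<open>[1/4, 3/4]\<close>,
  where \<open>fm\<close> applies.\<close>

lemma fourth_moment_step:
  fixes \<rho> K :: real and N :: nat
  assumes \<rho>: "3 / 8 \<le> \<rho>" "\<rho> \<le> 3 / 4" and N: "1 \<le> N" "2 ^ 23 \<le> fluct_scale \<rho> N" and K: "0 \<le> K"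
    and fm: "\<And>n r. n \<le> N \<Longrightarrow> 1 / 4 \<le> r \<Longrightarrow> r \<le> 3 / 4 \<Longrightarrow> fourth_moment r n \<le> ennreal (K * fluct_scale r n ^ 4)"
  shows "fourth_moment \<rho> N
    \<le> ennreal ((64 * (48 * exp 115 + 512 * (29 * (2 ^ 20 + 2)) ^ 4 + 512 * 65536 * 1536) + K / 2) * fluct_scale \<rho> N ^ 4)"
proof -
  define \<sigma> where "\<sigma> = fluct_scale \<rho> N"
  \<comment> \<open>Large enough for
    \<open>64 * 1024 * 32000 * (1 + 2 ^ 44) / \<Lambda> ^ 4 \<le> 1/2\<close>, and a square, so that
    \<open>sqrt \<Lambda> = 2 ^ 10\<close> is exact.\<close>
  define \<Lambda> where "\<Lambda> = (2 ^ 20 :: real)"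
  define s where "s = 1 / \<sigma>"
  define e where "e = \<Lambda> / \<sigma>"
  define d where "d = \<bar>\<rho> - 1 / 2\<bar>"
  have \<sigma>: "2 ^ 23 \<le> \<sigma>" "0 < \<sigma>" "1 \<le> \<sigma>" using N(2) by (auto simp: \<sigma>_def)
  have N3: "real N \<le> \<sigma> ^ 3" and Nd: "real N * d \<le> \<sigma>\<^sup>2"
    using fluct_scale_bounds[of N \<rho>] by (simp_all add: \<sigma>_def d_def)
  have \<Lambda>: "1 < \<Lambda>" "\<Lambda> * 8 \<le> \<sigma>" using \<sigma> by (simp_all add: \<Lambda>_def)
  have s: "0 < s" "s \<le> 1 / 8" "s < e" using \<sigma> \<Lambda> by (auto simp: s_def e_def field_simps)
  have e: "0 < e" "e \<le> 1 / 8" using \<sigma> \<Lambda> by (auto simp: e_def field_simps)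
  have se: "s / e = 1 / \<Lambda>" using \<sigma> \<Lambda> by (simp add: s_def e_def)
  define \<rho>2 where "\<rho>2 = \<rho> - e"
  have \<rho>2: "1 / 4 \<le> \<rho>2" "\<rho>2 \<le> 3 / 4" using \<rho> e by (auto simp: \<rho>2_def)
  define x where "x = 1 / (1 - \<rho>)"
  define \<mu> where "\<mu> = 1 / (1 - \<rho>) + 1 / \<rho>"
  define A where "A E = max (diag_lpp x (1 / (\<rho> + s)) E N - N * \<mu>) 0" for E
  define B where "B E = max (- (diag_lpp x (1 / (\<rho> - s)) E N - N * \<mu>)) 0" for E
  define W where "W E = Max ((\<lambda>i. \<bar>centered_lpp \<rho> E i\<bar>) ` {..N})" for E
  define V where "V E = Max ((\<lambda>i. \<bar>centered_lpp \<rho>2 E i\<bar>) ` {..N})" for E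
  define S where "S = diag_norm4 N"
  define G where "G = N * (29 * (e * (e + 2 * d)))"
  define R where "R E = 2 * W E + 2 * V E + (G + 16 * e * S E)" for E
  have [measurable]: "A \<in> borel_measurable iid_env" "B \<in> borel_measurable iid_env"
    "W \<in> borel_measurable iid_env" "V \<in> borel_measurable iid_env" "S \<in> borel_measurable iid_env"
    unfolding A_def B_def W_def V_def S_def by measurable
  have S_nonneg: "0 \<le> S E" for E by (simp add: S_def diag_norm4_props)
  have W_ge: "\<bar>centered_lpp \<rho> E i\<bar> \<le> W E" "\<bar>centered_lpp \<rho>2 E i\<bar> \<le> V E" if "i \<le> N" for E i
    unfolding W_def V_def using that by (auto intro!: Max_ge)
  have WV_nonneg: "0 \<le> W E" "0 \<le> V E" for E using W_ge[of 0 E] by auto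
  have G: "0 \<le> G" using e by (simp add: G_def d_def)

  have "\<bar>centered_lpp \<rho> E N\<bar> \<le> A E + B E + s / e * R E" for E
    unfolding A_def B_def x_def \<mu>_def
  proof (rule centered_lpp_sandwich)
    \<comment> \<open>The second model of the mixed comparison is the stationary one with parameter
      \<open>\<rho>2\<close>; it has the same diagonal mean as the perturbed model.\<close>
    have y: "1 / \<rho> < 1 / \<rho>2" using \<rho> \<rho>2 e by (auto simp: \<rho>2_def frac_less2)
    have "diag_lpp (1 / (1 - \<rho>)) (1 / \<rho>2) E N - diag_lpp (1 / (1 - \<rho>)) (1 / \<rho>) E N
       \<le> 2 * W E + 2 * V E + N * max ((1 / (1 - \<rho>2) + 1 / \<rho>2) - (1 / (1 - \<rho>) + 1 / \<rho>)) 0 + (1 / \<rho>2 - 1 / \<rho>) * S E"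
      by (rule mixed_gain_bound[OF N(1) y])
         (use W_ge in \<open>auto simp: centered_lpp_def S_def diag_norm4_props\<close>)
    also have "\<dots> \<le> 2 * W E + 2 * V E + N * (29 * (e * (e + 2 * d))) + 16 * e * S E"
    proof (intro add_mono mult_left_mono mult_right_mono order_refl S_nonneg)
      show "max ((1 / (1 - \<rho>2) + 1 / \<rho>2) - (1 / (1 - \<rho>) + 1 / \<rho>)) 0 \<le> 29 * (e * (e + 2 * d))"
        using mean_gap[of \<rho> e] \<rho> \<rho>2 e by (simp add: \<rho>2_def d_def)
      have "1 / \<rho>2 - 1 / \<rho> = e / (\<rho>2 * \<rho>)" using \<rho> \<rho>2 by (simp add: \<rho>2_def field_simps)
      also have "\<dots> \<le> e / (1 / 4 * (1 / 4))" using \<rho> \<rho>2 e by (intro divide_left_mono mult_mono) auto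
      finally show "1 / \<rho>2 - 1 / \<rho> \<le> 16 * e" by simp
    qed simp_all
    finally show "diag_lpp (1 / (1 - \<rho>)) (1 / (\<rho> - e)) E N - diag_lpp (1 / (1 - \<rho>)) (1 / \<rho>) E N \<le> R E"
      by (simp add: R_def G_def \<rho>2_def)
    show "0 \<le> R E" using WV_nonneg G e S_nonneg by (simp add: R_def)
  qed (use \<rho> s e in auto)
  then have abs_le: "\<bar>centered_lpp \<rho> E N\<bar> \<le> A E + B E + 1 / \<Lambda> * R E" for E unfolding se .
  have R4: "R E ^ 4 \<le> 1024 * (W E ^ 4 + V E ^ 4) + 512 * (G ^ 4 + 65536 * e ^ 4 * S E ^ 4)" for E
    using pow4_sum_le3[of "2 * W E" "2 * V E" "G + 16 * e * S E"] pow4_sum_le2[of G "16 * e * S E"]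
    by (simp add: R_def power_mult_distrib)
  have c4: "centered_lpp \<rho> E N ^ 4 \<le> 64 * (A E ^ 4 + B E ^ 4) + 64 / \<Lambda> ^ 4 *
      (1024 * (W E ^ 4 + V E ^ 4) + 512 * (G ^ 4 + 65536 * e ^ 4 * S E ^ 4))" for E
  proof -
    have "centered_lpp \<rho> E N ^ 4 = \<bar>centered_lpp \<rho> E N\<bar> ^ 4" by simp
    also have "\<dots> \<le> (A E + B E + 1 / \<Lambda> * R E) ^ 4" by (rule power_mono[OF abs_le]) simp
    also have "\<dots> \<le> 64 * (A E ^ 4 + B E ^ 4 + (1 / \<Lambda> * R E) ^ 4)" by (rule pow4_sum_le3)
    also have "(1 / \<Lambda> * R E) ^ 4 = 1 / \<Lambda> ^ 4 * R E ^ 4" by (simp add: power_mult_distrib power_divide)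
    also have "\<dots> \<le> 1 / \<Lambda> ^ 4 * (1024 * (W E ^ 4 + V E ^ 4) + 512 * (G ^ 4 + 65536 * e ^ 4 * S E ^ 4))"
      using \<Lambda> by (intro mult_left_mono R4) auto
    finally show ?thesis by simp
  qed

  \<comment> \<open>With \<open>s = 1 / \<sigma>\<close>, both \<open>N * s\<^sup>2 * d\<close> and
    \<open>N * s ^ 3\<close> are at most 1, and 29 + 86 = 115.\<close>
  have exps: "N * (29 * s\<^sup>2 * d + 86 * s ^ 3) \<le> 115" "N * (29 * s\<^sup>2 * d) \<le> 115"
  proof -
    have "N * (29 * s\<^sup>2 * d) = 29 * (N * d / \<sigma>\<^sup>2)" by (simp add: s_def power_divide)
    also have "\<dots> \<le> 29 * 1" using Nd \<sigma> by (intro mult_left_mono) auto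
    finally have 1: "N * (29 * s\<^sup>2 * d) \<le> 29" by simp
    have "N * (86 * s ^ 3) = 86 * (N / \<sigma> ^ 3)" by (simp add: s_def power_divide)
    also have "\<dots> \<le> 86 * 1" using N3 \<sigma> by (intro mult_left_mono) auto
    finally show "N * (29 * s\<^sup>2 * d + 86 * s ^ 3) \<le> 115" "N * (29 * s\<^sup>2 * d) \<le> 115" using 1 by (simp_all add: distrib_left)
  qed
  have A4: "envint (\<lambda>E. ennreal (A E ^ 4)) \<le> ennreal (24 * exp 115 / s ^ 4)"
    unfolding A_def
  proof (rule nn_integral_pow4_from_mgf)
    have "envint (\<lambda>E. ennreal (exp (s * (diag_lpp x (1 / (\<rho> + s)) E N - N * \<mu>))))
        \<le> ennreal (exp (N * (29 * s\<^sup>2 * \<bar>\<rho> - 1 / 2\<bar> + 86 * s ^ 3)))"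
      unfolding x_def \<mu>_def by (rule subcritical_exp_moment) (use \<rho> s in auto)
    also have "\<dots> \<le> ennreal (exp 115)" using exps by (intro ennreal_leI) (simp add: d_def)
    finally show "envint (\<lambda>E. ennreal (exp (s * (diag_lpp x (1 / (\<rho> + s)) E N - N * \<mu>)))) \<le> ennreal (exp 115)" .
  qed (use s in auto)
  have B4: "envint (\<lambda>E. ennreal (B E ^ 4)) \<le> ennreal (24 * exp 115 / s ^ 4)"
    unfolding B_def
  proof (rule nn_integral_pow4_from_mgf)
    have "envint (\<lambda>E. ennreal (exp (s * - (diag_lpp x (1 / (\<rho> - s)) E N - N * \<mu>))))
        = envint (\<lambda>E. ennreal (exp (- s * (diag_lpp x (1 / (\<rho> - s)) E N - N * \<mu>))))"
      by (simp only: mult_minus_right mult_minus_left)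
    also have "\<dots> \<le> ennreal (exp (N * (29 * s\<^sup>2 * \<bar>\<rho> - 1 / 2\<bar>)))"
      unfolding x_def \<mu>_def by (rule supercritical_exp_moment) (use \<rho> s in auto)
    also have "\<dots> \<le> ennreal (exp 115)" using exps by (intro ennreal_leI) (simp add: d_def)
    finally show "envint (\<lambda>E. ennreal (exp (s * - (diag_lpp x (1 / (\<rho> - s)) E N - N * \<mu>)))) \<le> ennreal (exp 115)" .
  qed (use s in auto)
  have AB: "envint (\<lambda>E. ennreal (A E ^ 4 + B E ^ 4)) \<le> ennreal (1 * (24 * exp 115 / s ^ 4) + 1 * (24 * exp 115 / s ^ 4))"
    using A4 B4 s by (intro nn_integral_lincomb_le[where a = 1 and b = 1 and g = "\<lambda>E. A E ^ 4" and h = "\<lambda>E. B E ^ 4"]) auto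
  have W4: "envint (\<lambda>E. ennreal (W E ^ 4)) \<le> ennreal (32000 * K * \<sigma> ^ 4)"
    unfolding W_def \<sigma>_def by (rule maximal_inequality[OF _ _ N(1) K fm]) (use \<rho> in auto)
  have V4: "envint (\<lambda>E. ennreal (V E ^ 4)) \<le> ennreal (32000 * K * (2 ^ 11 * \<sigma>) ^ 4)"
  proof -
    have "envint (\<lambda>E. ennreal (V E ^ 4)) \<le> ennreal (32000 * K * fluct_scale \<rho>2 N ^ 4)"
      unfolding V_def by (rule maximal_inequality[OF _ _ N(1) K fm]) (use \<rho>2 in auto)
    also have "\<dots> \<le> ennreal (32000 * K * (2 ^ 11 * \<sigma>) ^ 4)"
    proof (intro ennreal_leI mult_left_mono power_mono)
      \<comment> \<open>Here \<open>e * \<sigma> = \<Lambda> = (2 ^ 10)\<^sup>2\<close>.\<close>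
      have "fluct_scale \<rho>2 N \<le> (1 + 2 ^ 10) * \<sigma>"
        unfolding \<rho>2_def \<sigma>_def
        by (rule fluct_scale_shift) (use e N \<sigma> in \<open>auto simp: e_def \<Lambda>_def \<sigma>_def\<close>)
      also have "\<dots> \<le> 2 ^ 11 * \<sigma>" using \<sigma> by simp
      finally show "fluct_scale \<rho>2 N \<le> 2 ^ 11 * \<sigma>" .
    qed (use K fluct_scale_nonneg in auto)
    finally show ?thesis .
  qed
  have WV: "envint (\<lambda>E. ennreal (W E ^ 4 + V E ^ 4)) \<le> ennreal (1 * (32000 * K * \<sigma> ^ 4) + 1 * (32000 * K * (2 ^ 11 * \<sigma>) ^ 4))"
    using W4 V4 K by (intro nn_integral_lincomb_le[where a = 1 and b = 1 and g = "\<lambda>E. W E ^ 4" and h = "\<lambda>E. V E ^ 4"]) auto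
  have GS: "envint (\<lambda>E. ennreal (G ^ 4 + 65536 * e ^ 4 * S E ^ 4)) \<le> ennreal (G ^ 4 * 1 + (65536 * e ^ 4) * (1536 * N))"
    using nn_integral_diag_norm4[of N] prob_space.emeasure_space_1[OF prob_space_iid_env]
    by (intro nn_integral_lincomb_le[where a = "G ^ 4" and b = "65536 * e ^ 4" and g = "\<lambda>E. 1" and h = "\<lambda>E. S E ^ 4"]) (auto simp: S_def)
  define b1 where "b1 = 48 * exp 115 / s ^ 4"
  define b2 where "b2 = 32000 * K * \<sigma> ^ 4 + 32000 * K * (2 ^ 11 * \<sigma>) ^ 4"
  define b3 where "b3 = G ^ 4 + 65536 * e ^ 4 * (1536 * N)"
  have b: "0 \<le> b1" "0 \<le> b2" "0 \<le> b3" using s K by (auto simp: b1_def b2_def b3_def)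
  have WVGS: "envint (\<lambda>E. ennreal (1024 * (W E ^ 4 + V E ^ 4) + 512 * (G ^ 4 + 65536 * e ^ 4 * S E ^ 4)))
      \<le> ennreal (1024 * b2 + 512 * b3)"
    by (rule nn_integral_lincomb_le[where g = "\<lambda>E. W E ^ 4 + V E ^ 4" and h = "\<lambda>E. G ^ 4 + 65536 * e ^ 4 * S E ^ 4"
          and c = b2 and d = b3]) (use WV GS b in \<open>simp_all add: b2_def b3_def del: ennreal_plus\<close>)
  have AB': "envint (\<lambda>E. ennreal (A E ^ 4 + B E ^ 4)) \<le> ennreal b1"
    using AB by (simp add: b1_def del: ennreal_plus)
  have "fourth_moment \<rho> N \<le> ennreal (64 * b1 + 64 / \<Lambda> ^ 4 * (1024 * b2 + 512 * b3))"
    unfolding fourth_moment_def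
    by (rule nn_integral_lincomb_le[OF _ _ _ _ _ _ _ _ AB' WVGS c4]) (use b \<Lambda> in auto)
  also have "64 * b1 + 64 / \<Lambda> ^ 4 * (1024 * b2 + 512 * b3)
     \<le> (64 * (48 * exp 115 + 512 * (29 * (2 ^ 20 + 2)) ^ 4 + 512 * 65536 * 1536) + K / 2) * \<sigma> ^ 4"
  proof -
    have 1: "b1 = 48 * exp 115 * \<sigma> ^ 4" using \<sigma> by (simp add: b1_def s_def power_divide)
    \<comment> \<open>The contraction: \<open>\<Lambda> ^ 4 = 2 ^ 80\<close> against
      \<open>2 ^ 44\<close> from the enlarged scale of the \<open>\<rho>2\<close> model.\<close>
    have 2: "64 / \<Lambda> ^ 4 * (1024 * b2) \<le> K / 2 * \<sigma> ^ 4"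
    proof -
      have "64 / \<Lambda> ^ 4 * (1024 * b2) = (64 * 1024 * 32000 * (1 + 2 ^ 44) / 2 ^ 80) * (K * \<sigma> ^ 4)"
        by (simp add: b2_def \<Lambda>_def power_mult_distrib algebra_simps)
      also have "\<dots> \<le> 1 / 2 * (K * \<sigma> ^ 4)" using K by (intro mult_right_mono) auto
      finally show ?thesis by simp
    qed
    have G_le: "G \<le> \<Lambda> * (29 * (\<Lambda> + 2)) * \<sigma>"
    proof -
      have "G = \<Lambda> * 29 * (\<Lambda> * (N / \<sigma>\<^sup>2) + 2 * (N * d / \<sigma>))"
        using \<sigma> by (simp add: G_def e_def power2_eq_square field_simps)
      also have "\<dots> \<le> \<Lambda> * 29 * (\<Lambda> * \<sigma> + 2 * \<sigma>)"
        using \<Lambda> \<sigma> N3 Nd by (intro mult_left_mono add_mono) (auto simp: field_simps power2_eq_square power3_eq_cube)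
      finally show ?thesis by (simp add: algebra_simps)
    qed
    then have "G ^ 4 \<le> (\<Lambda> * (29 * (\<Lambda> + 2)) * \<sigma>) ^ 4" using G by (rule power_mono)
    also have "\<dots> = (29 * (\<Lambda> + 2)) ^ 4 * \<sigma> ^ 4 * \<Lambda> ^ 4" by (simp only: power_mult_distrib mult_ac)
    finally have 3: "G ^ 4 / \<Lambda> ^ 4 \<le> (29 * (\<Lambda> + 2)) ^ 4 * \<sigma> ^ 4"
      using \<Lambda> by (subst pos_divide_le_eq) auto
    have 4: "e ^ 4 * N / \<Lambda> ^ 4 \<le> \<sigma> ^ 4"
    proof -
      have "e ^ 4 * N / \<Lambda> ^ 4 = N / \<sigma> ^ 4" using \<Lambda> by (simp add: e_def power_divide)
      also have "\<dots> \<le> \<sigma> ^ 3 / \<sigma> ^ 4" using N3 \<sigma> by (intro divide_right_mono) auto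
      also have "\<dots> \<le> 1" using \<sigma> by (simp add: power_increasing)
      also have "1 \<le> \<sigma> ^ 4" using \<sigma> by simp
      finally show ?thesis .
    qed
    have "64 * b1 + 64 / \<Lambda> ^ 4 * (1024 * b2 + 512 * b3)
       = 64 * b1 + 64 / \<Lambda> ^ 4 * (1024 * b2) + 64 * 512 * (G ^ 4 / \<Lambda> ^ 4) + 64 * 512 * 65536 * 1536 * (e ^ 4 * N / \<Lambda> ^ 4)"
      by (simp add: b3_def algebra_simps add_divide_distrib)
    also have "\<dots> \<le> 64 * (48 * exp 115 * \<sigma> ^ 4) + K / 2 * \<sigma> ^ 4 + 64 * 512 * ((29 * (\<Lambda> + 2)) ^ 4 * \<sigma> ^ 4)
        + 64 * 512 * 65536 * 1536 * \<sigma> ^ 4"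
      using 1 2 3 4 by (intro add_mono mult_left_mono) auto
    also have "\<dots> = (64 * (48 * exp 115 + 512 * (29 * (\<Lambda> + 2)) ^ 4 + 512 * 65536 * 1536) + K / 2) * \<sigma> ^ 4"
      by (simp add: distrib_right distrib_left mult.assoc del: power_mult_distrib)
    finally show ?thesis by (simp only: \<Lambda>_def)
  qed
  then have "ennreal (64 * b1 + 64 / \<Lambda> ^ 4 * (1024 * b2 + 512 * b3)) \<le> ennreal \<dots>" by (rule ennreal_leI)
  finally show ?thesis by (simp only: \<sigma>_def)
qed

text \<open>The cases left open by \<open>fourth_moment_step\<close> follow from the diffusive
  bound. A scale below \<open>2 ^ 23\<close> forces \<open>N \<le> 2 ^ 69\<close>, hence the
  constant \<open>2 ^ 161\<close>; and for \<open>\<rho> < 3/8\<close> one has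
  \<open>N \<le> 8 * fluct_scale \<rho> N ^ 2\<close>, so the diffusive size is already the right
  one.\<close>

lemma fourth_moment_contraction:
  fixes \<rho> K :: real
  assumes \<rho>: "1 / 4 \<le> \<rho>" "\<rho> \<le> 3 / 4" and K: "0 \<le> K"
    and fm: "\<And>n r. n \<le> N \<Longrightarrow> 1 / 4 \<le> r \<Longrightarrow> r \<le> 3 / 4 \<Longrightarrow> fourth_moment r n \<le> ennreal (K * fluct_scale r n ^ 4)"
  shows "fourth_moment \<rho> N
    \<le> ennreal ((64 * (48 * exp 115 + 512 * (29 * (2 ^ 20 + 2)) ^ 4 + 512 * 65536 * 1536) + 2 ^ 161 + K / 2) * fluct_scale \<rho> N ^ 4)"
proof -
  define C :: real where "C = 64 * (48 * exp 115 + 512 * (29 * (2 ^ 20 + 2)) ^ 4 + 512 * 65536 * 1536)"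
  have C: "0 \<le> C" by (simp add: C_def)
  let ?\<sigma> = "fluct_scale \<rho> N"
  have \<sigma>0: "0 \<le> ?\<sigma>" by (rule fluct_scale_nonneg)
  consider "N = 0" | "1 \<le> N" "?\<sigma> < 2 ^ 23" | "1 \<le> N" "\<rho> < 3 / 8" | "1 \<le> N" "3 / 8 \<le> \<rho>" "2 ^ 23 \<le> ?\<sigma>"
    by linarith
  then have "fourth_moment \<rho> N \<le> ennreal ((C + 2 ^ 161 + K / 2) * ?\<sigma> ^ 4)"
  proof cases
    case 1
    then show ?thesis using fourth_moment_trivial[OF \<rho>, of N] by simp
  next
    case 2
    have "real N \<le> ?\<sigma> ^ 3" by (rule fluct_scale_bounds(1))
    also have "\<dots> \<le> (2 ^ 23) ^ 3" using 2 \<sigma>0 by (intro power_mono) auto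
    finally have "(real N)\<^sup>2 \<le> ((2 ^ 23) ^ 3)\<^sup>2" by (intro power_mono) auto
    then have "2 ^ 23 * (real N)\<^sup>2 \<le> 2 ^ 161 * 1" by simp
    also have "\<dots> \<le> (C + 2 ^ 161 + K / 2) * ?\<sigma> ^ 4"
      using C K fluct_scale_bounds(3)[OF 2(1), of \<rho>] by (intro mult_mono) auto
    finally show ?thesis using fourth_moment_trivial[OF \<rho>, of N] by (meson ennreal_leI order_trans)
  next
    case 3
    have "real N * (1 / 8) \<le> real N * \<bar>\<rho> - 1 / 2\<bar>" using 3 by (intro mult_left_mono) auto
    also have "\<dots> \<le> ?\<sigma>\<^sup>2" by (rule fluct_scale_bounds(2))
    finally have "(real N)\<^sup>2 \<le> (8 * ?\<sigma>\<^sup>2)\<^sup>2" by (intro power_mono) auto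
    then have "2 ^ 23 * (real N)\<^sup>2 \<le> 2 ^ 29 * ?\<sigma> ^ 4" by (simp add: power_mult_distrib)
    also have "\<dots> \<le> (C + 2 ^ 161 + K / 2) * ?\<sigma> ^ 4" using C K by (intro mult_right_mono) auto
    finally show ?thesis using fourth_moment_trivial[OF \<rho>, of N] by (meson ennreal_leI order_trans)
  next
    case 4
    have "fourth_moment \<rho> N \<le> ennreal ((C + K / 2) * ?\<sigma> ^ 4)"
      unfolding C_def by (rule fourth_moment_step[OF 4(2) \<rho>(2) 4(1,3) K fm])
    also have "\<dots> \<le> ennreal ((C + 2 ^ 161 + K / 2) * ?\<sigma> ^ 4)" by (intro ennreal_leI mult_right_mono) auto
    finally show ?thesis .
  qed
  then show ?thesis by (simp only: C_def)
qed

text \<open>Hypothesis and conclusion of the contraction concern the same times, so this is no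
  induction on \<open>N\<close>: for fixed \<open>N\<close> a finite constant \<open>K\<close> is
  improved to \<open>C + K / 2\<close>, with fixed point \<open>2 * C\<close>. Enough iterations
  push the excess below 1, however large the initial constant was.\<close>

theorem uniform_fourth_moment:
  obtains C where "0 \<le> C"
    "\<And>\<rho> N. 1 / 4 \<le> \<rho> \<Longrightarrow> \<rho> \<le> 3 / 4 \<Longrightarrow> fourth_moment \<rho> N \<le> ennreal (C * fluct_scale \<rho> N ^ 4)"
proof -
  define C :: real where "C = 64 * (48 * exp 115 + 512 * (29 * (2 ^ 20 + 2)) ^ 4 + 512 * 65536 * 1536) + 2 ^ 161"
  have C: "0 \<le> C" by (simp add: C_def)
  have "fourth_moment \<rho> N \<le> ennreal ((2 * C + 1) * fluct_scale \<rho> N ^ 4)" if \<rho>: "1 / 4 \<le> \<rho>" "\<rho> \<le> 3 / 4" for \<rho> N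
  proof -
    \<comment> \<open>The diffusive bound is a valid start because
      \<open>fluct_scale r n \<ge> 1\<close> for \<open>n \<ge> 1\<close>; the dependence of
      \<open>K0\<close> on \<open>N\<close> is harmless, as \<open>j\<close> may depend on
      \<open>N\<close> too.\<close>
    define K0 where "K0 = 2 ^ 23 * (real N)\<^sup>2"
    have "fourth_moment r n \<le> ennreal ((2 * C + K0 / 2 ^ j) * fluct_scale r n ^ 4)"
      if "n \<le> N" "1 / 4 \<le> r" "r \<le> 3 / 4" for j n r
      using that
    proof (induction j arbitrary: n r)
      case 0
      have "2 ^ 23 * (real n)\<^sup>2 \<le> (2 * C + K0 / 2 ^ 0) * fluct_scale r n ^ 4"
      proof (cases "1 \<le> n")
        case True
        have "2 ^ 23 * (real n)\<^sup>2 \<le> (2 * C + K0) * 1" using 0 C by (simp add: K0_def power_mono add_increasing)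
        also have "\<dots> \<le> (2 * C + K0) * fluct_scale r n ^ 4"
          using C fluct_scale_bounds(3)[OF True, of r] by (intro mult_left_mono) (auto simp: K0_def)
        finally show ?thesis by simp
      qed (use C in \<open>simp add: K0_def not_le\<close>)
      then show ?case using fourth_moment_trivial[OF 0(2,3), of n] by (meson ennreal_leI order_trans)
    next
      case (Suc j)
      have "fourth_moment r n \<le> ennreal ((C + (2 * C + K0 / 2 ^ j) / 2) * fluct_scale r n ^ 4)"
        unfolding C_def
        by (rule fourth_moment_contraction[OF Suc.prems(2,3)], fold C_def)
           (use C Suc.IH Suc.prems in \<open>auto simp: K0_def\<close>)
      also have "C + (2 * C + K0 / 2 ^ j) / 2 = 2 * C + K0 / 2 ^ Suc j" by (simp add: field_simps)
      finally show ?case .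
    qed
    moreover obtain j where "K0 < 2 ^ j" using real_arch_pow[of 2 K0] by auto
    ultimately have "fourth_moment \<rho> N \<le> ennreal ((2 * C + K0 / 2 ^ j) * fluct_scale \<rho> N ^ 4)" "K0 / 2 ^ j \<le> 1"
      using \<rho> by (auto simp: field_simps)
    then show ?thesis by (elim order_trans) (intro ennreal_leI mult_right_mono; simp)
  qed
  with C show ?thesis by (intro that[of "2 * C + 1"]) auto
qed

section \<open>Transfer to the stationary environment\<close>

lemma exp_law_scale:
  assumes "0 < c"
  shows "exp_law (1 / c) = distr (exp_law 1) borel (\<lambda>u. c * u)"
proof (rule measure_eqI)
  have meas: "(\<lambda>u. c * u) \<in> measurable (exp_law 1) borel" by (simp cong: measurable_cong_sets)
  fix B assume "B \<in> sets (exp_law (1 / c))"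
  then have B: "B \<in> sets borel" by simp
  have "emeasure (exp_law (1 / c)) B = (\<integral>\<^sup>+u. indicator B u \<partial>exp_law (1 / c))" using B by simp
  also have "\<dots> = (\<integral>\<^sup>+u. indicator B (c * u) \<partial>exp_law 1)"
    using B assms by (intro nn_integral_exp_law_scale[symmetric]) auto
  also have "\<dots> = (\<integral>\<^sup>+u. indicator B u \<partial>distr (exp_law 1) borel (\<lambda>u. c * u))"
    using B meas by (subst nn_integral_distr) auto
  finally show "emeasure (exp_law (1 / c)) B = emeasure (distr (exp_law 1) borel (\<lambda>u. c * u)) B"
    using B by simp
qed simp

definition stationary_weights :: "real \<Rightarrow> (nat \<times> nat \<Rightarrow> real) \<Rightarrow> nat \<times> nat \<Rightarrow> real" where
  "stationary_weights \<rho> E = (\<lambda>p\<in>half_space.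
     if p = (0, 0) then 0 else scaled_weights (1 / (1 - \<rho>)) (1 / \<rho>) E p)"

lemma stationary_weights_component:
  "stationary_weights \<rho> E p = (if p \<in> half_space then
     (if p = (0, 0) then 0 else if snd p = 0 then 1 / (1 - \<rho>) else if fst p = snd p then 1 / \<rho> else 1) * E p
     else undefined)"
  by (auto simp: stationary_weights_def scaled_weights_def split: prod.split)

lemma stationary_weight_law_distr:
  assumes "0 < \<rho>" "\<rho> < 1"
  shows "stationary_weight_law \<rho> p = distr (exp_law 1) borel (\<lambda>u.
     (if p = (0, 0) then 0 else if snd p = 0 then 1 / (1 - \<rho>) else if fst p = snd p then 1 / \<rho> else 1) * u)"
proof -
  have h0: "return borel 0 = distr (exp_law 1) borel (\<lambda>u. 0 * u)"
    using prob_space.distr_const[OF prob_space_exp_law[of 1], of "0::real" borel] by simp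
  have h: "exp_law c = distr (exp_law 1) borel (\<lambda>u. 1 / c * u)" if "0 < c" for c
    using exp_law_scale[of "1 / c"] that by (simp only: divide_divide_eq_right div_by_1 mult_1 zero_less_divide_1_iff)
  have h1: "exp_law 1 = distr (exp_law 1) borel (\<lambda>u. 1 * u)"
    using h[of 1] by (simp only: div_by_1 zero_less_one simp_thms)
  obtain i j where p: "p = (i, j)" by (cases p)
  consider "i = 0 \<and> j = 0" | "j = 0" "i \<noteq> 0" | "j = i" "i \<noteq> 0" | "j \<noteq> 0" "i \<noteq> j" by linarith
  then show ?thesis
  proof cases
    case 1 then show ?thesis using h0 by (simp add: p stationary_weight_law_def)
  next
    case 2 then show ?thesis using h[of "1 - \<rho>"] assms by (simp add: p stationary_weight_law_def)
  next
    case 3 then show ?thesis using h[of \<rho>] assms by (simp add: p stationary_weight_law_def)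
  next
    case 4
    then have "stationary_weight_law \<rho> p = exp_law 1" by (simp add: p stationary_weight_law_def)
    moreover have "(if p = (0, 0) then 0 else if snd p = 0 then 1 / (1 - \<rho>) else if fst p = snd p then 1 / \<rho> else 1) = (1::real)"
      using 4 by (simp add: p)
    ultimately show ?thesis by (simp only: h1[symmetric])
  qed
qed

text \<open>Coordinatewise maps send a product measure to the product of the image laws. This is
  checked on cylinder sets, whose preimages are cylinders again.\<close>

lemma stationary_env_distr:
  assumes \<rho>: "0 < \<rho>" "\<rho> < 1"
  shows "stationary_env \<rho> = distr iid_env (stationary_env \<rho>) (stationary_weights \<rho>)"
    and "stationary_weights \<rho> \<in> measurable iid_env (stationary_env \<rho>)"
proof -
  define c where "c p = (if p = (0, 0) then 0 else if snd p = 0 then 1 / (1 - \<rho>) else if fst p = snd p then 1 / \<rho> else 1)"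
    for p :: "nat \<times> nat"
  define law where "law = stationary_weight_law \<rho>"
  have law: "law p = distr (exp_law 1) borel (\<lambda>u. c p * u)" for p
    unfolding law_def c_def by (rule stationary_weight_law_distr[OF \<rho>])
  have meas_c: "(\<lambda>u. c p * u) \<in> measurable (exp_law 1) borel" for p by (simp cong: measurable_cong_sets)
  have prob: "prob_space (law p)" for p
    unfolding law by (rule prob_space.prob_space_distr[OF prob_space_exp_law meas_c]) simp
  have sets_law [simp]: "sets (law p) = sets borel" for p by (simp add: law)
  have env: "stationary_env \<rho> = PiM half_space law" by (simp add: stationary_env_def law_def)
  have comp: "stationary_weights \<rho> E p = c p * E p" if "p \<in> half_space" for E p
    using that by (simp add: stationary_weights_component c_def)
  have meas: "stationary_weights \<rho> \<in> measurable iid_env (PiM half_space law)"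
    unfolding stationary_weights_def[abs_def]
  proof (rule measurable_restrict)
    fix p assume p: "p \<in> half_space"
    have "(\<lambda>E. c p * E p) \<in> borel_measurable iid_env"
      by (intro borel_measurable_times borel_measurable_const measurable_iid_env_component p)
    then show "(\<lambda>E. if p = (0, 0) then 0 else scaled_weights (1 / (1 - \<rho>)) (1 / \<rho>) E p) \<in> measurable iid_env (law p)"
      using comp[OF p] p by (simp add: stationary_weights_def cong: measurable_cong_sets)
  qed
  then show "stationary_weights \<rho> \<in> measurable iid_env (stationary_env \<rho>)" by (simp only: env)
  have "PiM half_space law = distr iid_env (PiM half_space law) (stationary_weights \<rho>)"
  proof (rule measure_eqI_PiM_infinite[OF refl])
    show "finite_measure (PiM half_space law)"
      using prob_space_PiM[of half_space law] prob by (simp add: prob_space_def)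
    fix A J assume J: "finite J" "J \<subseteq> half_space" and A: "\<And>p. p \<in> J \<Longrightarrow> A p \<in> sets (law p)"
    have "stationary_weights \<rho> -` prod_emb half_space law J (Pi\<^sub>E J A) \<inter> space iid_env
        = prod_emb half_space (\<lambda>_. exp_law 1) J (\<Pi>\<^sub>E p\<in>J. (\<lambda>u. c p * u) -` A p)"
      using J measurable_space[OF meas]
      by (auto simp: prod_emb_def iid_env_def space_PiM PiE_iff comp subset_eq)
    then have "emeasure (distr iid_env (PiM half_space law) (stationary_weights \<rho>)) (prod_emb half_space law J (Pi\<^sub>E J A))
       = emeasure iid_env (prod_emb half_space (\<lambda>_. exp_law 1) J (\<Pi>\<^sub>E p\<in>J. (\<lambda>u. c p * u) -` A p))"
      using J A by (subst emeasure_distr[OF meas]) (auto intro!: sets_PiM_I)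
    also have "\<dots> = (\<Prod>p\<in>J. emeasure (exp_law 1) ((\<lambda>u. c p * u) -` A p))"
      unfolding iid_env_def
      using J A measurable_sets[OF meas_c] by (intro emeasure_PiM_emb) (auto intro: prob_space_exp_law)
    also have "\<dots> = (\<Prod>p\<in>J. emeasure (law p) (A p))"
      using A by (intro prod.cong) (auto simp: law emeasure_distr[OF meas_c])
    also have "\<dots> = emeasure (PiM half_space law) (prod_emb half_space law J (Pi\<^sub>E J A))"
      using J A prob by (intro emeasure_PiM_emb[symmetric]) auto
    finally show "emeasure (PiM half_space law) (prod_emb half_space law J (Pi\<^sub>E J A))
      = emeasure (distr iid_env (PiM half_space law) (stationary_weights \<rho>)) (prod_emb half_space law J (Pi\<^sub>E J A))" ..
  qed simp
  then show "stationary_env \<rho> = distr iid_env (stationary_env \<rho>) (stationary_weights \<rho>)" by (simp only: env)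
qed

definition stat_lpp :: "real \<Rightarrow> nat \<Rightarrow> (nat \<times> nat \<Rightarrow> real) \<Rightarrow> real" where
  "stat_lpp \<rho> n E = diag_lpp (1 / (1 - \<rho>)) (1 / \<rho>) E n"

lemma measurable_stat_lpp [measurable]: "stat_lpp \<rho> n \<in> borel_measurable iid_env"
  unfolding stat_lpp_def[abs_def] by measurable

lemma last_passage_stationary_weights:
  "last_passage (stationary_weights \<rho> E) (0, 0) (n, n) = stat_lpp \<rho> n E"
  unfolding last_passage_eq_lpp[OF order_refl] stat_lpp_def diag_lpp_def
  by (rule lpp_cong) (auto simp: stationary_weights_def half_space_def)

lemma measurable_last_passage_stationary_env:
  "(\<lambda>\<omega>. last_passage \<omega> (0, 0) (n, n)) \<in> borel_measurable (stationary_env \<rho>)"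
proof -
  have law: "sets (stationary_weight_law \<rho> p) = sets borel" for p
    by (cases p) (auto simp: stationary_weight_law_def)
  have comp: "(\<lambda>\<omega>. \<omega> p) \<in> borel_measurable (stationary_env \<rho>)" if "p \<in> half_space" for p
    using measurable_component_singleton[OF that, of "stationary_weight_law \<rho>"] law
    by (simp add: stationary_env_def cong: measurable_cong_sets)
  have "(\<lambda>\<omega>. lpp \<omega> i j) \<in> borel_measurable (stationary_env \<rho>)" if "j \<le> i" for i j
    using that
  proof (induction "\<lambda>_::nat\<times>nat. 0::real" i j rule: lpp.induct)
    case (2 i)
    then show ?case using comp[of "(Suc i, 0)"] by (simp add: half_space_def)
  next
    case (3 i j)
    then show ?case using comp[of "(Suc i, Suc j)"] by (cases "j < i") (simp_all add: half_space_def)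
  qed simp
  then show ?thesis by (simp add: last_passage_eq_lpp)
qed

text \<open>Both times are read in one environment, so that the covariance, and not only one-point
  laws, can be moved to \<open>iid_env\<close>.\<close>

lemma integral_stationary_env:
  fixes f :: "real \<Rightarrow> real \<Rightarrow> real"
  assumes \<rho>: "0 < \<rho>" "\<rho> < 1" and f: "(\<lambda>(a, b). f a b) \<in> borel_measurable (borel \<Otimes>\<^sub>M borel)"
  shows "(\<integral>\<omega>. f (last_passage \<omega> (0, 0) (m, m)) (last_passage \<omega> (0, 0) (n, n)) \<partial>stationary_env \<rho>)
    = (\<integral>E. f (stat_lpp \<rho> m E) (stat_lpp \<rho> n E) \<partial>iid_env)"
proof -
  have "(\<lambda>\<omega>. f (last_passage \<omega> (0, 0) (m, m)) (last_passage \<omega> (0, 0) (n, n))) \<in> borel_measurable (stationary_env \<rho>)"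
    using measurable_compose[OF measurable_Pair[OF measurable_last_passage_stationary_env measurable_last_passage_stationary_env] f]
    by simp
  then show ?thesis
    by (subst stationary_env_distr(1)[OF \<rho>], subst integral_distr[OF stationary_env_distr(2)[OF \<rho>]])
       (simp_all add: last_passage_stationary_weights)
qed

lemma (in prob_space) integrable_powers_of_fourth_moment:
  assumes X [measurable]: "X \<in> borel_measurable M"
    and fin: "(\<integral>\<^sup>+x. ennreal (X x ^ 4) \<partial>M) \<le> ennreal c"
  shows "integrable M (\<lambda>x. X x ^ 4)" "integrable M (\<lambda>x. (X x)\<^sup>2)" "integrable M X"
proof -
  show 4: "integrable M (\<lambda>x. X x ^ 4)"
    using fin by (intro integrableI_nonneg) (auto simp: le_less_trans[OF _ ennreal_less_top])
  have "integrable M (\<lambda>x. ((X x)\<^sup>2)\<^sup>2)" using 4 by simp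
  then show 2: "integrable M (\<lambda>x. (X x)\<^sup>2)" by (intro square_integrable_imp_integrable[of "\<lambda>x. (X x)\<^sup>2"]) auto
  show "integrable M X" by (rule square_integrable_imp_integrable[OF X 2])
qed

lemma integrable_stat_lpp:
  assumes "1 / 4 \<le> \<rho>" "\<rho> \<le> 3 / 4"
  shows "integrable iid_env (\<lambda>E. (stat_lpp \<rho> n E)\<^sup>2)" "integrable iid_env (stat_lpp \<rho> n)"
proof -
  interpret prob_space iid_env by (rule prob_space_iid_env)
  have fin: "envint (\<lambda>E. ennreal (centered_lpp \<rho> E n ^ 4)) \<le> ennreal (2 ^ 23 * (real n)\<^sup>2)"
    using fourth_moment_trivial[OF assms] by (simp add: fourth_moment_def)
  define m where "m = n * (1 / (1 - \<rho>) + 1 / \<rho>)"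
  note int = integrable_powers_of_fourth_moment[OF measurable_centered_lpp fin]
  have eq: "stat_lpp \<rho> n E = centered_lpp \<rho> E n + m" for E
    by (simp add: stat_lpp_def centered_lpp_def m_def)
  show "integrable iid_env (stat_lpp \<rho> n)" using int(3) by (simp add: eq[abs_def])
  have "(stat_lpp \<rho> n E)\<^sup>2 = (centered_lpp \<rho> E n)\<^sup>2 + 2 * m * centered_lpp \<rho> E n + m\<^sup>2" for E
    by (simp add: eq power2_eq_square algebra_simps)
  then show "integrable iid_env (\<lambda>E. (stat_lpp \<rho> n E)\<^sup>2)" using int by simp
qed

section \<open>Convergence of variances\<close>

text \<open>Weak convergence tests only bounded functions, so the fourth power is capped at
  \<open>k\<close>; the capped integrals inherit the bound and monotone convergence removes the
  cap.\<close>

lemma weak_limit_fourth_moment: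
  fixes Z :: "nat \<Rightarrow> 'a \<Rightarrow> real" and A :: "'b \<Rightarrow> real"
  assumes M: "prob_space M" and P: "prob_space P"
    and Z [measurable]: "\<And>N. Z N \<in> borel_measurable M" and A [measurable]: "A \<in> borel_measurable P"
    and fourth: "\<forall>\<^sub>F N in sequentially. (\<integral>\<^sup>+x. ennreal (Z N x ^ 4) \<partial>M) \<le> ennreal C" and C: "0 \<le> C"
    and weak: "\<And>g :: real \<Rightarrow> real. continuous_on UNIV g \<Longrightarrow> bounded (range g) \<Longrightarrow>
        (\<lambda>N. \<integral>x. g (Z N x) \<partial>M) \<longlonglongrightarrow> (\<integral>x. g (A x) \<partial>P)"
  shows "(\<integral>\<^sup>+x. ennreal (A x ^ 4) \<partial>P) \<le> ennreal C"
proof -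
  interpret M: prob_space M by fact
  interpret P: prob_space P by fact
  have trunc: "(\<integral>\<^sup>+x. ennreal (min (A x ^ 4) (real k)) \<partial>P) \<le> ennreal C" for k
  proof -
    let ?g = "\<lambda>z::real. min (z ^ 4) (real k)"
    have lim: "(\<lambda>N. \<integral>x. ?g (Z N x) \<partial>M) \<longlonglongrightarrow> (\<integral>x. ?g (A x) \<partial>P)"
    proof (rule weak[where g = ?g])
      show "continuous_on UNIV ?g" by (intro continuous_intros)
      show "bounded (range ?g)" by (rule boundedI[of _ "real k"]) auto
    qed
    have "\<forall>\<^sub>F N in sequentially. (\<integral>x. ?g (Z N x) \<partial>M) \<le> C"
      using fourth
    proof eventually_elim
      case (elim N)
      have "ennreal (\<integral>x. ?g (Z N x) \<partial>M) = (\<integral>\<^sup>+x. ennreal (?g (Z N x)) \<partial>M)"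
        by (intro nn_integral_eq_integral[symmetric] M.integrable_const_bound[where B = "real k"]) auto
      also have "\<dots> \<le> (\<integral>\<^sup>+x. ennreal (Z N x ^ 4) \<partial>M)" by (intro nn_integral_mono ennreal_leI) auto
      also have "\<dots> \<le> ennreal C" by fact
      finally show ?case using C by simp
    qed
    then have "(\<integral>x. ?g (A x) \<partial>P) \<le> C" by (rule tendsto_upperbound[OF lim]) simp
    moreover have "(\<integral>\<^sup>+x. ennreal (?g (A x)) \<partial>P) = ennreal (\<integral>x. ?g (A x) \<partial>P)"
      by (intro nn_integral_eq_integral P.integrable_const_bound[where B = "real k"]) auto
    ultimately show ?thesis by (simp add: ennreal_leI)
  qed
  have sup_eq: "ennreal a = (SUP k. ennreal (min a (real k)))" if "0 \<le> a" for a
  proof (rule antisym)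
    obtain k where "a \<le> real k" using real_arch_simple by blast
    then show "ennreal a \<le> (SUP k. ennreal (min a (real k)))"
      by (intro SUP_upper2[of k]) (auto simp: min_def)
    show "(SUP k. ennreal (min a (real k))) \<le> ennreal a" by (intro SUP_least ennreal_leI) auto
  qed
  have "(\<integral>\<^sup>+x. ennreal (A x ^ 4) \<partial>P) = (\<integral>\<^sup>+x. (SUP k. ennreal (min (A x ^ 4) (real k))) \<partial>P)"
    by (intro nn_integral_cong sup_eq) simp
  also have "\<dots> = (SUP k. \<integral>\<^sup>+x. ennreal (min (A x ^ 4) (real k)) \<partial>P)"
    by (rule nn_integral_monotone_convergence_SUP)
       (auto simp: incseq_def le_fun_def intro!: ennreal_leI min.mono)
  also have "\<dots> \<le> ennreal C" by (rule SUP_least) (rule trunc)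
  finally show ?thesis .
qed

text \<open>Replacing \<open>\<phi>\<close> by the bounded continuous \<open>g K\<close> costs at
  most \<open>C / K\<close> by the fourth moment bound, both eventually along the sequence and for
  the limit; \<open>g K\<close> itself is covered by weak convergence.\<close>

lemma weak_limit_integral:
  fixes Z :: "nat \<Rightarrow> 'a \<Rightarrow> real" and A :: "'b \<Rightarrow> real" and \<phi> :: "real \<Rightarrow> real" and g :: "real \<Rightarrow> real \<Rightarrow> real"
  assumes M: "prob_space M" and P: "prob_space P"
    and Z [measurable]: "\<And>N. Z N \<in> borel_measurable M" and A [measurable]: "A \<in> borel_measurable P"
    and fourth: "\<forall>\<^sub>F N in sequentially. (\<integral>\<^sup>+x. ennreal (Z N x ^ 4) \<partial>M) \<le> ennreal C" and C: "0 \<le> C"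
    and weak: "\<And>g :: real \<Rightarrow> real. continuous_on UNIV g \<Longrightarrow> bounded (range g) \<Longrightarrow>
        (\<lambda>N. \<integral>x. g (Z N x) \<partial>M) \<longlonglongrightarrow> (\<integral>x. g (A x) \<partial>P)"
    and \<phi> [measurable]: "\<phi> \<in> borel_measurable borel"
    and g: "\<And>K. 1 \<le> K \<Longrightarrow> continuous_on UNIV (g K)" "\<And>K z. 1 \<le> K \<Longrightarrow> \<bar>g K z\<bar> \<le> K"
    and approx: "\<And>K z. 1 \<le> K \<Longrightarrow> \<bar>\<phi> z - g K z\<bar> \<le> z ^ 4 / K"
  shows "(\<lambda>N. \<integral>x. \<phi> (Z N x) \<partial>M) \<longlonglongrightarrow> (\<integral>x. \<phi> (A x) \<partial>P)"
proof -
  have diff: "\<bar>(\<integral>x. \<phi> (X x) \<partial>Q) - (\<integral>x. g K (X x) \<partial>Q)\<bar> \<le> C / K"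
    if Q: "prob_space Q" and X [measurable]: "X \<in> borel_measurable Q"
      and fin: "(\<integral>\<^sup>+x. ennreal (X x ^ 4) \<partial>Q) \<le> ennreal C" and K: "1 \<le> K"
    for Q :: "'c measure" and X K
  proof -
    interpret Q: prob_space Q by fact
    note int4 = Q.integrable_powers_of_fourth_moment(1)[OF X fin]
    have [measurable]: "g K \<in> borel_measurable borel" by (rule borel_measurable_continuous_onI[OF g(1)[OF K]])
    have intg: "integrable Q (\<lambda>x. g K (X x))"
      by (rule Q.integrable_const_bound[where B = K]) (use g(2)[OF K] in auto)
    have intd: "integrable Q (\<lambda>x. \<phi> (X x) - g K (X x))"
      by (rule Bochner_Integration.integrable_bound[of Q "\<lambda>x. X x ^ 4 / K"]) (use int4 approx[OF K] K in auto)
    have "integrable Q (\<lambda>x. \<phi> (X x))" using Bochner_Integration.integrable_add[OF intd intg] by simp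
    then have "(\<integral>x. \<phi> (X x) \<partial>Q) - (\<integral>x. g K (X x) \<partial>Q) = (\<integral>x. \<phi> (X x) - g K (X x) \<partial>Q)"
      using intg by simp
    also have "\<bar>\<dots>\<bar> \<le> (\<integral>x. \<bar>\<phi> (X x) - g K (X x)\<bar> \<partial>Q)" by (rule integral_abs_bound)
    also have "\<dots> \<le> (\<integral>x. X x ^ 4 / K \<partial>Q)"
      by (rule integral_mono[OF integrable_abs[OF intd]]) (use int4 approx[OF K] in auto)
    also have "\<dots> = (\<integral>x. X x ^ 4 \<partial>Q) / K" by simp
    also have "\<dots> \<le> C / K"
    proof (rule divide_right_mono)
      have "ennreal (\<integral>x. X x ^ 4 \<partial>Q) = (\<integral>\<^sup>+x. ennreal (X x ^ 4) \<partial>Q)"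
        by (rule nn_integral_eq_integral[symmetric]) (use int4 in auto)
      then show "(\<integral>x. X x ^ 4 \<partial>Q) \<le> C" using fin C by (metis ennreal_le_iff)
    qed (use K in simp)
    finally show ?thesis .
  qed
  have A4: "(\<integral>\<^sup>+x. ennreal (A x ^ 4) \<partial>P) \<le> ennreal C"
    by (rule weak_limit_fourth_moment[OF M P Z A fourth C weak])
  show ?thesis
  proof (rule LIMSEQ_I)
    fix r :: real assume r: "0 < r"
    define K where "K = max 1 (4 * C / r)"
    have K: "1 \<le> K" "C / K \<le> r / 4"
    proof -
      show "1 \<le> K" by (simp add: K_def)
      have "4 * C / r \<le> K" by (simp add: K_def)
      then show "C / K \<le> r / 4" using r \<open>1 \<le> K\<close> by (simp add: field_simps)
    qed
    have "(\<lambda>N. \<integral>x. g K (Z N x) \<partial>M) \<longlonglongrightarrow> (\<integral>x. g K (A x) \<partial>P)"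
      by (rule weak[OF g(1)[OF K(1)]]) (rule boundedI[of _ K], use g(2)[OF K(1)] in auto)
    then have "\<forall>\<^sub>F N in sequentially. dist (\<integral>x. g K (Z N x) \<partial>M) (\<integral>x. g K (A x) \<partial>P) < r / 4"
      by (rule tendstoD) (use r in simp)
    then have "\<forall>\<^sub>F N in sequentially. norm ((\<integral>x. \<phi> (Z N x) \<partial>M) - (\<integral>x. \<phi> (A x) \<partial>P)) < r"
      using fourth
    proof eventually_elim
      case (elim N)
      have "\<bar>(\<integral>x. \<phi> (Z N x) \<partial>M) - (\<integral>x. g K (Z N x) \<partial>M)\<bar> \<le> r / 4"
        using diff[OF M Z elim(2) K(1)] K(2) by linarith
      moreover have "\<bar>(\<integral>x. \<phi> (A x) \<partial>P) - (\<integral>x. g K (A x) \<partial>P)\<bar> \<le> r / 4"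
        using diff[OF P A A4 K(1)] K(2) by linarith
      ultimately show ?case using elim(1) r unfolding dist_real_def real_norm_def by linarith
    qed
    then show "\<exists>no. \<forall>N\<ge>no. norm ((\<integral>x. \<phi> (Z N x) \<partial>M) - (\<integral>x. \<phi> (A x) \<partial>P)) < r"
      by (simp add: eventually_sequentially)
  qed
qed

lemma weak_limit_variance:
  fixes Z :: "nat \<Rightarrow> 'a \<Rightarrow> real" and A :: "'b \<Rightarrow> real"
  assumes M: "prob_space M" and P: "prob_space P"
    and Z [measurable]: "\<And>N. Z N \<in> borel_measurable M" and A [measurable]: "A \<in> borel_measurable P"
    and fourth: "\<forall>\<^sub>F N in sequentially. (\<integral>\<^sup>+x. ennreal (Z N x ^ 4) \<partial>M) \<le> ennreal C" and C: "0 \<le> C"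
    and weak: "\<And>g :: real \<Rightarrow> real. continuous_on UNIV g \<Longrightarrow> bounded (range g) \<Longrightarrow>
        (\<lambda>N. \<integral>x. g (Z N x) \<partial>M) \<longlonglongrightarrow> (\<integral>x. g (A x) \<partial>P)"
  shows "(\<lambda>N. prob_space.variance M (Z N)) \<longlonglongrightarrow> prob_space.variance P A"
proof -
  interpret M: prob_space M by fact
  interpret P: prob_space P by fact
  have "(\<lambda>N. \<integral>x. Z N x \<partial>M) \<longlonglongrightarrow> (\<integral>x. A x \<partial>P)"
  proof (rule weak_limit_integral[OF M P Z A fourth C weak, where \<phi> = "\<lambda>z. z" and g = "\<lambda>K z. max (- K) (min z K)"])
    fix K z :: real assume K: "1 \<le> K"
    show "\<bar>z - max (- K) (min z K)\<bar> \<le> z ^ 4 / K"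
    proof (cases "\<bar>z\<bar> \<le> K")
      case False
      then have "1 \<le> \<bar>z\<bar>" using K by simp
      then have "\<bar>z\<bar>\<^sup>2 * 1 \<le> \<bar>z\<bar>\<^sup>2 * \<bar>z\<bar>\<^sup>2" by (intro mult_left_mono one_le_power) auto
      moreover have "K * \<bar>z\<bar> \<le> \<bar>z\<bar>\<^sup>2" using False unfolding power2_eq_square by (intro mult_right_mono) auto
      ultimately have "K * \<bar>z\<bar> \<le> z ^ 4" by (simp add: power4_eq_xxxx power2_eq_square mult.assoc)
      then have "\<bar>z\<bar> \<le> z ^ 4 / K" using K by (simp add: pos_le_divide_eq mult.commute)
      moreover have "\<bar>z - max (- K) (min z K)\<bar> \<le> \<bar>z\<bar>" using False K by (auto simp: max_def min_def)
      ultimately show ?thesis by linarith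
    qed (use K in \<open>auto simp: abs_le_iff\<close>)
  qed (auto intro!: continuous_intros)
  moreover have "(\<lambda>N. \<integral>x. (Z N x)\<^sup>2 \<partial>M) \<longlonglongrightarrow> (\<integral>x. (A x)\<^sup>2 \<partial>P)"
  proof (rule weak_limit_integral[OF M P Z A fourth C weak, where \<phi> = "\<lambda>z. z\<^sup>2" and g = "\<lambda>K z. min (z\<^sup>2) K"])
    fix K z :: real assume K: "1 \<le> K"
    show "\<bar>z\<^sup>2 - min (z\<^sup>2) K\<bar> \<le> z ^ 4 / K"
    proof (cases "z\<^sup>2 \<le> K")
      case False
      then have "K * z\<^sup>2 \<le> z\<^sup>2 * z\<^sup>2" by (intro mult_right_mono) auto
      then have "z\<^sup>2 \<le> z ^ 4 / K" using K by (simp add: pos_le_divide_eq mult.commute flip: power_add)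
      then show ?thesis using False K by (auto simp: min_def)
    qed (use K in auto)
  qed (auto intro!: continuous_intros)
  ultimately have lim: "(\<lambda>N. (\<integral>x. (Z N x)\<^sup>2 \<partial>M) - (\<integral>x. Z N x \<partial>M)\<^sup>2) \<longlonglongrightarrow> (\<integral>x. (A x)\<^sup>2 \<partial>P) - (\<integral>x. A x \<partial>P)\<^sup>2"
    by (intro tendsto_intros)
  have "P.variance A = (\<integral>x. (A x)\<^sup>2 \<partial>P) - (\<integral>x. A x \<partial>P)\<^sup>2"
    using P.integrable_powers_of_fourth_moment[OF A weak_limit_fourth_moment[OF M P Z A fourth C weak]]
    by (intro P.variance_eq) auto
  moreover have "\<forall>\<^sub>F N in sequentially. (\<integral>x. (Z N x)\<^sup>2 \<partial>M) - (\<integral>x. Z N x \<partial>M)\<^sup>2 = M.variance (Z N)"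
    using fourth
  proof eventually_elim
    case (elim N)
    show ?case using M.integrable_powers_of_fourth_moment[OF Z elim] by (intro M.variance_eq[symmetric]) auto
  qed
  ultimately show ?thesis using lim by (simp add: tendsto_cong)
qed

section \<open>Variances of affine images, differences and small perturbations\<close>

lemma (in prob_space) variance_affine:
  fixes X :: "'a \<Rightarrow> real"
  assumes "integrable M X"
  shows "variance (\<lambda>x. (X x - a) / c) = variance X / c\<^sup>2"
proof -
  have "((X x - a) / c - expectation (\<lambda>x. (X x - a) / c))\<^sup>2 = (X x - expectation X)\<^sup>2 / c\<^sup>2" for x
    using assms by (simp add: prob_space diff_divide_distrib[symmetric] power_divide)
  then show ?thesis by simp
qed

lemma (in prob_space) integrable_mult_of_squares:
  fixes X Y :: "'a \<Rightarrow> real"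
  assumes [measurable]: "X \<in> borel_measurable M" "Y \<in> borel_measurable M"
    and "integrable M (\<lambda>x. (X x)\<^sup>2)" "integrable M (\<lambda>x. (Y x)\<^sup>2)"
  shows "integrable M (\<lambda>x. X x * Y x)"
proof (rule Bochner_Integration.integrable_bound[of M "\<lambda>x. (X x)\<^sup>2 + (Y x)\<^sup>2"])
  show "AE x in M. norm (X x * Y x) \<le> norm ((X x)\<^sup>2 + (Y x)\<^sup>2)"
  proof (rule AE_I2)
    fix x
    have "2 * \<bar>X x\<bar> * \<bar>Y x\<bar> \<le> \<bar>X x\<bar>\<^sup>2 + \<bar>Y x\<bar>\<^sup>2" by (rule sum_squares_bound)
    moreover have "0 \<le> \<bar>X x\<bar> * \<bar>Y x\<bar>" by simp
    ultimately have "\<bar>X x\<bar> * \<bar>Y x\<bar> \<le> (X x)\<^sup>2 + (Y x)\<^sup>2" unfolding power2_abs mult.assoc by linarith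
    then show "norm (X x * Y x) \<le> norm ((X x)\<^sup>2 + (Y x)\<^sup>2)" by (simp add: abs_mult)
  qed
qed (use assms in auto)

lemma (in prob_space) covariance_polarization:
  fixes X Y :: "'a \<Rightarrow> real"
  assumes [measurable]: "X \<in> borel_measurable M" "Y \<in> borel_measurable M"
    and X: "integrable M (\<lambda>x. (X x)\<^sup>2)" and Y: "integrable M (\<lambda>x. (Y x)\<^sup>2)"
  shows "2 * covariance M X Y = variance X + variance Y - variance (\<lambda>x. X x - Y x)"
proof -
  have iX: "integrable M X" and iY: "integrable M Y"
    using X Y by (auto intro: square_integrable_imp_integrable)
  define u where "u x = X x - expectation X" for x
  define v where "v x = Y x - expectation Y" for x
  have [measurable]: "u \<in> borel_measurable M" "v \<in> borel_measurable M" unfolding u_def v_def by measurable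
  have u2: "integrable M (\<lambda>x. (u x)\<^sup>2)" and v2: "integrable M (\<lambda>x. (v x)\<^sup>2)"
    using X Y iX iY by (simp_all add: u_def v_def power2_diff)
  have uv: "integrable M (\<lambda>x. u x * v x)" by (rule integrable_mult_of_squares[OF _ _ u2 v2]) auto
  have "variance (\<lambda>x. X x - Y x) = expectation (\<lambda>x. (u x)\<^sup>2 + (v x)\<^sup>2 - 2 * (u x * v x))"
    using iX iY by (intro Bochner_Integration.integral_cong) (auto simp: u_def v_def power2_eq_square algebra_simps)
  also have "\<dots> = expectation (\<lambda>x. (u x)\<^sup>2) + expectation (\<lambda>x. (v x)\<^sup>2) - 2 * expectation (\<lambda>x. u x * v x)"
    using u2 v2 uv by simp
  finally show ?thesis by (simp add: u_def v_def covariance_def)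
qed

text \<open>The cross term is controlled by \<open>2 * \<bar>u * w\<bar> \<le> \<eta> * u\<^sup>2 +
  w\<^sup>2 / \<eta>\<close>, with a weight that tends to 0 more slowly than the second moment of
  the perturbation.\<close>

lemma (in prob_space) variance_perturbation:
  fixes U D :: "nat \<Rightarrow> 'a \<Rightarrow> real"
  assumes [measurable]: "\<And>N. U N \<in> borel_measurable M" "\<And>N. D N \<in> borel_measurable M"
    and U: "\<forall>\<^sub>F N in sequentially. integrable M (\<lambda>x. (U N x)\<^sup>2)"
    and D: "\<forall>\<^sub>F N in sequentially. integrable M (\<lambda>x. (D N x)\<^sup>2) \<and> expectation (\<lambda>x. (D N x)\<^sup>2) \<le> d N"
    and lim: "(\<lambda>N. variance (U N)) \<longlonglongrightarrow> v" and d: "d \<longlonglongrightarrow> 0"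
  shows "(\<lambda>N. variance (\<lambda>x. U N x + D N x)) \<longlonglongrightarrow> v"
proof -
  \<comment> \<open>The size \<open>sqrt \<bar>d N\<bar>\<close> makes \<open>d N / \<eta> N\<close>
    vanish in the limit; the summand \<open>1 / Suc N\<close> keeps the weight positive when
    \<open>d N = 0\<close>.\<close>
  define \<eta> where "\<eta> N = sqrt \<bar>d N\<bar> + 1 / real (Suc N)" for N
  have \<eta>: "0 < \<eta> N" for N by (simp add: \<eta>_def add_nonneg_pos)
  have "(\<lambda>N. sqrt \<bar>d N\<bar> + 1 / real (Suc N)) \<longlonglongrightarrow> sqrt \<bar>0\<bar> + 0"
    by (intro tendsto_intros d LIMSEQ_Suc lim_1_over_n[THEN LIMSEQ_Suc])
  then have \<eta>0: "\<eta> \<longlonglongrightarrow> 0" by (simp add: \<eta>_def[abs_def])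
  have bound: "\<forall>\<^sub>F N in sequentially. norm (variance (\<lambda>x. U N x + D N x) - variance (U N))
      \<le> \<bar>d N\<bar> + (\<eta> N * variance (U N) + sqrt \<bar>d N\<bar>)"
    using U D
  proof eventually_elim
    case (elim N)
    have iU: "integrable M (U N)" and iD: "integrable M (D N)"
      using elim by (auto intro: square_integrable_imp_integrable)
    define u where "u x = U N x - expectation (U N)" for x
    define w where "w x = D N x - expectation (D N)" for x
    have [measurable]: "u \<in> borel_measurable M" "w \<in> borel_measurable M" unfolding u_def w_def by measurable
    have u2: "integrable M (\<lambda>x. (u x)\<^sup>2)" and w2: "integrable M (\<lambda>x. (w x)\<^sup>2)"
      using elim iU iD by (simp_all add: u_def w_def power2_diff)
    have uw: "integrable M (\<lambda>x. u x * w x)" by (rule integrable_mult_of_squares[OF _ _ u2 w2]) auto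
    have w_le: "expectation (\<lambda>x. (w x)\<^sup>2) \<le> d N"
      using variance_eq[of "D N"] elim iD by (simp add: w_def) (smt (verit) zero_le_power2)
    have w_nonneg: "0 \<le> expectation (\<lambda>x. (w x)\<^sup>2)" by simp
    have "variance (\<lambda>x. U N x + D N x) = expectation (\<lambda>x. (u x)\<^sup>2 + (w x)\<^sup>2 + 2 * (u x * w x))"
      using iU iD by (intro Bochner_Integration.integral_cong) (auto simp: u_def w_def power2_eq_square algebra_simps)
    also have "\<dots> = variance (U N) + expectation (\<lambda>x. (w x)\<^sup>2) + expectation (\<lambda>x. 2 * (u x * w x))"
      using u2 w2 uw by (simp add: u_def)
    finally have eq: "variance (\<lambda>x. U N x + D N x) - variance (U N)
        = expectation (\<lambda>x. (w x)\<^sup>2) + expectation (\<lambda>x. 2 * (u x * w x))" by simp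
    have pw: "\<bar>2 * (u x * w x)\<bar> \<le> \<eta> N * (u x)\<^sup>2 + (w x)\<^sup>2 / \<eta> N" for x
    proof -
      have "2 * (sqrt (\<eta> N) * \<bar>u x\<bar>) * (\<bar>w x\<bar> / sqrt (\<eta> N)) \<le> (sqrt (\<eta> N) * \<bar>u x\<bar>)\<^sup>2 + (\<bar>w x\<bar> / sqrt (\<eta> N))\<^sup>2"
        by (rule sum_squares_bound)
      then show ?thesis using \<eta>[of N] by (simp add: power_mult_distrib power_divide abs_mult)
    qed
    have "\<bar>expectation (\<lambda>x. 2 * (u x * w x))\<bar> \<le> expectation (\<lambda>x. \<eta> N * (u x)\<^sup>2 + (w x)\<^sup>2 / \<eta> N)"
      by (rule order_trans[OF integral_abs_bound integral_mono[OF integrable_abs]]) (use pw u2 w2 uw in auto)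
    also have "\<dots> = \<eta> N * variance (U N) + expectation (\<lambda>x. (w x)\<^sup>2) / \<eta> N"
      using u2 w2 by (simp add: u_def)
    also have "expectation (\<lambda>x. (w x)\<^sup>2) / \<eta> N \<le> sqrt \<bar>d N\<bar>"
    proof -
      have "expectation (\<lambda>x. (w x)\<^sup>2) \<le> sqrt \<bar>d N\<bar> * sqrt \<bar>d N\<bar>" using w_le by simp
      also have "\<dots> \<le> sqrt \<bar>d N\<bar> * \<eta> N" by (intro mult_left_mono) (auto simp: \<eta>_def)
      finally show ?thesis using \<eta>[of N] by (simp add: pos_divide_le_eq)
    qed
    finally have "\<bar>expectation (\<lambda>x. 2 * (u x * w x))\<bar> \<le> \<eta> N * variance (U N) + sqrt \<bar>d N\<bar>" by simp
    then show ?case unfolding eq real_norm_def using w_le w_nonneg by linarith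
  qed
  have "(\<lambda>N. \<bar>d N\<bar> + (\<eta> N * variance (U N) + sqrt \<bar>d N\<bar>)) \<longlonglongrightarrow> \<bar>0\<bar> + (0 * v + sqrt \<bar>0\<bar>)"
    by (intro tendsto_intros d \<eta>0 lim)
  then have "(\<lambda>N. \<bar>d N\<bar> + (\<eta> N * variance (U N) + sqrt \<bar>d N\<bar>)) \<longlonglongrightarrow> 0" by simp
  then have "(\<lambda>N. variance (\<lambda>x. U N x + D N x) - variance (U N)) \<longlonglongrightarrow> 0"
    by (rule Lim_null_comparison[OF bound])
  from tendsto_add[OF this lim] show ?thesis by simp
qed

section \<open>Critical scaling and the covariance\<close>

lemma rho_crit_tendsto: "(\<lambda>N. rho_crit d N) \<longlonglongrightarrow> 1 / 2"
proof -
  have "(\<lambda>N. real N powr (- (1 / 3))) \<longlonglongrightarrow> 0"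
    by (rule tendsto_neg_powr) (auto intro: filterlim_real_sequentially)
  then have "(\<lambda>N. 1 / 2 + d * 2 powr (- (4 / 3)) * real N powr (- (1 / 3))) \<longlonglongrightarrow> 1 / 2 + d * 2 powr (- (4 / 3)) * 0"
    by (intro tendsto_intros)
  then show ?thesis by (simp add: rho_crit_def)
qed

lemma eventually_rho_crit: "\<forall>\<^sub>F N in sequentially. 1 / 4 \<le> rho_crit d N \<and> rho_crit d N \<le> 3 / 4"
proof -
  have "\<forall>\<^sub>F N in sequentially. dist (rho_crit d N) (1 / 2) < 1 / 4"
    by (rule tendstoD[OF rho_crit_tendsto]) simp
  then show ?thesis
    by eventually_elim (simp add: dist_real_def abs_if split: if_splits)
qed

definition height_scale :: "nat \<Rightarrow> real" where
  "height_scale N = 2 powr (4 / 3) * real N powr (1 / 3)"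

lemma height_scale_pos: "1 \<le> N \<Longrightarrow> 0 < height_scale N"
  by (simp add: height_scale_def)

text \<open>In the critical window \<open>N * \<bar>\<rho> - 1/2\<bar>\<close> is of order at most
  \<open>N powr (2/3)\<close>, so \<open>fluct_scale\<close> reduces to the order
  \<open>N powr (1/3)\<close>.\<close>

lemma fluct_scale_rho_crit:
  assumes "1 \<le> N"
  shows "fluct_scale (rho_crit d N) N \<le> (1 + sqrt \<bar>d\<bar>) * real N powr (1 / 3)"
proof -
  have c: "2 powr (- (4 / 3)) \<le> (1::real)" using powr_mono[of "- (4 / 3)" 0 "2::real"] by simp
  have "real N * \<bar>rho_crit d N - 1 / 2\<bar> = \<bar>d\<bar> * 2 powr (- (4 / 3)) * (real N powr 1 * real N powr (- (1 / 3)))"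
    using assms by (simp add: rho_crit_def abs_mult)
  also have "real N powr 1 * real N powr (- (1 / 3)) = (real N powr (1 / 3))\<^sup>2"
    by (simp only: powr_add[symmetric] power2_eq_square) simp
  also have "\<bar>d\<bar> * 2 powr (- (4 / 3)) * (real N powr (1 / 3))\<^sup>2 \<le> \<bar>d\<bar> * 1 * (real N powr (1 / 3))\<^sup>2"
    using c by (intro mult_right_mono mult_left_mono) auto
  finally have "sqrt (real N * \<bar>rho_crit d N - 1 / 2\<bar>) \<le> sqrt (\<bar>d\<bar> * 1 * (real N powr (1 / 3))\<^sup>2)"
    by (rule real_sqrt_le_mono)
  also have "\<dots> = sqrt \<bar>d\<bar> * real N powr (1 / 3)" by (simp add: real_sqrt_mult)
  finally show ?thesis by (simp add: fluct_scale_def algebra_simps)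
qed

text \<open>The limit is centred at \<open>4 * N\<close>, the moment bound at the exact mean. They
  differ by \<open>N\<close> times a term quadratic in \<open>\<rho> - 1/2\<close>, which in the
  critical window is at most of the size of the fluctuations.\<close>

lemma stationary_mean_gap:
  fixes \<rho> :: real
  assumes "1 / 4 \<le> \<rho>" "\<rho> \<le> 3 / 4"
  shows "\<bar>1 / (1 - \<rho>) + 1 / \<rho> - 4\<bar> \<le> 22 * (\<rho> - 1 / 2)\<^sup>2"
proof -
  note p = parameter_product_lower[OF assms]
  have "1 / (1 - \<rho>) + 1 / \<rho> = 1 / (\<rho> * (1 - \<rho>))" using assms by (simp add: field_simps)
  then have "1 / (1 - \<rho>) + 1 / \<rho> - 4 = (1 - 4 * (\<rho> * (1 - \<rho>))) / (\<rho> * (1 - \<rho>))"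
  proof -
    have "1 / q - 4 = (1 - 4 * q) / q" if "q \<noteq> 0" for q :: real
      using that by (simp add: diff_divide_distrib)
    moreover have "\<rho> * (1 - \<rho>) \<noteq> 0" using assms by simp
    ultimately show ?thesis
      using \<open>1 / (1 - \<rho>) + 1 / \<rho> = 1 / (\<rho> * (1 - \<rho>))\<close> by (simp only:)
  qed
  also have "1 - 4 * (\<rho> * (1 - \<rho>)) = 4 * (\<rho> - 1 / 2)\<^sup>2" by (simp add: power2_eq_square algebra_simps)
  finally have eq: "1 / (1 - \<rho>) + 1 / \<rho> - 4 = 4 * (\<rho> - 1 / 2)\<^sup>2 / (\<rho> * (1 - \<rho>))" .
  have "4 * (\<rho> - 1 / 2)\<^sup>2 / (\<rho> * (1 - \<rho>)) \<le> 4 * (\<rho> - 1 / 2)\<^sup>2 / (3 / 16)"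
    using p by (intro divide_left_mono) auto
  also have "\<dots> \<le> 22 * (\<rho> - 1 / 2)\<^sup>2" by simp
  finally show ?thesis unfolding eq using p by simp
qed

lemma rescaled_fourth_moment:
  obtains C where "0 \<le> C"
    "\<forall>\<^sub>F N in sequentially. envint (\<lambda>E. ennreal (((stat_lpp (rho_crit d N) N E - 4 * real N) / height_scale N) ^ 4)) \<le> ennreal C"
proof -
  interpret prob_space iid_env by (rule prob_space_iid_env)
  obtain C where C: "0 \<le> C"
    "\<And>\<rho> N. 1 / 4 \<le> \<rho> \<Longrightarrow> \<rho> \<le> 3 / 4 \<Longrightarrow> fourth_moment \<rho> N \<le> ennreal (C * fluct_scale \<rho> N ^ 4)"
    using uniform_fourth_moment by blast
  define C' where "C' = 8 * (C * (1 + sqrt \<bar>d\<bar>) ^ 4) + 8 * (22 * d\<^sup>2) ^ 4 * 1"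
  have "0 \<le> C'" using C(1) by (simp add: C'_def)
  moreover have "\<forall>\<^sub>F N in sequentially. envint (\<lambda>E. ennreal (((stat_lpp (rho_crit d N) N E - 4 * real N) / height_scale N) ^ 4)) \<le> ennreal C'"
    using eventually_rho_crit[of d] eventually_ge_at_top[of 1]
  proof eventually_elim
    case (elim N)
    define \<rho> where "\<rho> = rho_crit d N"
    define n3 where "n3 = real N powr (1 / 3)"
    have n3: "0 < n3" "n3 ^ 3 = real N" using elim by (auto simp: n3_def powr_realpow[symmetric] powr_powr)
    have hs: "n3 \<le> height_scale N"
    proof -
      have "1 \<le> (2::real) powr (4 / 3)" by (intro ge_one_powr_ge_zero) auto
      then show ?thesis using n3(1) by (simp add: height_scale_def flip: n3_def)
    qed
    have \<rho>: "1 / 4 \<le> \<rho>" "\<rho> \<le> 3 / 4" using elim by (auto simp: \<rho>_def)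
    define g where "g = 1 / (1 - \<rho>) + 1 / \<rho> - 4"
    have g: "\<bar>real N * g\<bar> \<le> 22 * d\<^sup>2 * n3"
    proof -
      have "real N powr (- (1 / 3)) = 1 / n3" by (simp add: n3_def powr_minus_divide)
      then have "(\<rho> - 1 / 2)\<^sup>2 = d\<^sup>2 * (2 powr (- (4 / 3)))\<^sup>2 / n3\<^sup>2"
        by (simp add: \<rho>_def rho_crit_def power_mult_distrib power_divide)
      also have "\<dots> \<le> d\<^sup>2 * 1 / n3\<^sup>2"
        using powr_mono[of "- (4 / 3)" 0 "2::real"]
        by (intro divide_right_mono mult_left_mono) (auto intro: power_le_one)
      finally have "\<bar>g\<bar> \<le> 22 * (d\<^sup>2 / n3\<^sup>2)" using stationary_mean_gap[OF \<rho>] by (simp add: g_def)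
      then have "\<bar>real N * g\<bar> \<le> n3 ^ 3 * (22 * (d\<^sup>2 / n3\<^sup>2))"
        unfolding abs_mult n3(2)[symmetric] using n3(1) by (intro mult_mono) auto
      also have "\<dots> = 22 * d\<^sup>2 * n3" using n3(1) by (simp add: power2_eq_square power3_eq_cube)
      finally show ?thesis .
    qed
    have pw: "((stat_lpp \<rho> N E - 4 * real N) / height_scale N) ^ 4 \<le> 8 / n3 ^ 4 * centered_lpp \<rho> E N ^ 4 + 8 * (22 * d\<^sup>2) ^ 4 * 1" for E
    proof -
      have "stat_lpp \<rho> N E - 4 * real N = centered_lpp \<rho> E N + real N * g"
        by (simp add: stat_lpp_def centered_lpp_def g_def algebra_simps)
      then have "((stat_lpp \<rho> N E - 4 * real N) / height_scale N) ^ 4 \<le> 8 * (centered_lpp \<rho> E N ^ 4 + (real N * g) ^ 4) / height_scale N ^ 4"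
        using pow4_sum_le2[of "centered_lpp \<rho> E N" "real N * g"] by (simp add: power_divide divide_right_mono)
      also have "\<dots> \<le> 8 * (centered_lpp \<rho> E N ^ 4 + (real N * g) ^ 4) / n3 ^ 4"
        using hs n3 by (intro divide_left_mono power_mono) (auto intro: mult_pos_pos)
      also have "(real N * g) ^ 4 \<le> (22 * d\<^sup>2 * n3) ^ 4"
        using power_mono[OF g, of 4] by simp
      then have "8 * (centered_lpp \<rho> E N ^ 4 + (real N * g) ^ 4) / n3 ^ 4 \<le> 8 * (centered_lpp \<rho> E N ^ 4 + (22 * d\<^sup>2 * n3) ^ 4) / n3 ^ 4"
        using n3 by (intro divide_right_mono) auto
      also have "\<dots> = 8 / n3 ^ 4 * centered_lpp \<rho> E N ^ 4 + 8 * (22 * d\<^sup>2) ^ 4 * 1"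
        using n3 by (simp add: power_mult_distrib distrib_left add_divide_distrib)
      finally show ?thesis .
    qed
    have "envint (\<lambda>E. ennreal (((stat_lpp \<rho> N E - 4 * real N) / height_scale N) ^ 4))
       \<le> ennreal (8 / n3 ^ 4 * (C * fluct_scale \<rho> N ^ 4) + 8 * (22 * d\<^sup>2) ^ 4 * 1)"
      by (rule nn_integral_lincomb_le[OF _ _ _ _ _ _ _ _ _ _ pw])
         (use C(1) C(2)[OF \<rho>, of N] n3 in \<open>auto simp: fourth_moment_def emeasure_space_1\<close>)
    also have "\<dots> \<le> ennreal C'"
    proof (rule ennreal_leI)
      have "fluct_scale \<rho> N ^ 4 \<le> ((1 + sqrt \<bar>d\<bar>) * n3) ^ 4"
        unfolding \<rho>_def n3_def by (intro power_mono fluct_scale_rho_crit fluct_scale_nonneg elim)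
      then have "8 / n3 ^ 4 * (C * fluct_scale \<rho> N ^ 4) \<le> 8 / n3 ^ 4 * (C * ((1 + sqrt \<bar>d\<bar>) * n3) ^ 4)"
        using C(1) n3 by (intro mult_left_mono) auto
      also have "\<dots> = 8 * (C * (1 + sqrt \<bar>d\<bar>) ^ 4)" using n3 by (simp add: power_mult_distrib)
      finally show "8 / n3 ^ 4 * (C * fluct_scale \<rho> N ^ 4) + 8 * (22 * d\<^sup>2) ^ 4 * 1 \<le> C'" by (simp add: C'_def)
    qed
    finally show ?case by (simp only: \<rho>_def)
  qed
  ultimately show ?thesis by (rule that)
qed

lemma Q_point_0: "Q_point N 0 = (N, N)"
  by (simp add: Q_point_def round_point_def)

text \<open>This uses the assumed convergence for \<open>k = 1\<close> and \<open>u = 0\<close>,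
  where the endpoint is \<open>(N, N)\<close>. The fourth moment bound upgrades weak convergence to
  convergence of variances, and the centring drops out of them.\<close>

lemma stationary_variance_limit:
  assumes lim: "half_space_stationary_limit d P A"
  shows "(\<lambda>N. prob_space.variance iid_env (stat_lpp (rho_crit d N) N) / (height_scale N)\<^sup>2) \<longlonglongrightarrow> prob_space.variance P (A 0)"
proof -
  interpret prob_space iid_env by (rule prob_space_iid_env)
  define Z where "Z N E = (stat_lpp (rho_crit d N) N E - 4 * real N) / height_scale N" for N E
  have [measurable]: "Z N \<in> borel_measurable iid_env" for N unfolding Z_def by measurable
  have P: "prob_space P" and A: "A 0 \<in> borel_measurable P"
    using lim by (auto simp: half_space_stationary_limit_def)
  obtain C where C: "0 \<le> C" "\<forall>\<^sub>F N in sequentially. envint (\<lambda>E. ennreal (Z N E ^ 4)) \<le> ennreal C"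
    using rescaled_fourth_moment[of d, folded Z_def] by blast
  have "(\<lambda>N. variance (Z N)) \<longlonglongrightarrow> prob_space.variance P (A 0)"
  proof (rule weak_limit_variance[OF prob_space_iid_env P _ A C(2,1)])
    fix g :: "real \<Rightarrow> real" assume g: "continuous_on UNIV g" "bounded (range g)"
    have [measurable]: "g \<in> borel_measurable borel" by (rule borel_measurable_continuous_onI[OF g(1)])
    define f where "f h = g (h 0)" for h :: "nat \<Rightarrow> real"
    have f: "continuous_on UNIV f" "bounded (range f)"
    proof -
      have c: "continuous_on UNIV (\<lambda>h :: nat \<Rightarrow> real. h 0)" by (rule continuous_on_product_coordinates)
      show "continuous_on UNIV f"
        unfolding f_def by (rule continuous_on_compose2[OF g(1) c subset_UNIV])
      show "bounded (range f)" by (rule bounded_subset[OF g(2)]) (auto simp: f_def)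
    qed
    have "(\<lambda>N. \<integral>\<omega>. f (\<lambda>i. if i < 1 then rescaled_space N 0 \<omega> else 0) \<partial>stationary_env (rho_crit d N))
        \<longlonglongrightarrow> (\<integral>x. f (\<lambda>i. if i < 1 then A 0 x else 0) \<partial>P)"
      using lim[unfolded half_space_stationary_limit_def, THEN conjunct2, THEN conjunct2, rule_format,
          of 1 "\<lambda>_. 0" f] f by simp
    then have "(\<lambda>N. \<integral>\<omega>. g (rescaled_space N 0 \<omega>) \<partial>stationary_env (rho_crit d N)) \<longlonglongrightarrow> (\<integral>x. g (A 0 x) \<partial>P)"
      by (simp add: f_def)
    moreover have "\<forall>\<^sub>F N in sequentially.
        (\<integral>\<omega>. g (rescaled_space N 0 \<omega>) \<partial>stationary_env (rho_crit d N)) = (\<integral>E. g (Z N E) \<partial>iid_env)"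
      using eventually_rho_crit[of d]
    proof eventually_elim
      case (elim N)
      have "(\<integral>\<omega>. (\<lambda>a b. g ((a - 4 * real N) / height_scale N)) (last_passage \<omega> (0, 0) (N, N)) (last_passage \<omega> (0, 0) (N, N)) \<partial>stationary_env (rho_crit d N))
        = (\<integral>E. (\<lambda>a b. g ((a - 4 * real N) / height_scale N)) (stat_lpp (rho_crit d N) N E) (stat_lpp (rho_crit d N) N E) \<partial>iid_env)"
        by (rule integral_stationary_env) (use elim in auto)
      then show ?case by (simp add: rescaled_space_def Q_point_0 Z_def height_scale_def)
    qed
    ultimately show "(\<lambda>N. \<integral>E. g (Z N E) \<partial>iid_env) \<longlonglongrightarrow> (\<integral>x. g (A 0 x) \<partial>P)"
      by (simp add: tendsto_cong)
  qed measurable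
  moreover have "\<forall>\<^sub>F N in sequentially. variance (Z N) = variance (stat_lpp (rho_crit d N) N) / (height_scale N)\<^sup>2"
    using eventually_rho_crit[of d]
  proof eventually_elim
    case (elim N)
    show ?case unfolding Z_def by (rule variance_affine) (use integrable_stat_lpp(2) elim in auto)
  qed
  ultimately show ?thesis by (simp add: tendsto_cong)
qed

lemma stat_lpp_increment_variance:
  assumes \<rho>: "0 < \<rho>" "\<rho> < 1" and mn: "m \<le> n"
  shows "prob_space.variance iid_env (\<lambda>E. stat_lpp \<rho> n E - stat_lpp \<rho> m E)
       = prob_space.variance iid_env (stat_lpp \<rho> (n - m))"
proof -
  define X where "X E = stat_lpp \<rho> n E - stat_lpp \<rho> m E" for E
  define Y where "Y = stat_lpp \<rho> (n - m)"
  have [measurable]: "X \<in> borel_measurable iid_env" "Y \<in> borel_measurable iid_env"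
    unfolding X_def Y_def by measurable
  have "distr iid_env borel X = distr iid_env borel Y"
  proof (rule measure_eqI)
    fix B assume "B \<in> sets (distr iid_env borel X)"
    then have [measurable]: "B \<in> sets borel" by simp
    have em: "emeasure (distr iid_env borel Z) B = envint (\<lambda>E. indicator B (Z E))"
      if "Z \<in> borel_measurable iid_env" for Z
      using nn_integral_distr[OF that, of "indicator B"] by simp
    have "emeasure (distr iid_env borel X) B = envint (\<lambda>E. indicator B (X E))"
      by (rule em) simp
    also have "\<dots> = envint (\<lambda>E. indicator B (Y E))"
      using diag_lpp_stationary_increments[of "\<lambda>z. indicator B z" "1 / (1 - \<rho>)" "1 / \<rho>" m "n - m"] \<rho> mn
      by (simp add: X_def Y_def stat_lpp_def)
    also have "\<dots> = emeasure (distr iid_env borel Y) B"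
      by (rule em[symmetric]) simp
    finally show "emeasure (distr iid_env borel X) B = emeasure (distr iid_env borel Y) B" .
  qed simp
  then have eq: "(\<integral>E. f (X E) \<partial>iid_env) = (\<integral>E. f (Y E) \<partial>iid_env)"
    if "f \<in> borel_measurable borel" for f :: "real \<Rightarrow> real"
    using that integral_distr[of X iid_env borel f] integral_distr[of Y iid_env borel f] by simp
  have mean: "(\<integral>E. X E \<partial>iid_env) = (\<integral>E. Y E \<partial>iid_env)" using eq[of "\<lambda>z. z"] by simp
  show ?thesis
    using eq[of "\<lambda>z. (z - (\<integral>E. Y E \<partial>iid_env))\<^sup>2"] mean by (simp add: X_def[abs_def] Y_def)
qed

lemma weight_second_moment:
  assumes p: "p \<in> half_space"
  shows "integrable iid_env (\<lambda>E. (E p)\<^sup>2)" "(\<integral>E. (E p)\<^sup>2 \<partial>iid_env) \<le> 1537"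
proof -
  interpret prob_space iid_env by (rule prob_space_iid_env)
  note int = integrable_powers_of_fourth_moment[OF measurable_iid_env_component[OF p] nn_integral_weight_pow4[OF p]]
  show "integrable iid_env (\<lambda>E. (E p)\<^sup>2)" by (rule int)
  have "ennreal (\<integral>E. E p ^ 4 \<partial>iid_env) \<le> ennreal 1536"
    using nn_integral_weight_pow4[OF p] by (subst nn_integral_eq_integral[OF int(1), symmetric]) auto
  then have "(\<integral>E. E p ^ 4 \<partial>iid_env) \<le> 1536" by (simp only: ennreal_le_iff)
  moreover have "z\<^sup>2 \<le> 1 + z ^ 4" for z :: real
  proof -
    have "0 \<le> (z\<^sup>2 - 1 / 2)\<^sup>2" by simp
    also have "\<dots> = z ^ 4 - z\<^sup>2 + 1 / 4" by (simp add: power2_eq_square power4_eq_xxxx algebra_simps)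
    finally show ?thesis by simp
  qed
  then have "(\<integral>E. (E p)\<^sup>2 \<partial>iid_env) \<le> (\<integral>E. 1 + E p ^ 4 \<partial>iid_env)"
    using int by (intro integral_mono) auto
  ultimately show "(\<integral>E. (E p)\<^sup>2 \<partial>iid_env) \<le> 1537" using int by (simp add: prob_space)
qed

text \<open>Cauchy-Schwarz applied to \<open>lpp_lipschitz\<close>. The reciprocal has Lipschitz
  constant 16 on numbers above \<open>1/4\<close>, and
  \<open>16\<^sup>2 * 2 * (1537 + 1537) = 1573888\<close>.\<close>

lemma stat_lpp_parameter_lipschitz:
  assumes \<rho>: "1 / 4 \<le> \<rho>" "\<rho> \<le> 3 / 4" and \<rho>': "1 / 4 \<le> \<rho>'" "\<rho>' \<le> 3 / 4"
  shows "integrable iid_env (\<lambda>E. (stat_lpp \<rho> n E - stat_lpp \<rho>' n E)\<^sup>2)"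
    and "(\<integral>E. (stat_lpp \<rho> n E - stat_lpp \<rho>' n E)\<^sup>2 \<partial>iid_env) \<le> 1573888 * (\<bar>\<rho> - \<rho>'\<bar> * n)\<^sup>2"
proof -
  define r where "r = 16 * \<bar>\<rho> - \<rho>'\<bar>"
  define Q where "Q E = (\<Sum>k=1..n. (E (k, 0))\<^sup>2 + (E (k, k))\<^sup>2)" for E :: "nat \<times> nat \<Rightarrow> real"
  have hs: "(k, 0) \<in> half_space" "(k, k) \<in> half_space" for k by (auto simp: half_space_def)
  have gap: "\<bar>1 / s - 1 / t\<bar> \<le> 16 * \<bar>s - t\<bar>" if "1 / 4 \<le> s" "1 / 4 \<le> t" for s t :: real
  proof -
    have "1 / s - 1 / t = (t - s) / (s * t)" using that by (simp add: field_simps)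
    then have "\<bar>1 / s - 1 / t\<bar> = \<bar>s - t\<bar> / (s * t)" using that by (simp add: abs_mult)
    also have "\<dots> \<le> \<bar>s - t\<bar> / (1 / 4 * (1 / 4))" using that by (intro divide_left_mono mult_mono) auto
    finally show ?thesis by simp
  qed
  have pw: "(stat_lpp \<rho> n E - stat_lpp \<rho>' n E)\<^sup>2 \<le> r\<^sup>2 * (2 * n) * Q E" for E
  proof -
    have "\<bar>stat_lpp \<rho> n E - stat_lpp \<rho>' n E\<bar>
        \<le> \<bar>1 / (1 - \<rho>) - 1 / (1 - \<rho>')\<bar> * (\<Sum>k=1..n. \<bar>E (k, 0)\<bar>) + \<bar>1 / \<rho> - 1 / \<rho>'\<bar> * (\<Sum>k=1..n. \<bar>E (k, k)\<bar>)"
      unfolding stat_lpp_def diag_lpp_def by (rule lpp_lipschitz) simp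
    also have "\<dots> \<le> r * (\<Sum>k=1..n. \<bar>E (k, 0)\<bar>) + r * (\<Sum>k=1..n. \<bar>E (k, k)\<bar>)"
      using gap[of "1 - \<rho>" "1 - \<rho>'"] gap[of \<rho> \<rho>'] \<rho> \<rho>'
      by (intro add_mono mult_right_mono) (auto simp: r_def abs_minus_commute intro!: sum_nonneg)
    also have "\<dots> = r * (\<Sum>k=1..n. \<bar>E (k, 0)\<bar> + \<bar>E (k, k)\<bar>)" by (simp add: sum.distrib distrib_left)
    finally have "\<bar>stat_lpp \<rho> n E - stat_lpp \<rho>' n E\<bar>\<^sup>2 \<le> (r * (\<Sum>k=1..n. \<bar>E (k, 0)\<bar> + \<bar>E (k, k)\<bar>))\<^sup>2"
      by (rule power_mono) simp
    also have "\<dots> = r\<^sup>2 * (\<Sum>k=1..n. \<bar>E (k, 0)\<bar> + \<bar>E (k, k)\<bar>)\<^sup>2" by (rule power_mult_distrib)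
    also have "\<dots> \<le> r\<^sup>2 * ((\<Sum>k=1..n. (\<bar>E (k, 0)\<bar> + \<bar>E (k, k)\<bar>)\<^sup>2) * card {1..n})"
      by (intro mult_left_mono sum_squared_le_sum_of_squares) auto
    also have "\<dots> \<le> r\<^sup>2 * ((\<Sum>k=1..n. 2 * ((E (k, 0))\<^sup>2 + (E (k, k))\<^sup>2)) * card {1..n})"
    proof (intro mult_left_mono mult_right_mono sum_mono)
      fix k
      show "(\<bar>E (k, 0)\<bar> + \<bar>E (k, k)\<bar>)\<^sup>2 \<le> 2 * ((E (k, 0))\<^sup>2 + (E (k, k))\<^sup>2)"
        using sum_squares_bound[of "\<bar>E (k, 0)\<bar>" "\<bar>E (k, k)\<bar>"] by (simp add: power2_sum)
    qed auto
    also have "\<dots> = r\<^sup>2 * (2 * n) * Q E" by (simp only: Q_def sum_distrib_left[symmetric]) simp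
    finally show ?thesis by simp
  qed
  have intQ: "integrable iid_env Q"
    unfolding Q_def by (intro Bochner_Integration.integrable_sum Bochner_Integration.integrable_add weight_second_moment hs)
  show int: "integrable iid_env (\<lambda>E. (stat_lpp \<rho> n E - stat_lpp \<rho>' n E)\<^sup>2)"
  proof (rule Bochner_Integration.integrable_bound[OF integrable_mult_right[OF intQ, of "r\<^sup>2 * (2 * n)"]])
    show "AE E in iid_env. norm ((stat_lpp \<rho> n E - stat_lpp \<rho>' n E)\<^sup>2) \<le> norm (r\<^sup>2 * (2 * n) * Q E)"
    proof (rule AE_I2)
      fix E
      show "norm ((stat_lpp \<rho> n E - stat_lpp \<rho>' n E)\<^sup>2) \<le> norm (r\<^sup>2 * (2 * n) * Q E)"
        unfolding real_norm_def abs_of_nonneg[OF zero_le_power2] by (rule order_trans[OF pw abs_ge_self])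
    qed
  qed measurable
  have "(\<integral>E. Q E \<partial>iid_env) = (\<Sum>k=1..n. (\<integral>E. (E (k, 0))\<^sup>2 \<partial>iid_env) + (\<integral>E. (E (k, k))\<^sup>2 \<partial>iid_env))"
    unfolding Q_def using weight_second_moment(1) hs
    by (subst Bochner_Integration.integral_sum) (auto intro!: sum.cong)
  also have "\<dots> \<le> (\<Sum>k=1..n. 1537 + 1537)" by (intro sum_mono add_mono weight_second_moment hs)
  finally have Q_le: "(\<integral>E. Q E \<partial>iid_env) \<le> 3074 * n" by simp
  have "(\<integral>E. (stat_lpp \<rho> n E - stat_lpp \<rho>' n E)\<^sup>2 \<partial>iid_env) \<le> (\<integral>E. r\<^sup>2 * (2 * n) * Q E \<partial>iid_env)"
    by (rule integral_mono[OF int integrable_mult_right[OF intQ] pw])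
  also have "\<dots> = r\<^sup>2 * (2 * n) * (\<integral>E. Q E \<partial>iid_env)" by simp
  also have "\<dots> \<le> r\<^sup>2 * (2 * n) * (3074 * n)" by (intro mult_left_mono Q_le) auto
  also have "\<dots> = 1573888 * (\<bar>\<rho> - \<rho>'\<bar> * n)\<^sup>2"
    by (simp add: r_def power_mult_distrib power2_eq_square[of "real n"])
  finally show "(\<integral>E. (stat_lpp \<rho> n E - stat_lpp \<rho>' n E)\<^sup>2 \<partial>iid_env) \<le> 1573888 * (\<bar>\<rho> - \<rho>'\<bar> * n)\<^sup>2" .
qed

text \<open>If \<open>n = \<kappa> * N\<close> exactly, then
  \<open>\<kappa> powr (1/3) * n powr (- (1/3)) = N powr (- (1/3))\<close> and the parameters
  coincide; this is the origin of the rescaled \<open>\<delta>\<close> in the limit. Rounding moves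
  the ratio \<open>t\<close> from 1 by at most \<open>1 / n\<close>, and its cube root by no
  more.\<close>

lemma rho_crit_time_change:
  assumes \<kappa>: "0 < \<kappa>" and n: "1 \<le> n" "1 \<le> N" "\<bar>real n - \<kappa> * real N\<bar> \<le> 1"
  shows "\<bar>rho_crit \<delta> N - rho_crit (\<delta> * \<kappa> powr (1 / 3)) n\<bar> * n \<le> \<bar>\<delta>\<bar>"
proof -
  define t where "t = \<kappa> * real N / real n"
  define c where "c = 2 powr (- (4 / 3)) * real N powr (- (1 / 3))"
  have t: "0 < t" using \<kappa> n by (simp add: t_def)
  have c: "0 \<le> c" "c \<le> 1"
    using powr_mono[of "- (4 / 3)" 0 "2::real"] powr_mono[of "- (1 / 3)" 0 "real N"] n
    by (auto simp: c_def intro!: mult_le_one)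
  have "\<kappa> powr (1 / 3) * real n powr (- (1 / 3)) = real N powr (- (1 / 3)) * t powr (1 / 3)"
    using \<kappa> n by (simp add: t_def powr_divide powr_mult powr_minus_divide)
  then have "rho_crit \<delta> N - rho_crit (\<delta> * \<kappa> powr (1 / 3)) n = \<delta> * c * (1 - t powr (1 / 3))"
    by (simp add: rho_crit_def c_def algebra_simps)
  then have "\<bar>rho_crit \<delta> N - rho_crit (\<delta> * \<kappa> powr (1 / 3)) n\<bar> * n = \<bar>\<delta>\<bar> * c * (\<bar>1 - t powr (1 / 3)\<bar> * n)"
    using c by (simp add: abs_mult)
  also have "\<bar>1 - t powr (1 / 3)\<bar> * n \<le> 1"
  proof -
    have "\<bar>1 - t powr (1 / 3)\<bar> \<le> \<bar>1 - t\<bar>"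
    proof (cases "t \<le> 1")
      case True
      then have "t powr 1 \<le> t powr (1 / 3)" "t powr (1 / 3) \<le> 1"
        using t powr_mono'[of "1 / 3" 1 t] by (auto intro: powr_le1)
      then show ?thesis using t True by simp
    next
      case False
      then have "t powr (1 / 3) \<le> t powr 1" "1 \<le> t powr (1 / 3)"
        using powr_mono[of "1 / 3" 1 t] by (auto intro: ge_one_powr_ge_zero)
      then show ?thesis using t False by simp
    qed
    then have "\<bar>1 - t powr (1 / 3)\<bar> * n \<le> \<bar>1 - t\<bar> * n" by (rule mult_right_mono) simp
    also have "\<dots> = \<bar>(1 - t) * n\<bar>" by (simp add: abs_mult)
    also have "(1 - t) * n = real n - \<kappa> * real N" using n by (simp add: t_def left_diff_distrib)
    also have "\<bar>\<dots>\<bar> \<le> 1" by (rule n)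
    finally show ?thesis .
  qed
  then have "\<bar>\<delta>\<bar> * c * (\<bar>1 - t powr (1 / 3)\<bar> * n) \<le> \<bar>\<delta>\<bar> * 1 * 1"
    using c by (intro mult_mono) auto
  finally show ?thesis by simp
qed

text \<open>\<open>U\<close> is the passage time at the parameter critical for its own length,
  measured on the scale of \<open>N\<close>; the ratio of the scales produces
  \<open>\<kappa> powr (2/3)\<close>. \<open>D\<close> is the effect of the mismatch of parameters,
  bounded in mean square before the division by the height scale and hence negligible.\<close>

lemma scaled_variance_limit:
  assumes lim: "half_space_stationary_limit (\<delta> * \<kappa> powr (1 / 3)) P A"
    and \<kappa>: "0 < \<kappa>" and n: "\<And>N. \<bar>real (n N) - \<kappa> * real N\<bar> \<le> 1"
  shows "(\<lambda>N. prob_space.variance iid_env (stat_lpp (rho_crit \<delta> N) (n N)) / (height_scale N)\<^sup>2)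
     \<longlonglongrightarrow> \<kappa> powr (2 / 3) * prob_space.variance P (A 0)"
proof -
  interpret prob_space iid_env by (rule prob_space_iid_env)
  define d where "d = \<delta> * \<kappa> powr (1 / 3)"
  have n_lower: "\<kappa> * real N - 1 \<le> real (n N)" for N using n[of N] by linarith
  have n_top: "filterlim n sequentially sequentially"
  proof -
    have "filterlim (\<lambda>N. \<kappa> * real N - 1) at_top sequentially"
      using filterlim_tendsto_add_at_top[OF tendsto_const[of "- 1"]
          filterlim_tendsto_pos_mult_at_top[OF tendsto_const \<kappa> filterlim_real_sequentially]]
      by simp
    then have "filterlim (\<lambda>N. real (n N)) at_top sequentially"
      by (rule filterlim_at_top_mono) (use n_lower in auto)
    then show ?thesis by (simp add: filterlim_sequentially_iff_filterlim_real)
  qed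
  have ratio: "(\<lambda>N. real (n N) / real N) \<longlonglongrightarrow> \<kappa>"
  proof -
    have "(\<lambda>N. real (n N) / real N - \<kappa>) \<longlonglongrightarrow> 0"
    proof (rule Lim_null_comparison)
      show "\<forall>\<^sub>F N in sequentially. norm (real (n N) / real N - \<kappa>) \<le> 1 / real N"
        using eventually_ge_at_top[of 1]
      proof eventually_elim
        case (elim N)
        have "real (n N) / real N - \<kappa> = (real (n N) - \<kappa> * real N) / real N" using elim by (simp add: field_simps)
        then show ?case using n[of N] elim by (simp add: divide_right_mono)
      qed
      show "(\<lambda>N. 1 / real N) \<longlonglongrightarrow> 0" by (rule lim_1_over_n)
    qed
    from tendsto_add[OF this tendsto_const[of \<kappa>]] show ?thesis by simp
  qed
  have large: "\<forall>\<^sub>F N in sequentially. 1 \<le> N \<and> 1 \<le> n N \<and> 1 / 4 \<le> rho_crit \<delta> N \<and> rho_crit \<delta> N \<le> 3 / 4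
      \<and> 1 / 4 \<le> rho_crit d (n N) \<and> rho_crit d (n N) \<le> 3 / 4"
    using eventually_rho_crit[of \<delta>] filterlim_iff[THEN iffD1, OF n_top, rule_format, OF eventually_rho_crit[of d]]
      filterlim_iff[THEN iffD1, OF n_top, rule_format, OF eventually_ge_at_top[of 1]] eventually_ge_at_top[of 1]
    by eventually_elim auto
  \<comment> \<open>The \<open>- 0\<close> matches the form of
    \<open>variance_affine\<close>.\<close>
  define U where "U N E = (stat_lpp (rho_crit d (n N)) (n N) E - 0) / height_scale N" for N E
  define D where "D N E = (stat_lpp (rho_crit \<delta> N) (n N) E - stat_lpp (rho_crit d (n N)) (n N) E) / height_scale N" for N E
  have [measurable]: "U N \<in> borel_measurable iid_env" "D N \<in> borel_measurable iid_env" for N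
    unfolding U_def D_def by measurable
  have hs0: "(\<lambda>N. 1573888 * \<delta>\<^sup>2 / (height_scale N)\<^sup>2) \<longlonglongrightarrow> 0"
  proof -
    have "(\<lambda>N. 1573888 * \<delta>\<^sup>2 / (2 powr (4 / 3))\<^sup>2 * real N powr (- (2 / 3))) \<longlonglongrightarrow> 1573888 * \<delta>\<^sup>2 / (2 powr (4 / 3))\<^sup>2 * 0"
      by (intro tendsto_mult tendsto_const tendsto_neg_powr filterlim_real_sequentially) simp
    moreover have "1573888 * \<delta>\<^sup>2 / (height_scale N)\<^sup>2 = 1573888 * \<delta>\<^sup>2 / (2 powr (4 / 3))\<^sup>2 * real N powr (- (2 / 3))" for N
    proof -
      have "(height_scale N)\<^sup>2 = (2 powr (4 / 3))\<^sup>2 * real N powr (2 / 3)"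
        by (simp add: height_scale_def power_mult_distrib power2_eq_square[of "real N powr (1 / 3)"] powr_add[symmetric])
      then show ?thesis by (simp add: powr_minus_divide)
    qed
    ultimately show ?thesis by simp
  qed
  have "(\<lambda>N. variance (\<lambda>E. U N E + D N E)) \<longlonglongrightarrow> \<kappa> powr (2 / 3) * prob_space.variance P (A 0)"
  proof (rule variance_perturbation[OF _ _ _ _ _ hs0])
    show "\<forall>\<^sub>F N in sequentially. integrable iid_env (\<lambda>E. (U N E)\<^sup>2)"
      using large by eventually_elim (auto simp: U_def power_divide intro!: integrable_stat_lpp)
    show "\<forall>\<^sub>F N in sequentially. integrable iid_env (\<lambda>E. (D N E)\<^sup>2) \<and> expectation (\<lambda>E. (D N E)\<^sup>2) \<le> 1573888 * \<delta>\<^sup>2 / (height_scale N)\<^sup>2"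
      using large
    proof eventually_elim
      case (elim N)
      note L = stat_lpp_parameter_lipschitz[of "rho_crit \<delta> N" "rho_crit d (n N)" "n N"]
      have "\<bar>rho_crit \<delta> N - rho_crit d (n N)\<bar> * n N \<le> \<bar>\<delta>\<bar>"
        unfolding d_def by (rule rho_crit_time_change[OF \<kappa> _ _ n]) (use elim in auto)
      then have "(\<bar>rho_crit \<delta> N - rho_crit d (n N)\<bar> * n N)\<^sup>2 \<le> \<bar>\<delta>\<bar>\<^sup>2" by (intro power_mono) auto
      then have "expectation (\<lambda>E. (stat_lpp (rho_crit \<delta> N) (n N) E - stat_lpp (rho_crit d (n N)) (n N) E)\<^sup>2) \<le> 1573888 * \<delta>\<^sup>2"
        using L(2) elim by simp
      then show ?case using L(1) elim by (simp add: D_def power_divide divide_right_mono)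
    qed
    have "(\<lambda>N. prob_space.variance iid_env (stat_lpp (rho_crit d (n N)) (n N)) / (height_scale (n N))\<^sup>2 * (real (n N) / real N) powr (2 / 3))
       \<longlonglongrightarrow> prob_space.variance P (A 0) * \<kappa> powr (2 / 3)"
      using filterlim_compose[OF stationary_variance_limit[OF lim[folded d_def]] n_top] \<kappa>
      by (intro tendsto_mult tendsto_powr[OF ratio tendsto_const]) auto
    moreover have "\<forall>\<^sub>F N in sequentially. prob_space.variance iid_env (stat_lpp (rho_crit d (n N)) (n N)) / (height_scale (n N))\<^sup>2 * (real (n N) / real N) powr (2 / 3)
        = variance (U N)"
      using large
    proof eventually_elim
      case (elim N)
      have pos: "0 < height_scale N" "0 < height_scale (n N)" using elim by (auto simp: height_scale_pos)
      have "height_scale (n N) = (real (n N) / real N) powr (1 / 3) * height_scale N"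
        using elim by (simp add: height_scale_def powr_divide)
      then have "(height_scale (n N))\<^sup>2 = (real (n N) / real N) powr (2 / 3) * (height_scale N)\<^sup>2"
        by (simp add: power_mult_distrib power2_eq_square powr_add[symmetric])
      moreover have "variance (U N) = variance (stat_lpp (rho_crit d (n N)) (n N)) / (height_scale N)\<^sup>2"
        unfolding U_def by (rule variance_affine) (use elim integrable_stat_lpp in auto)
      ultimately show ?case using pos elim by simp
    qed
    ultimately show "(\<lambda>N. variance (U N)) \<longlonglongrightarrow> \<kappa> powr (2 / 3) * prob_space.variance P (A 0)"
      by (simp add: tendsto_cong mult.commute)
  qed measurable
  moreover have "\<forall>\<^sub>F N in sequentially. variance (\<lambda>E. U N E + D N E) = variance (stat_lpp (rho_crit \<delta> N) (n N)) / (height_scale N)\<^sup>2"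
    using large
  proof eventually_elim
    case (elim N)
    have "U N E + D N E = (stat_lpp (rho_crit \<delta> N) (n N) E - 0) / height_scale N" for E
      by (simp add: U_def D_def add_divide_distrib[symmetric])
    then show ?case using variance_affine[of "stat_lpp (rho_crit \<delta> N) (n N)" 0 "height_scale N"] integrable_stat_lpp elim by simp
  qed
  ultimately show ?thesis by (simp add: tendsto_cong)
qed

theorem theorem2p1:
  fixes \<delta> \<tau> :: real
    and P :: "real \<Rightarrow> 'a measure"
    and A :: "real \<Rightarrow> real \<Rightarrow> 'a \<Rightarrow> real"
  assumes limit_process: "\<And>d. half_space_stationary_limit d (P d) (A d)"
    and tau: "0 < \<tau>" "\<tau> < 1"
  shows "(\<lambda>N. covariance (stationary_env (rho_crit \<delta> N)) (rescaled_time N 1) (rescaled_time N \<tau>))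
    \<longlonglongrightarrow>
      1 / 2 * prob_space.variance (P \<delta>) (A \<delta> 0)
    + 1 / 2 * \<tau> powr (2 / 3)
        * prob_space.variance (P (\<delta> * \<tau> powr (1 / 3))) (A (\<delta> * \<tau> powr (1 / 3)) 0)
    - 1 / 2 * (1 - \<tau>) powr (2 / 3)
        * prob_space.variance (P (\<delta> * (1 - \<tau>) powr (1 / 3))) (A (\<delta> * (1 - \<tau>) powr (1 / 3)) 0)"
proof -
  interpret prob_space iid_env by (rule prob_space_iid_env)
  define n where "n N = nat \<lfloor>\<tau> * real N\<rfloor>" for N
  have floor: "real (n N) \<le> \<tau> * real N" "\<tau> * real N - 1 \<le> real (n N)" for N
  proof -
    have "0 \<le> \<tau> * real N" using tau by simp
    then have "real (n N) = of_int \<lfloor>\<tau> * real N\<rfloor>" by (simp add: n_def)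
    then show "real (n N) \<le> \<tau> * real N" "\<tau> * real N - 1 \<le> real (n N)" by linarith+
  qed
  have n_le: "n N \<le> N" for N
  proof -
    have "\<tau> * real N \<le> 1 * real N" using tau by (intro mult_right_mono) auto
    then show ?thesis using floor(1)[of N] by linarith
  qed
  define v where "v k N = variance (stat_lpp (rho_crit \<delta> N) k) / (height_scale N)\<^sup>2" for k N
  have "(\<lambda>N. 1 / 2 * v N N + 1 / 2 * v (n N) N - 1 / 2 * v (N - n N) N) \<longlonglongrightarrow>
      1 / 2 * prob_space.variance (P \<delta>) (A \<delta> 0)
    + 1 / 2 * (\<tau> powr (2 / 3)
        * prob_space.variance (P (\<delta> * \<tau> powr (1 / 3))) (A (\<delta> * \<tau> powr (1 / 3)) 0))
    - 1 / 2 * ((1 - \<tau>) powr (2 / 3)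
        * prob_space.variance (P (\<delta> * (1 - \<tau>) powr (1 / 3))) (A (\<delta> * (1 - \<tau>) powr (1 / 3)) 0))"
    unfolding v_def
  proof (intro tendsto_diff tendsto_add tendsto_mult_left)
    show "(\<lambda>N. variance (stat_lpp (rho_crit \<delta> N) N) / (height_scale N)\<^sup>2) \<longlonglongrightarrow> prob_space.variance (P \<delta>) (A \<delta> 0)"
      by (rule stationary_variance_limit) (rule limit_process)
    show "(\<lambda>N. variance (stat_lpp (rho_crit \<delta> N) (n N)) / (height_scale N)\<^sup>2) \<longlonglongrightarrow>
        \<tau> powr (2 / 3) * prob_space.variance (P (\<delta> * \<tau> powr (1 / 3))) (A (\<delta> * \<tau> powr (1 / 3)) 0)"
    proof (rule scaled_variance_limit[OF limit_process tau(1)])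
      fix N
      show "\<bar>real (n N) - \<tau> * real N\<bar> \<le> 1" using floor[of N] by linarith
    qed
    show "(\<lambda>N. variance (stat_lpp (rho_crit \<delta> N) (N - n N)) / (height_scale N)\<^sup>2) \<longlonglongrightarrow>
        (1 - \<tau>) powr (2 / 3) * prob_space.variance (P (\<delta> * (1 - \<tau>) powr (1 / 3))) (A (\<delta> * (1 - \<tau>) powr (1 / 3)) 0)"
    proof (rule scaled_variance_limit[OF limit_process])
      fix N
      \<comment> \<open>The difference \<open>N - n N\<close> is a ceiling of
        \<open>(1 - \<tau>) * N\<close>, which is why \<open>scaled_variance_limit\<close> admits
        any rounding within 1.\<close>
      have eq: "real (N - n N) - (1 - \<tau>) * real N = \<tau> * real N - real (n N)"
        using n_le[of N] by (simp add: of_nat_diff algebra_simps)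
      show "\<bar>real (N - n N) - (1 - \<tau>) * real N\<bar> \<le> 1" unfolding eq using floor[of N] by linarith
    qed (use tau in simp)
  qed
  moreover have "\<forall>\<^sub>F N in sequentially. 1 / 2 * v N N + 1 / 2 * v (n N) N - 1 / 2 * v (N - n N) N
      = covariance (stationary_env (rho_crit \<delta> N)) (rescaled_time N 1) (rescaled_time N \<tau>)"
    using eventually_rho_crit[of \<delta>]
  proof eventually_elim
    case (elim N)
    define \<rho> where "\<rho> = rho_crit \<delta> N"
    have \<rho>: "1 / 4 \<le> \<rho>" "\<rho> \<le> 3 / 4" "0 < \<rho>" "\<rho> < 1" using elim by (auto simp: \<rho>_def)
    define X where "X E = (stat_lpp \<rho> N E - 4 * real N) / height_scale N" for E
    define Y where "Y E = (stat_lpp \<rho> (n N) E - 4 * \<tau> * real N) / height_scale N" for E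
    have [measurable]: "X \<in> borel_measurable iid_env" "Y \<in> borel_measurable iid_env"
      unfolding X_def Y_def by measurable
    have rt: "rescaled_time N 1 = (\<lambda>\<omega>. (last_passage \<omega> (0, 0) (N, N) - 4 * real N) / height_scale N)"
      "rescaled_time N \<tau> = (\<lambda>\<omega>. (last_passage \<omega> (0, 0) (n N, n N) - 4 * \<tau> * real N) / height_scale N)"
      by (auto simp: rescaled_time_def round_point_def height_scale_def n_def)
    have env: "(\<integral>\<omega>. f (rescaled_time N 1 \<omega>) (rescaled_time N \<tau> \<omega>) \<partial>stationary_env \<rho>) = (\<integral>E. f (X E) (Y E) \<partial>iid_env)"
      if f: "(\<lambda>(a, b). f a b) \<in> borel_measurable (borel \<Otimes>\<^sub>M borel)" for f :: "real \<Rightarrow> real \<Rightarrow> real"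
      unfolding rt X_def Y_def
      by (rule integral_stationary_env[OF \<rho>(3,4), where f = "\<lambda>a b. f ((a - 4 * real N) / height_scale N) ((b - 4 * \<tau> * real N) / height_scale N)"])
         (use measurable_compose[OF _ f, of "\<lambda>(a, b). ((a - 4 * real N) / height_scale N, (b - 4 * \<tau> * real N) / height_scale N)" "borel \<Otimes>\<^sub>M borel"] in \<open>simp add: case_prod_beta'\<close>)
    have "covariance (stationary_env \<rho>) (rescaled_time N 1) (rescaled_time N \<tau>) = covariance iid_env X Y"
    proof -
      have "integral\<^sup>L (stationary_env \<rho>) (rescaled_time N 1) = integral\<^sup>L iid_env X"
        using env[of "\<lambda>a b. a"] by simp
      moreover have "integral\<^sup>L (stationary_env \<rho>) (rescaled_time N \<tau>) = integral\<^sup>L iid_env Y"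
        using env[of "\<lambda>a b. b"] by simp
      ultimately show ?thesis
        unfolding covariance_def using env[of "\<lambda>a b. (a - integral\<^sup>L iid_env X) * (b - integral\<^sup>L iid_env Y)"] by simp
    qed
    moreover have "2 * covariance iid_env X Y = variance X + variance Y - variance (\<lambda>E. X E - Y E)"
    proof (rule covariance_polarization)
      show "integrable iid_env (\<lambda>E. (X E)\<^sup>2)" "integrable iid_env (\<lambda>E. (Y E)\<^sup>2)"
        using integrable_stat_lpp[OF \<rho>(1,2)] by (simp_all add: X_def Y_def power_divide power2_diff)
    qed measurable
    moreover have "variance X = v N N" "variance Y = v (n N) N"
      unfolding X_def Y_def v_def \<rho>_def[symmetric]
      by (rule variance_affine, rule integrable_stat_lpp[OF \<rho>(1,2)])+
    \<comment> \<open>The centrings contribute a constant only. The increment behaves like a passage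
      time of length \<open>N - n N\<close> at the unchanged parameter \<open>\<rho>\<close>, so
      \<open>v\<close> keeps parameter and scale tied to \<open>N\<close>.\<close>
    moreover have "variance (\<lambda>E. X E - Y E) = v (N - n N) N"
    proof -
      have "X E - Y E = (stat_lpp \<rho> N E - stat_lpp \<rho> (n N) E - (4 * real N - 4 * \<tau> * real N)) / height_scale N" for E
        by (simp add: X_def Y_def diff_divide_distrib)
      then have "variance (\<lambda>E. X E - Y E) = variance (\<lambda>E. stat_lpp \<rho> N E - stat_lpp \<rho> (n N) E) / (height_scale N)\<^sup>2"
        using variance_affine[of "\<lambda>E. stat_lpp \<rho> N E - stat_lpp \<rho> (n N) E" "4 * real N - 4 * \<tau> * real N" "height_scale N"]
          integrable_stat_lpp[OF \<rho>(1,2)] by simp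
      then show ?thesis
        using stat_lpp_increment_variance[OF \<rho>(3,4) n_le] by (simp add: v_def \<rho>_def)
    qed
    ultimately show ?case by (simp add: \<rho>_def)
  qed
  ultimately show ?thesis by (simp add: tendsto_cong mult.assoc)
qed

end
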